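(* Let $\mathcal{D}$ be any set. Define a coproduct $\delta:\mathit{CP}_+(\mathcal{D})\longrightarrow\mathit{CP}_+(\mathcal{D})\otimes\mathit{CP}_+(\mathcal{D})$ by: for every nonempty $T\in\mathcal{PT}(\mathcal{D})$, $$\delta(T)=\sum_{T'\in\mathcal{S}t(T)}(T\setminus T')\otimes T'.$$ Then, as a preLie algebra, $(\mathit{CP}_+(\mathcal{D}),\bullet)$ is freely generated by $\mathrm{Ker}(\delta)$ (i.e. the preLie morphism from the free preLie algebra on the vector space $\mathrm{Ker}(\delta)$ to $\mathit{CP}_+(\mathcal{D})$ extending the inclusion is an isomorphism).
   Context: $\mathbb{K}$ is a field of characteristic zero. A (right) preLie algebra is a vector space with a bilinear product $\bullet$ such that $(a\bullet b)\bullet c-a\bullet(b\bullet c)=(a\bullet c)\bullet b-a\bullet(c\bullet b)$. A partitioned forest is a (finite) rooted forest $F$ with vertex set $V(F)$, edges oriented from the roots to the leaves, together with a partition of $V(F)$ into blocks such that two vertices in the same block are either both roots or have the same parent. It is a partitioned tree if all its roots lie in one block; the empty forest $\emptyset$ is a partitioned tree. $\mathcal{PT}(\mathcal{D})$ is the set of isomorphism classes of partitioned trees with vertices decorated by $\mathcal{D}$, including $\emptyset$. $\mathit{CP}_+(\mathcal{D})$ is the vector space with basis $\mathcal{PT}(\mathcal{D})\setminus\{\emptyset\}$. Its preLie product is $T\bullet T'=\sum_{s\in V(T)}T\bullet_{s,*}T'$, where $T\bullet_{s,*}T'$ is obtained by adding edges from the vertex $s$ of $T$ to every root of $T'$, keeping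 all blocks of $T$ and $T'$ unchanged. For nonempty $T\in\mathcal{PT}(\mathcal{D})$, $\mathcal{S}t(T)$ is the following family (counted with multiplicity) of partitioned subtrees of $T$: for each root $r$ of $T$ and each block $b$ of $T$ consisting of children of $r$, the partitioned tree $T'$ formed by the vertices of $b$ and all their descendants. $T\setminus T'$ is the partitioned tree obtained from $T$ by deleting all vertices of $T'$. *)

theory Defs
  imports "HOL-Algebra.Algebraic_Closure_Type" "HOL-Library.Poly_Mapping"
    "HOL-Library.Disjoint_Sets"
begin

section \<open>PreLie algebras\<close>

text \<open>
  The base field is a type of class \<^class>\<open>field_char_0\<close>. Vector spaces are modules in the sense
  of \<^theory>\<open>HOL-Algebra.Module\<close>. The field \<open>mult\<close> of the module record is used for
  the preLie product; the field \<open>one\<close> is not used.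
\<close>

abbreviation base_field :: "'k::field_char_0 ring" where
  "base_field \<equiv> ring_of_type_algebra"

locale prelie_algebra = module base_field A for A :: "('k::field_char_0, 'a) module" (structure) +
  assumes prod_closed [simp, intro]:
      "x \<in> carrier A \<Longrightarrow> y \<in> carrier A \<Longrightarrow> x \<otimes> y \<in> carrier A"
    and prod_l_distr:
      "x \<in> carrier A \<Longrightarrow> y \<in> carrier A \<Longrightarrow> z \<in> carrier A \<Longrightarrow>
        (x \<oplus> y) \<otimes> z = x \<otimes> z \<oplus> y \<otimes> z"
    and prod_r_distr:
      "x \<in> carrier A \<Longrightarrow> y \<in> carrier A \<Longrightarrow> z \<in> carrier A \<Longrightarrow>
        z \<otimes> (x \<oplus> y) = z \<otimes> x \<oplus> z \<otimes> y"
    and prod_smult_l: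
      "x \<in> carrier A \<Longrightarrow> y \<in> carrier A \<Longrightarrow> (c \<odot> x) \<otimes> y = c \<odot> (x \<otimes> y)"
    and prod_smult_r:
      "x \<in> carrier A \<Longrightarrow> y \<in> carrier A \<Longrightarrow> x \<otimes> (c \<odot> y) = c \<odot> (x \<otimes> y)"
    and prelie:
      "x \<in> carrier A \<Longrightarrow> y \<in> carrier A \<Longrightarrow> z \<in> carrier A \<Longrightarrow>
        ((x \<otimes> y) \<otimes> z) \<ominus> (x \<otimes> (y \<otimes> z)) = ((x \<otimes> z) \<otimes> y) \<ominus> (x \<otimes> (z \<otimes> y))"

definition linear_hom :: "('k::field_char_0, 'a) module \<Rightarrow> ('k, 'b) module \<Rightarrow> ('a \<Rightarrow> 'b) set" where
  "linear_hom A B = {f \<in> carrier A \<rightarrow> carrier B.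
     (\<forall>x\<in>carrier A. \<forall>y\<in>carrier A. f (x \<oplus>\<^bsub>A\<^esub> y) = f x \<oplus>\<^bsub>B\<^esub> f y) \<and>
     (\<forall>c. \<forall>x\<in>carrier A. f (c \<odot>\<^bsub>A\<^esub> x) = c \<odot>\<^bsub>B\<^esub> f x)}"

definition prelie_hom :: "('k::field_char_0, 'a) module \<Rightarrow> ('k, 'b) module \<Rightarrow> ('a \<Rightarrow> 'b) set" where
  "prelie_hom A B = {f \<in> linear_hom A B.
     \<forall>x\<in>carrier A. \<forall>y\<in>carrier A. f (x \<otimes>\<^bsub>A\<^esub> y) = f x \<otimes>\<^bsub>B\<^esub> f y}"

section \<open>The free preLie algebra on a vector space\<close>

text \<open>
  It is the set of formal expressions in elements of \<open>V\<close>, modulo the smallest congruence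
  that enforces the vector space axioms, bilinearity of the product, the preLie identity and
  linearity of the embedding of \<open>V\<close>. Its universal property is shown below.
\<close>

datatype (gens: 'v, 'k) pl_term =
  Gen 'v
| Zero
| Add "('v, 'k) pl_term" "('v, 'k) pl_term"
| Scale 'k "('v, 'k) pl_term"
| Mul "('v, 'k) pl_term" "('v, 'k) pl_term"

definition pl_terms :: "('k, 'v) module \<Rightarrow> ('v, 'k) pl_term set" where
  "pl_terms V = {t. gens t \<subseteq> carrier V}"

abbreviation Minus :: "('v, 'k::field_char_0) pl_term \<Rightarrow> ('v, 'k) pl_term \<Rightarrow> ('v, 'k) pl_term" where
  "Minus s t \<equiv> Add s (Scale (-1) t)"

inductive_set pl_cong :: "('k::field_char_0, 'v) module \<Rightarrow> ('v, 'k) pl_term rel" for V where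
  refl: "s \<in> pl_terms V \<Longrightarrow> (s, s) \<in> pl_cong V"
| sym: "(s, t) \<in> pl_cong V \<Longrightarrow> (t, s) \<in> pl_cong V"
| trans: "(s, t) \<in> pl_cong V \<Longrightarrow> (t, u) \<in> pl_cong V \<Longrightarrow> (s, u) \<in> pl_cong V"
| cong_Add: "(s, s') \<in> pl_cong V \<Longrightarrow> (t, t') \<in> pl_cong V \<Longrightarrow> (Add s t, Add s' t') \<in> pl_cong V"
| cong_Scale: "(s, s') \<in> pl_cong V \<Longrightarrow> (Scale c s, Scale c s') \<in> pl_cong V"
| cong_Mul: "(s, s') \<in> pl_cong V \<Longrightarrow> (t, t') \<in> pl_cong V \<Longrightarrow> (Mul s t, Mul s' t') \<in> pl_cong V"
| add_assoc: "s \<in> pl_terms V \<Longrightarrow> t \<in> pl_terms V \<Longrightarrow> u \<in> pl_terms V \<Longrightarrow>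
    (Add (Add s t) u, Add s (Add t u)) \<in> pl_cong V"
| add_comm: "s \<in> pl_terms V \<Longrightarrow> t \<in> pl_terms V \<Longrightarrow> (Add s t, Add t s) \<in> pl_cong V"
| add_zero: "s \<in> pl_terms V \<Longrightarrow> (Add Zero s, s) \<in> pl_cong V"
| add_minus: "s \<in> pl_terms V \<Longrightarrow> (Minus s s, Zero) \<in> pl_cong V"
| scale_add_l: "s \<in> pl_terms V \<Longrightarrow>
    (Scale (c + d) s, Add (Scale c s) (Scale d s)) \<in> pl_cong V"
| scale_add_r: "s \<in> pl_terms V \<Longrightarrow> t \<in> pl_terms V \<Longrightarrow>
    (Scale c (Add s t), Add (Scale c s) (Scale c t)) \<in> pl_cong V"
| scale_scale: "s \<in> pl_terms V \<Longrightarrow> (Scale (c * d) s, Scale c (Scale d s)) \<in> pl_cong V"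
| scale_one: "s \<in> pl_terms V \<Longrightarrow> (Scale 1 s, s) \<in> pl_cong V"
| mul_add_l: "s \<in> pl_terms V \<Longrightarrow> t \<in> pl_terms V \<Longrightarrow> u \<in> pl_terms V \<Longrightarrow>
    (Mul (Add s t) u, Add (Mul s u) (Mul t u)) \<in> pl_cong V"
| mul_add_r: "s \<in> pl_terms V \<Longrightarrow> t \<in> pl_terms V \<Longrightarrow> u \<in> pl_terms V \<Longrightarrow>
    (Mul u (Add s t), Add (Mul u s) (Mul u t)) \<in> pl_cong V"
| mul_scale_l: "s \<in> pl_terms V \<Longrightarrow> t \<in> pl_terms V \<Longrightarrow>
    (Mul (Scale c s) t, Scale c (Mul s t)) \<in> pl_cong V"
| mul_scale_r: "s \<in> pl_terms V \<Longrightarrow> t \<in> pl_terms V \<Longrightarrow>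
    (Mul s (Scale c t), Scale c (Mul s t)) \<in> pl_cong V"
| prelie: "s \<in> pl_terms V \<Longrightarrow> t \<in> pl_terms V \<Longrightarrow> u \<in> pl_terms V \<Longrightarrow>
    (Minus (Mul (Mul s t) u) (Mul s (Mul t u)), Minus (Mul (Mul s u) t) (Mul s (Mul u t)))
      \<in> pl_cong V"
| gen_add: "v \<in> carrier V \<Longrightarrow> w \<in> carrier V \<Longrightarrow> v \<oplus>\<^bsub>V\<^esub> w \<in> carrier V \<Longrightarrow>
    (Gen (v \<oplus>\<^bsub>V\<^esub> w), Add (Gen v) (Gen w)) \<in> pl_cong V"
| gen_scale: "v \<in> carrier V \<Longrightarrow> c \<odot>\<^bsub>V\<^esub> v \<in> carrier V \<Longrightarrow>
    (Gen (c \<odot>\<^bsub>V\<^esub> v), Scale c (Gen v)) \<in> pl_cong V"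

definition pl_class :: "('k::field_char_0, 'v) module \<Rightarrow> ('v, 'k) pl_term \<Rightarrow> ('v, 'k) pl_term set" where
  "pl_class V t = pl_cong V `` {t}"

definition free_prelie :: "('k::field_char_0, 'v) module \<Rightarrow> ('k, ('v, 'k) pl_term set) module" where
  "free_prelie V = \<lparr>
     carrier = pl_terms V // pl_cong V,
     monoid.mult = (\<lambda>P Q. \<Union>s\<in>P. \<Union>t\<in>Q. pl_class V (Mul s t)),
     one = undefined,
     zero = pl_class V Zero,
     add = (\<lambda>P Q. \<Union>s\<in>P. \<Union>t\<in>Q. pl_class V (Add s t)),
     module.smult = (\<lambda>c P. \<Union>s\<in>P. pl_class V (Scale c s))\<rparr>"

definition free_gen :: "('k::field_char_0, 'v) module \<Rightarrow> 'v \<Rightarrow> ('v, 'k) pl_term set" where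
  "free_gen V v = pl_class V (Gen v)"

text \<open>
  The morphism \<open>\<phi>\<close> is the preLie morphism extending the inclusion of \<open>S\<close>: it is unique on the
  carrier by \<open>free_prelie_unique\<close> below.
\<close>

definition freely_generated_by :: "('k::field_char_0, 'a) module \<Rightarrow> 'a set \<Rightarrow> bool" where
  "freely_generated_by A S \<longleftrightarrow>
     prelie_algebra A \<and> submodule S base_field A \<and>
     (\<exists>\<phi> \<in> prelie_hom (free_prelie (A\<lparr>carrier := S\<rparr>)) A.
        (\<forall>v\<in>S. \<phi> (free_gen (A\<lparr>carrier := S\<rparr>) v) = v) \<and>
        bij_betw \<phi> (carrier (free_prelie (A\<lparr>carrier := S\<rparr>))) (carrier A))"

subsection \<open>The universal property\<close>

lemma base_field_simps [simp]:
  "carrier base_field = UNIV" "\<zero>\<^bsub>base_field\<^esub> = 0" "\<one>\<^bsub>base_field\<^esub> = 1"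
  "a \<oplus>\<^bsub>base_field\<^esub> b = a + b" "a \<otimes>\<^bsub>base_field\<^esub> b = a * b"
  by (simp_all add: ring_of_type_algebra_def)

lemma pl_terms_simps [simp]:
  "Gen v \<in> pl_terms V \<longleftrightarrow> v \<in> carrier V" "Zero \<in> pl_terms V"
  "Add s t \<in> pl_terms V \<longleftrightarrow> s \<in> pl_terms V \<and> t \<in> pl_terms V"
  "Mul s t \<in> pl_terms V \<longleftrightarrow> s \<in> pl_terms V \<and> t \<in> pl_terms V"
  "Scale c s \<in> pl_terms V \<longleftrightarrow> s \<in> pl_terms V"
  by (auto simp: pl_terms_def)

lemma pl_cong_terms: "(s, t) \<in> pl_cong V \<Longrightarrow> s \<in> pl_terms V \<and> t \<in> pl_terms V"
  by (induction rule: pl_cong.induct) auto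

lemma equiv_pl_cong: "equiv (pl_terms V) (pl_cong V)"
proof (rule equivI)
  show "pl_cong V \<subseteq> pl_terms V \<times> pl_terms V" using pl_cong_terms by fast
qed (auto simp: refl_on_def intro!: symI transI intro: pl_cong.refl pl_cong.sym pl_cong.trans)

lemma pl_class_eq_iff:
  "s \<in> pl_terms V \<Longrightarrow> t \<in> pl_terms V \<Longrightarrow> pl_class V s = pl_class V t \<longleftrightarrow> (s, t) \<in> pl_cong V"
  unfolding pl_class_def by (rule eq_equiv_class_iff[OF equiv_pl_cong])

lemma carrier_free_prelie: "carrier (free_prelie V) = pl_class V ` pl_terms V"
  by (auto simp: free_prelie_def pl_class_def quotient_def)

lemma pl_class_memI: "s \<in> pl_terms V \<Longrightarrow> s \<in> pl_class V s"
  by (simp add: pl_class_def pl_cong.refl)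

lemma pl_class_eqI: "(s, t) \<in> pl_cong V \<Longrightarrow> pl_class V s = pl_class V t"
  using pl_cong_terms pl_class_eq_iff by blast

lemma free_prelie_zero [simp]: "\<zero>\<^bsub>free_prelie V\<^esub> = pl_class V Zero"
  by (simp add: free_prelie_def)

lemma free_prelie_ops:
  assumes "s \<in> pl_terms V" "t \<in> pl_terms V"
  shows "pl_class V s \<otimes>\<^bsub>free_prelie V\<^esub> pl_class V t = pl_class V (Mul s t)"
    and "pl_class V s \<oplus>\<^bsub>free_prelie V\<^esub> pl_class V t = pl_class V (Add s t)"
    and "c \<odot>\<^bsub>free_prelie V\<^esub> pl_class V s = pl_class V (Scale c s)"
proof -
  have cong: "(s, s') \<in> pl_cong V" "(t, t') \<in> pl_cong V"
    if "s' \<in> pl_class V s" "t' \<in> pl_class V t" for s' t'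
    using that by (auto simp: pl_class_def)
  have U: "(\<Union>p\<in>P. \<Union>q\<in>Q. F p q) = C"
    if "P \<noteq> {}" "Q \<noteq> {}" "\<And>p q. p \<in> P \<Longrightarrow> q \<in> Q \<Longrightarrow> F p q = C" for P Q F C
    using that by auto
  have ne: "pl_class V s \<noteq> {}" "pl_class V t \<noteq> {}"
    using assms by (auto dest: pl_class_memI)
  show "pl_class V s \<otimes>\<^bsub>free_prelie V\<^esub> pl_class V t = pl_class V (Mul s t)"
    unfolding free_prelie_def monoid.simps
    by (rule U[OF ne pl_class_eqI]) (blast intro: cong pl_cong.cong_Mul[THEN pl_cong.sym])
  show "pl_class V s \<oplus>\<^bsub>free_prelie V\<^esub> pl_class V t = pl_class V (Add s t)"
    unfolding free_prelie_def ring.simps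
    by (rule U[OF ne pl_class_eqI]) (blast intro: cong pl_cong.cong_Add[THEN pl_cong.sym])
  have "pl_class V (Scale c s') = pl_class V (Scale c s)" if "s' \<in> pl_class V s" for s'
    using that pl_cong.cong_Scale[of s s' V c]
    by (intro pl_class_eqI) (auto simp: pl_class_def intro: pl_cong.sym)
  then show "c \<odot>\<^bsub>free_prelie V\<^esub> pl_class V s = pl_class V (Scale c s)"
    using ne(1) by (auto simp: free_prelie_def)
qed

lemmas pl_axioms = pl_cong.add_assoc pl_cong.add_comm pl_cong.add_zero pl_cong.scale_add_l
  pl_cong.scale_add_r pl_cong.scale_scale pl_cong.scale_one pl_cong.mul_add_l pl_cong.mul_add_r
  pl_cong.mul_scale_l pl_cong.mul_scale_r

lemma module_free_prelie: "module base_field (free_prelie V)"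
proof (rule moduleI)
  show "cring (base_field :: 'k::field_char_0 ring)"
    by (rule cring_from_type_algebra)
  show "abelian_group (free_prelie V)"
  proof (rule abelian_groupI)
    fix x assume "x \<in> carrier (free_prelie V)"
    then obtain s where s: "s \<in> pl_terms V" "x = pl_class V s" by (auto simp: carrier_free_prelie)
    have "pl_class V (Scale (-1) s) \<oplus>\<^bsub>free_prelie V\<^esub> x = \<zero>\<^bsub>free_prelie V\<^esub>"
      using s by (simp add: free_prelie_ops)
        (meson pl_class_eqI pl_cong.trans pl_cong.add_comm pl_cong.add_minus pl_terms_simps)
    then show "\<exists>y\<in>carrier (free_prelie V). y \<oplus>\<^bsub>free_prelie V\<^esub> x = \<zero>\<^bsub>free_prelie V\<^esub>"
      using s by (intro bexI[of _ "pl_class V (Scale (-1) s)"]) (auto simp: carrier_free_prelie)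
  qed (auto simp: carrier_free_prelie free_prelie_ops intro!: pl_class_eqI intro: pl_axioms
      del: subset_antisym)
qed (auto simp: carrier_free_prelie free_prelie_ops intro!: pl_class_eqI intro: pl_axioms
      del: subset_antisym)

lemma (in module) minus_eq_smult:
  assumes "x \<in> carrier M" "y \<in> carrier M"
  shows "x \<ominus>\<^bsub>M\<^esub> y = x \<oplus>\<^bsub>M\<^esub> (\<ominus>\<^bsub>R\<^esub> \<one>\<^bsub>R\<^esub>) \<odot>\<^bsub>M\<^esub> y"
  using assms by (simp add: a_minus_def smult_l_minus)

lemma base_field_minus [simp]: "\<ominus>\<^bsub>base_field\<^esub> a = - a"
  by (rule abelian_group.minus_equality[OF ring.is_abelian_group[OF ring_from_type_algebra]]) simp_all

theorem prelie_algebra_free_prelie: "prelie_algebra (free_prelie V)"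
proof -
  interpret F: module base_field "free_prelie V" by (rule module_free_prelie)
  show ?thesis
  proof unfold_locales
    fix x y z
    assume xyz: "x \<in> carrier (free_prelie V)" "y \<in> carrier (free_prelie V)"
      "z \<in> carrier (free_prelie V)"
    have cl: "u \<otimes>\<^bsub>free_prelie V\<^esub> w \<in> carrier (free_prelie V)"
      if "u \<in> carrier (free_prelie V)" "w \<in> carrier (free_prelie V)" for u w
      using that by (auto simp: carrier_free_prelie free_prelie_ops)
    show "x \<otimes>\<^bsub>free_prelie V\<^esub> y \<otimes>\<^bsub>free_prelie V\<^esub> z \<ominus>\<^bsub>free_prelie V\<^esub>
            x \<otimes>\<^bsub>free_prelie V\<^esub> (y \<otimes>\<^bsub>free_prelie V\<^esub> z) =
          x \<otimes>\<^bsub>free_prelie V\<^esub> z \<otimes>\<^bsub>free_prelie V\<^esub> y \<ominus>\<^bsub>free_prelie V\<^esub>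
            x \<otimes>\<^bsub>free_prelie V\<^esub> (z \<otimes>\<^bsub>free_prelie V\<^esub> y)"
      using xyz by (simp add: F.minus_eq_smult cl)
        (auto simp: carrier_free_prelie free_prelie_ops intro!: pl_class_eqI pl_cong.prelie
          del: subset_antisym)
  qed (auto simp: carrier_free_prelie free_prelie_ops intro!: pl_class_eqI intro: pl_axioms
      del: subset_antisym)
qed

primrec pl_eval :: "('k, 'b) module \<Rightarrow> ('v \<Rightarrow> 'b) \<Rightarrow> ('v, 'k) pl_term \<Rightarrow> 'b" where
  "pl_eval B f (Gen v) = f v"
| "pl_eval B f Zero = \<zero>\<^bsub>B\<^esub>"
| "pl_eval B f (Add s t) = pl_eval B f s \<oplus>\<^bsub>B\<^esub> pl_eval B f t"
| "pl_eval B f (Scale c s) = c \<odot>\<^bsub>B\<^esub> pl_eval B f s"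
| "pl_eval B f (Mul s t) = pl_eval B f s \<otimes>\<^bsub>B\<^esub> pl_eval B f t"

context prelie_algebra
begin

lemma pl_eval_closed:
  "f \<in> carrier V \<rightarrow> carrier A \<Longrightarrow> t \<in> pl_terms V \<Longrightarrow> pl_eval A f t \<in> carrier A"
  by (induction t) (auto simp: Pi_def)

lemma pl_eval_cong:
  assumes f: "f \<in> linear_hom V A" and "(s, t) \<in> pl_cong V"
  shows "pl_eval A f s = pl_eval A f t"
  using assms(2)
proof (induction rule: pl_cong.induct)
  have f': "f \<in> carrier V \<rightarrow> carrier A" using f by (simp add: linear_hom_def)
  note cl = pl_eval_closed[OF f']
  {
    case (add_minus s)
    then show ?case using minus_eq_smult[of "pl_eval A f s" "pl_eval A f s"]
      by (simp add: cl r_neg a_minus_def)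
  next
    case (prelie s t u)
    then show ?case
      using prelie_algebra.prelie[OF prelie_algebra_axioms, of "pl_eval A f s" "pl_eval A f t" "pl_eval A f u"]
      by (simp add: cl minus_eq_smult)
  }
qed (use f in \<open>auto simp: linear_hom_def pl_eval_closed M.a_assoc M.a_comm M.a_lcomm
      prod_l_distr prod_r_distr prod_smult_l prod_smult_r smult_r_distr
      intro: smult_l_distr[simplified] smult_assoc1[simplified] smult_one[simplified]\<close>)

theorem free_prelie_universal:
  assumes f: "f \<in> linear_hom V A"
  shows "\<exists>\<phi> \<in> prelie_hom (free_prelie V) A. \<forall>v\<in>carrier V. \<phi> (free_gen V v) = f v"
proof -
  define \<phi> where "\<phi> P = pl_eval A f (SOME t. t \<in> P)" for P
  have f': "f \<in> carrier V \<rightarrow> carrier A" using f by (simp add: linear_hom_def)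
  have \<phi>: "\<phi> (pl_class V t) = pl_eval A f t" if "t \<in> pl_terms V" for t
  proof -
    have "(SOME u. u \<in> pl_class V t) \<in> pl_class V t" using pl_class_memI[OF that] by (rule someI)
    then have "(t, SOME u. u \<in> pl_class V t) \<in> pl_cong V" by (simp add: pl_class_def)
    from pl_eval_cong[OF f this] show ?thesis by (simp add: \<phi>_def)
  qed
  have "\<phi> \<in> prelie_hom (free_prelie V) A"
    by (auto simp: prelie_hom_def linear_hom_def carrier_free_prelie free_prelie_ops \<phi>
        pl_eval_closed[OF f'])
  moreover have "\<forall>v\<in>carrier V. \<phi> (free_gen V v) = f v"
    by (simp add: free_gen_def \<phi>)
  ultimately show ?thesis by blast
qed

theorem free_prelie_unique:
  assumes "\<phi> \<in> prelie_hom (free_prelie V) A" "\<psi> \<in> prelie_hom (free_prelie V) A"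
    and "\<And>v. v \<in> carrier V \<Longrightarrow> \<phi> (free_gen V v) = \<psi> (free_gen V v)"
    and "P \<in> carrier (free_prelie V)"
  shows "\<phi> P = \<psi> P"
proof -
  interpret F: module base_field "free_prelie V" by (rule module_free_prelie)
  have h: "\<chi> (pl_class V Zero) = \<zero>"
       "s \<in> pl_terms V \<Longrightarrow> t \<in> pl_terms V \<Longrightarrow>
          \<chi> (pl_class V (Add s t)) = \<chi> (pl_class V s) \<oplus> \<chi> (pl_class V t)"
       "s \<in> pl_terms V \<Longrightarrow> t \<in> pl_terms V \<Longrightarrow>
          \<chi> (pl_class V (Mul s t)) = \<chi> (pl_class V s) \<otimes> \<chi> (pl_class V t)"
       "s \<in> pl_terms V \<Longrightarrow> \<chi> (pl_class V (Scale c s)) = c \<odot> \<chi> (pl_class V s)"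
    if "\<chi> \<in> prelie_hom (free_prelie V) A" for \<chi> s t c
  proof -
    have z: "\<chi> (pl_class V Zero) \<in> carrier A"
      using that by (auto simp: prelie_hom_def linear_hom_def carrier_free_prelie)
    have "(0 \<odot>\<^bsub>free_prelie V\<^esub> pl_class V Zero) = pl_class V Zero"
      using F.smult_r_null[of 0] by simp
    then have "\<chi> (pl_class V Zero) = 0 \<odot> \<chi> (pl_class V Zero)"
      using that by (simp add: prelie_hom_def linear_hom_def carrier_free_prelie) (metis imageI pl_terms_simps(2))
    also have "\<dots> = \<zero>" using smult_l_null[OF z] by simp
    finally show "\<chi> (pl_class V Zero) = \<zero>" .
  qed (use that in \<open>simp_all add: prelie_hom_def linear_hom_def carrier_free_prelie
         flip: free_prelie_ops\<close>)
  have "\<phi> (pl_class V t) = \<psi> (pl_class V t)" if "t \<in> pl_terms V" for t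
    using that by (induction t) (simp_all add: h assms(1,2) assms(3)[unfolded free_gen_def])
  then show ?thesis using assms(4) by (auto simp: carrier_free_prelie)
qed

end

section \<open>Partitioned trees\<close>

record ('v, 'd) pforest =
  verts :: "'v set"
  edges :: "'v rel"
  blocks :: "'v set set"
  deco :: "'v \<Rightarrow> 'd"

definition roots :: "('v, 'd) pforest \<Rightarrow> 'v set" where
  "roots F = {v \<in> verts F. \<nexists>u. (u, v) \<in> edges F}"

text \<open>An edge \<open>(u, v)\<close> goes from the parent \<open>u\<close> to its child \<open>v\<close>.\<close>

definition rooted_forest :: "('v, 'd) pforest \<Rightarrow> bool" where
  "rooted_forest F \<longleftrightarrow>
     finite (verts F) \<and> edges F \<subseteq> verts F \<times> verts F \<and> acyclic (edges F) \<and>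
     (\<forall>u u' v. (u, v) \<in> edges F \<longrightarrow> (u', v) \<in> edges F \<longrightarrow> u = u')"

definition partitioned_forest :: "('v, 'd) pforest \<Rightarrow> bool" where
  "partitioned_forest F \<longleftrightarrow>
     rooted_forest F \<and> partition_on (verts F) (blocks F) \<and>
     (\<forall>b\<in>blocks F. \<forall>u\<in>b. \<forall>v\<in>b.
        (u \<in> roots F \<and> v \<in> roots F) \<or> (\<exists>p. (p, u) \<in> edges F \<and> (p, v) \<in> edges F))"

definition partitioned_tree :: "('v, 'd) pforest \<Rightarrow> bool" where
  "partitioned_tree F \<longleftrightarrow>
     partitioned_forest F \<and> (\<forall>u\<in>roots F. \<forall>v\<in>roots F. \<exists>b\<in>blocks F. u \<in> b \<and> v \<in> b)"

definition pforest_iso :: "('v, 'd) pforest \<Rightarrow> ('w, 'd) pforest \<Rightarrow> bool" (infix \<open>\<cong>\<^sub>p\<close> 50) where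
  "F \<cong>\<^sub>p G \<longleftrightarrow> (\<exists>f. bij_betw f (verts F) (verts G) \<and>
     edges G = map_prod f f ` edges F \<and> blocks G = (`) f ` blocks F \<and>
     (\<forall>v\<in>verts F. deco G (f v) = deco F v))"

text \<open>
  An isomorphism class is represented by its members with vertices in \<^typ>\<open>nat\<close>.
  Thus \<open>iso_class F\<close> makes sense for a finite forest \<open>F\<close> with vertices of any type.
\<close>

type_synonym 'd pt_class = "(nat, 'd) pforest set"

definition iso_class :: "('v, 'd) pforest \<Rightarrow> 'd pt_class" where
  "iso_class F = {G. F \<cong>\<^sub>p G}"

definition rep :: "'d pt_class \<Rightarrow> (nat, 'd) pforest" where
  "rep C = (SOME F. F \<in> C)"

definition PT :: "'d set \<Rightarrow> 'd pt_class set" where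
  "PT D = {iso_class F |F :: (nat, 'd) pforest. partitioned_tree F \<and> deco F ` verts F \<subseteq> D}"

definition empty_class :: "'d pt_class" where
  "empty_class = iso_class \<lparr>verts = {} :: nat set, edges = {}, blocks = {}, deco = undefined\<rparr>"

definition graft :: "('v, 'd) pforest \<Rightarrow> 'v \<Rightarrow> ('w, 'd) pforest \<Rightarrow> ('v + 'w, 'd) pforest" where
  "graft F s G = \<lparr>
     verts = Inl ` verts F \<union> Inr ` verts G,
     edges = map_prod Inl Inl ` edges F \<union> map_prod Inr Inr ` edges G \<union> {Inl s} \<times> Inr ` roots G,
     blocks = (`) Inl ` blocks F \<union> (`) Inr ` blocks G,
     deco = case_sum (deco F) (deco G)\<rparr>"

definition restrict_to :: "('v, 'd) pforest \<Rightarrow> 'v set \<Rightarrow> ('v, 'd) pforest" where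
  "restrict_to F S = \<lparr>
     verts = verts F \<inter> S,
     edges = edges F \<inter> S \<times> S,
     blocks = (\<lambda>b. b \<inter> S) ` blocks F - {{}},
     deco = deco F\<rparr>"

text \<open>
  The family \<open>\<S>t(F)\<close> is indexed by the pairs of a root \<open>r\<close> and a block \<open>b\<close> of children of \<open>r\<close>;
  the vertices of the corresponding subtree are \<open>(edges F)\<^sup>* `` b\<close>.
\<close>

definition St_index :: "('v, 'd) pforest \<Rightarrow> ('v \<times> 'v set) set" where
  "St_index F = {(r, b). r \<in> roots F \<and> b \<in> blocks F \<and> (\<forall>v\<in>b. (r, v) \<in> edges F)}"

definition St_sub :: "('v, 'd) pforest \<Rightarrow> 'v set \<Rightarrow> ('v, 'd) pforest" where
  "St_sub F b = restrict_to F ((edges F)\<^sup>* `` b)"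

definition St_rest :: "('v, 'd) pforest \<Rightarrow> 'v set \<Rightarrow> ('v, 'd) pforest" where
  "St_rest F b = restrict_to F (verts F - (edges F)\<^sup>* `` b)"

section \<open>The preLie product and the coproduct\<close>

text \<open>
  The vector space with basis \<open>B\<close> consists of the finitely supported functions on \<open>B\<close>, as a
  subspace of a type \<open>'b \<Rightarrow>\<^sub>0 'k\<close>. The tensor square of the vector space with basis \<open>B\<close> is the vector
  space with basis \<open>B \<times> B\<close>, the pair \<open>(T, T')\<close> standing for \<open>T \<otimes> T'\<close>.
\<close>

definition scale :: "'k::field_char_0 \<Rightarrow> ('b \<Rightarrow>\<^sub>0 'k) \<Rightarrow> 'b \<Rightarrow>\<^sub>0 'k" where
  "scale c = Poly_Mapping.map ((*) c)"

definition basis :: "'b \<Rightarrow> 'b \<Rightarrow>\<^sub>0 'k::field_char_0" where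
  "basis b = Poly_Mapping.single b 1"

definition linear_extend :: "('a \<Rightarrow> 'b \<Rightarrow>\<^sub>0 'k::field_char_0) \<Rightarrow> ('a \<Rightarrow>\<^sub>0 'k) \<Rightarrow> 'b \<Rightarrow>\<^sub>0 'k" where
  "linear_extend f x = (\<Sum>a\<in>Poly_Mapping.keys x. scale (Poly_Mapping.lookup x a) (f a))"

definition tree_prod :: "'d pt_class \<Rightarrow> 'd pt_class \<Rightarrow> 'd pt_class \<Rightarrow>\<^sub>0 'k::field_char_0" where
  "tree_prod T T' = (\<Sum>s\<in>verts (rep T). basis (iso_class (graft (rep T) s (rep T'))))"

definition tree_coprod :: "'d pt_class \<Rightarrow> 'd pt_class \<times> 'd pt_class \<Rightarrow>\<^sub>0 'k::field_char_0" where
  "tree_coprod T = (\<Sum>(r, b)\<in>St_index (rep T).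
     basis (iso_class (St_rest (rep T) b), iso_class (St_sub (rep T) b)))"

definition CP_plus :: "'d set \<Rightarrow> ('k::field_char_0, 'd pt_class \<Rightarrow>\<^sub>0 'k) module" where
  "CP_plus D = \<lparr>
     carrier = {x. Poly_Mapping.keys x \<subseteq> PT D - {empty_class}},
     monoid.mult = (\<lambda>x y. linear_extend (\<lambda>T. linear_extend (tree_prod T) y) x),
     one = undefined,
     zero = 0,
     add = (+),
     module.smult = scale\<rparr>"

definition coprod :: "('d pt_class \<Rightarrow>\<^sub>0 'k) \<Rightarrow> 'd pt_class \<times> 'd pt_class \<Rightarrow>\<^sub>0 'k::field_char_0" where
  "coprod = linear_extend tree_coprod"

definition Ker_coprod :: "'d set \<Rightarrow> ('d pt_class \<Rightarrow>\<^sub>0 'k::field_char_0) set" where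
  "Ker_coprod D = {x \<in> carrier (CP_plus D). coprod x = 0}"

subsection \<open>Independence of the chosen representatives\<close>

lemma pforest_isoE:
  assumes "F \<cong>\<^sub>p G"
  obtains f where "bij_betw f (verts F) (verts G)" "edges G = map_prod f f ` edges F"
    "blocks G = (`) f ` blocks F" "\<forall>v\<in>verts F. deco G (f v) = deco F v"
  using assms unfolding pforest_iso_def by (elim exE conjE) (rule that)

lemma pforest_iso_refl: "F \<cong>\<^sub>p F"
  unfolding pforest_iso_def by (intro exI[of _ id]) (auto simp: map_prod.id)

lemma pforest_iso_sym:
  assumes "F \<cong>\<^sub>p G" and E: "edges F \<subseteq> verts F \<times> verts F" and B: "\<Union>(blocks F) \<subseteq> verts F"
  shows "G \<cong>\<^sub>p F"
proof -
  from assms(1) obtain f where f: "bij_betw f (verts F) (verts G)"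
    "edges G = map_prod f f ` edges F" "blocks G = (`) f ` blocks F"
    "\<forall>v\<in>verts F. deco G (f v) = deco F v" by (rule pforest_isoE)
  define g where "g = inv_into (verts F) f"
  have gf: "g (f v) = v" if "v \<in> verts F" for v
    using that f(1) by (simp add: g_def bij_betw_inv_into_left)
  have "map_prod g g ` edges G = edges F"
  proof -
    have "map_prod g g (map_prod f f e) = e" if "e \<in> edges F" for e
      using that E gf by (cases e) auto
    then show ?thesis unfolding f(2) image_image by simp
  qed
  moreover have "(`) g ` blocks G = blocks F"
  proof -
    have "g ` f ` b = b" if "b \<in> blocks F" for b
    proof -
      have "g (f x) = x" if "x \<in> b" for x using that \<open>b \<in> blocks F\<close> B gf by blast
      then show ?thesis unfolding image_image by simp
    qed
    then show ?thesis unfolding f(3) image_image[of "(`) g"] by simp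
  qed
  moreover have "\<forall>v\<in>verts G. deco F (g v) = deco G v"
    unfolding bij_betw_imp_surj_on[OF f(1), symmetric] using f(4) gf by simp
  ultimately show ?thesis
    unfolding pforest_iso_def using bij_betw_inv_into[OF f(1)] g_def by (intro exI[of _ g]) auto
qed

lemma pforest_iso_trans:
  assumes "F \<cong>\<^sub>p G" "G \<cong>\<^sub>p H"
  shows "F \<cong>\<^sub>p H"
proof -
  from assms(1) obtain f where f: "bij_betw f (verts F) (verts G)"
    "edges G = map_prod f f ` edges F" "blocks G = (`) f ` blocks F"
    "\<forall>v\<in>verts F. deco G (f v) = deco F v" by (rule pforest_isoE)
  from assms(2) obtain g where g: "bij_betw g (verts G) (verts H)"
    "edges H = map_prod g g ` edges G" "blocks H = (`) g ` blocks G"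
    "\<forall>v\<in>verts G. deco H (g v) = deco G v" by (rule pforest_isoE)
  show ?thesis unfolding pforest_iso_def
  proof (intro exI[of _ "g \<circ> f"] conjI)
    show "bij_betw (g \<circ> f) (verts F) (verts H)" using f(1) g(1) by (rule bij_betw_trans)
    show "edges H = map_prod (g \<circ> f) (g \<circ> f) ` edges F"
      unfolding f(2) g(2) image_image by (rule image_cong) auto
    show "blocks H = (`) (g \<circ> f) ` blocks F"
      unfolding f(3) g(3) image_image by (rule image_cong) auto
    show "\<forall>v\<in>verts F. deco H ((g \<circ> f) v) = deco F v"
      using f(4) g(4) bij_betwE[OF f(1)] by simp
  qed
qed

lemma ex_nat_rep:
  assumes "finite (verts F)"
  shows "\<exists>G :: (nat, 'd) pforest. F \<cong>\<^sub>p G"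
proof -
  obtain f :: "'a \<Rightarrow> nat" where f: "inj_on f (verts F)"
    using assms finite_imp_inj_to_nat_seg by meson
  let ?G = "\<lparr>verts = f ` verts F, edges = map_prod f f ` edges F, blocks = (`) f ` blocks F,
    deco = deco F \<circ> inv_into (verts F) f\<rparr>"
  have "F \<cong>\<^sub>p ?G" unfolding pforest_iso_def
    using f by (intro exI[of _ f]) (auto simp: bij_betw_def)
  then show ?thesis by blast
qed

lemma rep_iso: "finite (verts F) \<Longrightarrow> F \<cong>\<^sub>p rep (iso_class F)"
  using someI_ex[OF ex_nat_rep] by (simp add: rep_def iso_class_def)

lemma partitioned_forest_subsets:
  assumes "partitioned_forest F"
  shows "finite (verts F)" "edges F \<subseteq> verts F \<times> verts F" "\<Union>(blocks F) \<subseteq> verts F"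
  using assms by (auto simp: partitioned_forest_def rooted_forest_def partition_on_def)

lemma iso_class_eqI:
  assumes "F \<cong>\<^sub>p G" "edges F \<subseteq> verts F \<times> verts F" "\<Union>(blocks F) \<subseteq> verts F"
  shows "iso_class F = iso_class G"
  using pforest_iso_trans[OF assms(1)] pforest_iso_trans[OF pforest_iso_sym[OF assms]]
  unfolding iso_class_def by blast

lemma iso_class_eq_iff:
  assumes "partitioned_forest F" "partitioned_forest G"
  shows "iso_class F = iso_class G \<longleftrightarrow> F \<cong>\<^sub>p G"
proof
  assume eq: "iso_class F = iso_class G"
  have F: "F \<cong>\<^sub>p rep (iso_class F)"
    by (rule rep_iso[OF partitioned_forest_subsets(1)[OF assms(1)]])
  then have "rep (iso_class F) \<in> iso_class G"
    using eq by (auto simp: iso_class_def)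
  then have "G \<cong>\<^sub>p rep (iso_class F)" by (simp add: iso_class_def)
  then show "F \<cong>\<^sub>p G"
    by (rule pforest_iso_trans[OF F pforest_iso_sym[OF _ partitioned_forest_subsets(2,3)[OF assms(2)]]])
qed (rule iso_class_eqI[OF _ partitioned_forest_subsets(2,3)[OF assms(1)]])

lemma roots_image:
  assumes "inj_on f (verts F)" "verts G = f ` verts F" "edges G = map_prod f f ` edges F"
    and "edges F \<subseteq> verts F \<times> verts F"
  shows "roots G = f ` roots F"
proof -
  have "(\<exists>u. (u, f v) \<in> edges G) \<longleftrightarrow> (\<exists>u. (u, v) \<in> edges F)" if v: "v \<in> verts F" for v
  proof
    assume "\<exists>u. (u, f v) \<in> edges G"
    then obtain u w where uw: "(u, w) \<in> edges F" "f w = f v" using assms(3) by auto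
    then have "w = v" using assms(1,4) v by (auto dest: inj_onD)
    then show "\<exists>u. (u, v) \<in> edges F" using uw by blast
  qed (use assms(3) in force)
  then show ?thesis unfolding roots_def assms(2) by blast
qed

lemma graft_iso:
  assumes f: "bij_betw f (verts F) (verts F')" "edges F' = map_prod f f ` edges F"
    "blocks F' = (`) f ` blocks F" "\<forall>v\<in>verts F. deco F' (f v) = deco F v"
    and g: "bij_betw g (verts G) (verts G')" "edges G' = map_prod g g ` edges G"
    "blocks G' = (`) g ` blocks G" "\<forall>v\<in>verts G. deco G' (g v) = deco G v"
    and G: "edges G \<subseteq> verts G \<times> verts G"
  shows "graft F s G \<cong>\<^sub>p graft F' (f s) G'"
proof -
  have r: "roots G' = g ` roots G" using g(1,2) G by (intro roots_image) (auto simp: bij_betw_def)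
  let ?h = "map_sum f g"
  show ?thesis unfolding pforest_iso_def
  proof (intro exI[of _ ?h] conjI)
    show "bij_betw ?h (verts (graft F s G)) (verts (graft F' (f s) G'))"
    proof (rule bij_betw_imageI)
      show "inj_on ?h (verts (graft F s G))"
      proof (rule inj_onI)
        fix x y
        assume "x \<in> verts (graft F s G)" "y \<in> verts (graft F s G)" "?h x = ?h y"
        then show "x = y" using f(1) g(1)
          by (cases x; cases y) (auto simp: graft_def bij_betw_def dest: inj_onD)
      qed
      show "?h ` verts (graft F s G) = verts (graft F' (f s) G')"
      proof -
        have "?h ` Inl ` verts F = Inl ` f ` verts F" "?h ` Inr ` verts G = Inr ` g ` verts G"
          by (simp_all add: image_image)
        then show ?thesis
          using bij_betw_imp_surj_on[OF f(1)] bij_betw_imp_surj_on[OF g(1)]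
          by (simp add: graft_def image_Un)
      qed
    qed
    show "edges (graft F' (f s) G') = map_prod ?h ?h ` edges (graft F s G)"
    proof -
      have "map_prod ?h ?h ` ({Inl s} \<times> Inr ` roots G) = {Inl (f s)} \<times> Inr ` g ` roots G"
        by force
      then show ?thesis unfolding graft_def
        by (simp add: f(2) g(2) r image_Un image_image map_prod.compositionality comp_def)
    qed
    show "blocks (graft F' (f s) G') = (`) ?h ` blocks (graft F s G)"
      unfolding graft_def by (simp add: f(3) g(3) image_Un image_image)
    show "\<forall>v\<in>verts (graft F s G). deco (graft F' (f s) G') (?h v) = deco (graft F s G) v"
      unfolding graft_def using f(4) g(4) by auto
  qed
qed

lemma graft_subsets:
  assumes "edges F \<subseteq> verts F \<times> verts F" "edges G \<subseteq> verts G \<times> verts G"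
    and "\<Union>(blocks F) \<subseteq> verts F" "\<Union>(blocks G) \<subseteq> verts G" and "s \<in> verts F"
  shows "edges (graft F s G) \<subseteq> verts (graft F s G) \<times> verts (graft F s G)"
    and "\<Union>(blocks (graft F s G)) \<subseteq> verts (graft F s G)"
  using assms unfolding graft_def roots_def by auto

theorem tree_prod_iso_class:
  assumes F: "partitioned_forest F" and G: "partitioned_forest G"
  shows "tree_prod (iso_class F) (iso_class G) = (\<Sum>s\<in>verts F. basis (iso_class (graft F s G)))"
proof -
  let ?F = "rep (iso_class F)" and ?G = "rep (iso_class G)"
  note F' = partitioned_forest_subsets[OF F] and G' = partitioned_forest_subsets[OF G]
  from rep_iso[OF F'(1)] obtain f where f: "bij_betw f (verts F) (verts ?F)"
    "edges ?F = map_prod f f ` edges F" "blocks ?F = (`) f ` blocks F"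
    "\<forall>v\<in>verts F. deco ?F (f v) = deco F v" by (rule pforest_isoE)
  from rep_iso[OF G'(1)] obtain g where g: "bij_betw g (verts G) (verts ?G)"
    "edges ?G = map_prod g g ` edges G" "blocks ?G = (`) g ` blocks G"
    "\<forall>v\<in>verts G. deco ?G (g v) = deco G v" by (rule pforest_isoE)
  have "iso_class (graft F s G) = iso_class (graft ?F (f s) ?G)" if "s \<in> verts F" for s
    by (rule iso_class_eqI[OF graft_iso[OF f g G'(2)]
          graft_subsets[OF F'(2) G'(2) F'(3) G'(3) that]])
  then show ?thesis unfolding tree_prod_def
    by (simp add: sum.reindex_bij_betw[OF f(1), symmetric])
qed

lemma restrict_to_iso:
  assumes f: "bij_betw f (verts F) (verts G)" "edges G = map_prod f f ` edges F"
    "blocks G = (`) f ` blocks F" "\<forall>v\<in>verts F. deco G (f v) = deco F v"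
    and F: "edges F \<subseteq> verts F \<times> verts F" "\<Union>(blocks F) \<subseteq> verts F" and S: "S \<subseteq> verts F"
  shows "iso_class (restrict_to F S) = iso_class (restrict_to G (f ` S))"
proof (rule iso_class_eqI)
  have inj: "inj_on f (verts F)" using f(1) by (simp add: bij_betw_def)
  have S': "f x \<in> f ` S \<longleftrightarrow> x \<in> S" if "x \<in> verts F" for x
    using inj_on_image_mem_iff[OF inj that S] .
  have b: "f ` b \<inter> f ` S = f ` (b \<inter> S)" if "b \<in> blocks F" for b
    using that F(2) S by (intro inj_on_image_Int[OF inj, symmetric]) auto
  show "restrict_to F S \<cong>\<^sub>p restrict_to G (f ` S)" unfolding pforest_iso_def
  proof (intro exI[of _ f] conjI)
    show "bij_betw f (verts (restrict_to F S)) (verts (restrict_to G (f ` S)))"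
      using S inj f(1) unfolding restrict_to_def bij_betw_def by (auto intro: inj_on_subset)
    show "edges (restrict_to G (f ` S)) = map_prod f f ` edges (restrict_to F S)"
    proof -
      have "map_prod f f ` edges F \<inter> f ` S \<times> f ` S \<subseteq> map_prod f f ` (edges F \<inter> S \<times> S)"
      proof
        fix e assume "e \<in> map_prod f f ` edges F \<inter> f ` S \<times> f ` S"
        then obtain u v where uv: "(u, v) \<in> edges F" "e = (f u, f v)" "f u \<in> f ` S" "f v \<in> f ` S"
          by (smt (verit) IntE imageE map_prod_simp mem_Sigma_iff surj_pair)
        then have "(u, v) \<in> edges F \<inter> S \<times> S" using F(1) S' by blast
        then show "e \<in> map_prod f f ` (edges F \<inter> S \<times> S)" using uv(2) by force
      qed
      then show ?thesis by (auto simp: restrict_to_def f(2))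
    qed
    show "blocks (restrict_to G (f ` S)) = (`) f ` blocks (restrict_to F S)"
    proof -
      have "(\<lambda>b. b \<inter> f ` S) ` (`) f ` blocks F = (`) f ` (\<lambda>b. b \<inter> S) ` blocks F"
        unfolding image_image using b by (rule image_cong[OF HOL.refl])
      moreover have "(`) f ` P - {{}} = (`) f ` (P - {{}})" for P by auto
      ultimately show ?thesis by (simp add: restrict_to_def f(3))
    qed
    show "\<forall>v\<in>verts (restrict_to F S). deco (restrict_to G (f ` S)) (f v) = deco (restrict_to F S) v"
      unfolding restrict_to_def using f(4) by auto
  qed
qed (use F in \<open>auto simp: restrict_to_def\<close>)

lemma rtrancl_image_map_prod:
  assumes inj: "inj_on f V" and E: "E \<subseteq> V \<times> V" and b: "b \<subseteq> V"
  shows "(map_prod f f ` E)\<^sup>* `` (f ` b) = f ` (E\<^sup>* `` b)"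
proof (intro equalityI subsetI)
  fix y assume "y \<in> (map_prod f f ` E)\<^sup>* `` (f ` b)"
  then obtain x where "(f x, y) \<in> (map_prod f f ` E)\<^sup>*" and x: "x \<in> b" by auto
  then have "\<exists>z\<in>V. y = f z \<and> (x, z) \<in> E\<^sup>*"
  proof (induction rule: rtrancl_induct)
    case base
    then show ?case using b x by auto
  next
    case (step y z)
    then obtain u u' v where uv: "u \<in> V" "y = f u" "(x, u) \<in> E\<^sup>*" "(u', v) \<in> E" "f u' = f u" "z = f v"
      by auto
    then have "u' = u" using inj E by (auto dest: inj_onD)
    with uv E show ?case by (intro bexI[of _ v]) (auto intro: rtrancl_into_rtrancl)
  qed
  then show "y \<in> f ` (E\<^sup>* `` b)" using x by auto
next
  fix y assume "y \<in> f ` (E\<^sup>* `` b)"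
  then obtain x z where "x \<in> b" "(x, z) \<in> E\<^sup>*" "y = f z" by auto
  from this(2) have "(f x, f z) \<in> (map_prod f f ` E)\<^sup>*"
  proof (induction rule: rtrancl_induct)
    case (step v w)
    then have "(f v, f w) \<in> map_prod f f ` E" by force
    with step show ?case by (rule_tac rtrancl_into_rtrancl)
  qed simp
  then show "y \<in> (map_prod f f ` E)\<^sup>* `` (f ` b)" using \<open>x \<in> b\<close> \<open>y = f z\<close> by auto
qed

theorem tree_coprod_iso_class:
  assumes F: "partitioned_forest F"
  shows "tree_coprod (iso_class F) =
    (\<Sum>(r, b)\<in>St_index F. basis (iso_class (St_rest F b), iso_class (St_sub F b)))"
proof -
  let ?F = "rep (iso_class F)"
  note F' = partitioned_forest_subsets[OF F]
  from rep_iso[OF F'(1)] obtain f where f: "bij_betw f (verts F) (verts ?F)"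
    "edges ?F = map_prod f f ` edges F" "blocks ?F = (`) f ` blocks F"
    "\<forall>v\<in>verts F. deco ?F (f v) = deco F v" by (rule pforest_isoE)
  have inj: "inj_on f (verts F)" using f(1) by (simp add: bij_betw_def)
  have roots: "roots ?F = f ` roots F"
    using f F' by (intro roots_image) (auto simp: bij_betw_def)
  have edge: "(f u, f v) \<in> edges ?F \<longleftrightarrow> (u, v) \<in> edges F" if "u \<in> verts F" "v \<in> verts F" for u v
    unfolding f(2) using F'(2) inj that by (auto dest: inj_onD)
  have sub: "r \<in> verts F \<and> b \<subseteq> verts F" if "(r, b) \<in> St_index F" for r b
    using that F' by (auto simp: St_index_def roots_def)
  have cond: "(\<forall>v\<in>f ` b. (f r, v) \<in> edges ?F) \<longleftrightarrow> (\<forall>v\<in>b. (r, v) \<in> edges F)"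
    if "r \<in> roots F" "b \<in> blocks F" for r b
  proof -
    have "v \<in> verts F" if "v \<in> b" for v using that \<open>b \<in> blocks F\<close> F'(3) by blast
    moreover have "r \<in> verts F" using that by (simp add: roots_def)
    ultimately show ?thesis using edge by simp
  qed
  have index: "St_index ?F = map_prod f ((`) f) ` St_index F"
  proof (intro equalityI subsetI)
    fix x assume "x \<in> St_index ?F"
    then obtain r b where "x = (f r, f ` b)" "r \<in> roots F" "b \<in> blocks F"
      "\<forall>v\<in>f ` b. (f r, v) \<in> edges ?F"
      unfolding St_index_def roots f(3) by blast
    then have "(r, b) \<in> St_index F" using cond by (simp add: St_index_def)
    then show "x \<in> map_prod f ((`) f) ` St_index F" using \<open>x = (f r, f ` b)\<close> by force
  next
    fix x assume "x \<in> map_prod f ((`) f) ` St_index F"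
    then obtain r b where "x = (f r, f ` b)" "r \<in> roots F" "b \<in> blocks F" "\<forall>v\<in>b. (r, v) \<in> edges F"
      by (auto simp: St_index_def)
    then show "x \<in> St_index ?F" using cond by (simp add: St_index_def roots f(3))
  qed
  have inj': "inj_on (map_prod f ((`) f)) (St_index F)"
  proof (rule inj_onI)
    fix x y assume xy: "x \<in> St_index F" "y \<in> St_index F" "map_prod f ((`) f) x = map_prod f ((`) f) y"
    then show "x = y" using sub[of "fst x" "snd x"] sub[of "fst y" "snd y"]
      inj_onD[OF inj, of "fst x" "fst y"] inj_on_image_eq_iff[OF inj, of "snd x" "snd y"]
      by (cases x; cases y) auto
  qed
  have cut: "iso_class (St_rest ?F (f ` b)) = iso_class (St_rest F b)"
       "iso_class (St_sub ?F (f ` b)) = iso_class (St_sub F b)" if b: "b \<subseteq> verts F" for b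
  proof -
    have im: "(edges ?F)\<^sup>* `` (f ` b) = f ` ((edges F)\<^sup>* `` b)"
      unfolding f(2) by (rule rtrancl_image_map_prod[OF inj F'(2) b])
    have sub: "(edges F)\<^sup>* `` b \<subseteq> verts F"
      using b F'(2) by (auto elim: rtranclE)
    have "verts ?F - f ` ((edges F)\<^sup>* `` b) = f ` (verts F - (edges F)\<^sup>* `` b)"
      using f(1) sub inj by (simp add: bij_betw_def inj_on_image_set_diff)
    then show "iso_class (St_rest ?F (f ` b)) = iso_class (St_rest F b)"
      unfolding St_rest_def im by (simp add: restrict_to_iso[OF f F'(2,3)])
    show "iso_class (St_sub ?F (f ` b)) = iso_class (St_sub F b)"
      unfolding St_sub_def im by (simp add: restrict_to_iso[OF f F'(2,3)] sub)
  qed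
  show ?thesis unfolding tree_coprod_def index
    by (subst sum.reindex[OF inj']) (intro sum.cong; use sub cut in \<open>force simp: cut\<close>)
qed

end

theory Submission
  imports Defs
begin

text \<open>
  Let \<open>\<delta>\<close> be the coproduct divided by the number of roots, \<open>\<mu>\<close> the product, and \<open>d\<^sub>t x\<close> the element
  that \<open>\<delta> x\<close> pairs with the tree \<open>t\<close> on its right. Then \<open>\<delta> (s \<bullet> t)\<close> is \<open>s \<otimes> t\<close> plus the terms
  \<open>(s' \<bullet> t) \<otimes> s'' + s' \<otimes> (s'' \<bullet> t)\<close> over \<open>s' \<otimes> s''\<close> in \<open>\<delta> s\<close>; the \<open>d\<^sub>t\<close> commute, lower the degree (the number
  of vertices), and have \<open>Ker \<delta>\<close> as joint kernel. If \<open>x\<close> is killed by any \<open>k + 1\<close> of the \<open>d\<^sub>t\<close>,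
  then \<open>\<mu> (\<delta> x) - k x\<close> is killed by any \<open>k\<close> of them. As \<open>\<mu> (\<delta> x)\<close> is a combination of products of
  elements of smaller degree, induction on the degree and on \<open>k\<close> shows that \<open>Ker \<delta>\<close> generates.

  For injectivity, choose a preimage \<open>\<tau> t\<close> of each tree in the free algebra, of the same degree, and let
  \<open>\<Theta> (s \<otimes> t) = \<tau> s \<bullet> \<tau> t\<close>. By induction on the degree \<open>\<tau>\<close> is inverse to the canonical map in
  degrees less than \<open>n\<close>, so an element of degree \<open>n\<close> has the form \<open>v + \<Theta> z\<close> with \<open>v\<close> a generator, and the
  preLie identity in the free algebra gives \<open>\<Theta> (\<delta> (\<mu> z)) = \<Theta> (K z)\<close>, where \<open>K z\<close> is a positive
  multiple of \<open>z\<close> modulo terms of lower order \<open>k\<close>. If \<open>v + \<mu> z = 0\<close> then \<open>\<delta> (\<mu> z) = 0\<close>, so \<open>z\<close> can be replaced by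
  an element of lower order without changing \<open>\<Theta> z\<close>, and finally by \<open>0\<close>.
\<close>

section \<open>Linear maps between spaces with a basis\<close>

text \<open>The guiding picture is that of commuting derivatives \<open>d\<^sub>t\<close>, with E =
  \<mu> \<circ> \<delta> in the place of the Euler field: \<open>d\<^sub>s\<close> E = E
  \<open>d\<^sub>s\<close> + \<open>d\<^sub>s\<close> up to terms of lower order, so E acts on each
  order by counting. The obstacle to injectivity is that the free algebra carries no coproduct:
  relations there are reached only through \<open>\<Theta>\<close> and the preLie identity. For z =
  a \<otimes> t, the element \<delta> (\<mu> z) contains terms (p \<bullet> t) \<otimes> q, in which
  t has moved to the left, so it is not close to a multiple of z. The preLie identity trades them
  for (p \<bullet> q) \<otimes> t at the price of terms p \<otimes> (t \<bullet> q). The former add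
  up to E acting on the left factor, the latter have lower order, and so the count that proves
  generation proves injectivity too. Characteristic zero enters through division by these counts and
  by numbers of roots. The \<open>d\<^sub>t\<close> commute because cuts at different blocks are
  independent and no cut changes the roots.\<close>

definition linmap :: "(('a \<Rightarrow>\<^sub>0 'k::field_char_0) \<Rightarrow> ('b \<Rightarrow>\<^sub>0 'k)) \<Rightarrow> bool" where
  "linmap f \<longleftrightarrow> (\<forall>x y. f (x + y) = f x + f y) \<and> (\<forall>c x. f (scale c x) = scale c (f x))"

definition subsp :: "('a \<Rightarrow>\<^sub>0 'k::field_char_0) set \<Rightarrow> bool" where
  "subsp W \<longleftrightarrow> 0 \<in> W \<and> (\<forall>x\<in>W. \<forall>y\<in>W. x + y \<in> W) \<and> (\<forall>c. \<forall>x\<in>W. scale c x \<in> W)"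

lemma lookup_scale [simp]: "Poly_Mapping.lookup (scale c x) b = c * Poly_Mapping.lookup x b"
  by (simp add: scale_def Poly_Mapping.map.rep_eq when_def)

lemma lookup_basis: "Poly_Mapping.lookup (basis a) b = (if a = b then 1 else 0)"
  by (simp add: basis_def lookup_single when_def)

lemma keys_basis [simp]: "Poly_Mapping.keys (basis a :: 'a \<Rightarrow>\<^sub>0 'k::field_char_0) = {a}"
  by (simp add: basis_def)

lemma scale_simps [simp]:
  "scale c 0 = 0" "scale 0 x = 0" "scale 1 x = x" "scale c (scale d x) = scale (c * d) x"
  by (auto intro!: poly_mapping_eqI)

lemma scale_add: "scale c (x + y) = scale c x + scale c y" "scale (c + d) x = scale c x + scale d x"
  by (auto intro!: poly_mapping_eqI simp: lookup_add distrib_left distrib_right)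

lemma scale_minus: "scale c (x - y) = scale c x - scale c y" "scale c (- x) = - scale c x"
  "scale (- c) x = - scale c x" "scale (c - d) x = scale c x - scale d x"
  by (auto intro!: poly_mapping_eqI simp: lookup_minus left_diff_distrib right_diff_distrib)

lemma scale_sum: "scale c (sum f S) = (\<Sum>i\<in>S. scale c (f i))"
  by (induction S rule: infinite_finite_induct) (auto simp: scale_add)

lemma keys_scale_subset: "Poly_Mapping.keys (scale c x) \<subseteq> Poly_Mapping.keys x"
  by (auto simp: in_keys_iff)

lemma subspD:
  assumes "subsp W"
  shows "0 \<in> W" "x \<in> W \<Longrightarrow> y \<in> W \<Longrightarrow> x + y \<in> W" "x \<in> W \<Longrightarrow> scale c x \<in> W"
  using assms by (auto simp: subsp_def)

lemma subsp_minus: "subsp W \<Longrightarrow> x \<in> W \<Longrightarrow> y \<in> W \<Longrightarrow> x - y \<in> W"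
  using subspD(2)[of W x "scale (-1) y"] subspD(3)[of W y "-1"]
  by (simp add: scale_minus)

lemma subsp_sum: "subsp W \<Longrightarrow> (\<And>i. i \<in> S \<Longrightarrow> f i \<in> W) \<Longrightarrow> sum f S \<in> W"
  by (induction S rule: infinite_finite_induct) (auto simp: subspD)

lemma subsp_keys: "subsp {x. Poly_Mapping.keys x \<subseteq> S}"
proof -
  have "Poly_Mapping.keys (x + y) \<subseteq> S" if "Poly_Mapping.keys x \<subseteq> S" "Poly_Mapping.keys y \<subseteq> S"
    for x y :: "'a \<Rightarrow>\<^sub>0 'b"
    using Poly_Mapping.keys_add[of x y] that by blast
  moreover have "Poly_Mapping.keys (scale c x) \<subseteq> S" if "Poly_Mapping.keys x \<subseteq> S" for c and x :: "'a \<Rightarrow>\<^sub>0 'b"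
    using keys_scale_subset[of c x] that by blast
  ultimately show ?thesis by (simp add: subsp_def)
qed

lemma linmap_simps:
  assumes "linmap f"
  shows "f 0 = 0" "f (x + y) = f x + f y" "f (scale c x) = scale c (f x)" "f (x - y) = f x - f y"
    "f (- x) = - f x" "f (sum g S) = (\<Sum>i\<in>S. f (g i))"
proof -
  show a: "f (x + y) = f x + f y" "f (scale c x) = scale c (f x)" for x y c
    using assms by (auto simp: linmap_def)
  show z: "f 0 = 0" using a(2)[of 0 0] by simp
  show u: "f (- x) = - f x" for x using a(2)[of "-1" x] by (simp add: scale_minus)
  show "f (x - y) = f x - f y" using a(1)[of x "- y"] by (simp add: u)
  show "f (sum g S) = (\<Sum>i\<in>S. f (g i))"
    by (induction S rule: infinite_finite_induct) (auto simp: a z)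
qed

lemma linear_extend_superset:
  assumes "finite S" "Poly_Mapping.keys x \<subseteq> S"
  shows "linear_extend f x = (\<Sum>a\<in>S. scale (Poly_Mapping.lookup x a) (f a))"
  unfolding linear_extend_def
  by (rule sum.mono_neutral_left) (use assms in \<open>auto simp: in_keys_iff\<close>)

lemma linmap_linear_extend [simp]: "linmap (linear_extend f)"
proof -
  have "linear_extend f (x + y) = linear_extend f x + linear_extend f y" for x y
  proof -
    let ?S = "Poly_Mapping.keys x \<union> Poly_Mapping.keys y"
    have "Poly_Mapping.keys (x + y) \<subseteq> ?S" by (rule Poly_Mapping.keys_add)
    then show ?thesis
      by (simp add: linear_extend_superset[of ?S] lookup_add scale_add sum.distrib)
  qed
  moreover have "linear_extend f (scale c x) = scale c (linear_extend f x)" for c x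
    using keys_scale_subset[of c x]
    by (simp add: linear_extend_superset[of "Poly_Mapping.keys x"] scale_sum)
  ultimately show ?thesis by (simp add: linmap_def)
qed

lemma linear_extend_basis [simp]: "linear_extend f (basis a) = f a"
  by (simp add: linear_extend_def lookup_basis)

lemma linmap_scale [simp]: "linmap (scale c)"
  by (simp add: linmap_def scale_add mult.commute)

lemmas linear_extend_simps = linmap_simps[OF linmap_linear_extend]

lemma linear_extend_basis_id [simp]: "linear_extend basis x = x"
proof (rule poly_mapping_eqI)
  fix b
  have "Poly_Mapping.lookup (linear_extend basis x) b
      = (\<Sum>a\<in>Poly_Mapping.keys x. if a = b then Poly_Mapping.lookup x a else 0)"
    unfolding linear_extend_def lookup_sum by (rule sum.cong) (auto simp: lookup_basis)
  also have "\<dots> = Poly_Mapping.lookup x b"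
    by (simp add: sum.delta in_keys_iff)
  finally show "Poly_Mapping.lookup (linear_extend basis x) b = Poly_Mapping.lookup x b" .
qed

lemma linear_extend_cong:
  "(\<And>a. a \<in> Poly_Mapping.keys x \<Longrightarrow> f a = g a) \<Longrightarrow> linear_extend f x = linear_extend g x"
  by (simp add: linear_extend_def)

lemma linmap_linear_extend_apply: "linmap g \<Longrightarrow> g (linear_extend f x) = linear_extend (\<lambda>a. g (f a)) x"
  by (simp add: linear_extend_def linmap_simps)

lemma linmap_eq_linear_extend: "linmap g \<Longrightarrow> g x = linear_extend (\<lambda>a. g (basis a)) x"
  using linmap_linear_extend_apply[of g basis x] by simp

text \<open>Only basis elements in the support of \<open>x\<close> have to be compared. Hence axioms
  assumed for basis elements in \<open>B\<close> extend to everything supported in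
  \<open>B\<close>.\<close>

lemma linmap_eqI:
  assumes "linmap f" "linmap g" "\<And>a. a \<in> Poly_Mapping.keys x \<Longrightarrow> f (basis a) = g (basis a)"
  shows "f x = g x"
  using linmap_eq_linear_extend[OF assms(1), of x] linmap_eq_linear_extend[OF assms(2), of x]
    linear_extend_cong[OF assms(3)] by simp

lemma linmap_intros:
  "linmap (\<lambda>x. x)" "linmap (\<lambda>x. 0)"
  "linmap f \<Longrightarrow> linmap g \<Longrightarrow> linmap (\<lambda>x. f x + g x)"
  "linmap f \<Longrightarrow> linmap g \<Longrightarrow> linmap (\<lambda>x. f x - g x)"
  "linmap f \<Longrightarrow> linmap (\<lambda>x. scale c (f x))"
  "linmap f \<Longrightarrow> linmap (\<lambda>x. linear_extend u (f x))"
  by (simp_all add: linmap_def linear_extend_simps scale_add scale_minus mult.commute add_ac diff_add_eq diff_diff_eq2)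

lemma linear_extend_mem:
  "subsp W \<Longrightarrow> (\<And>a. a \<in> Poly_Mapping.keys x \<Longrightarrow> f a \<in> W) \<Longrightarrow> linear_extend f x \<in> W"
  unfolding linear_extend_def by (intro subsp_sum) (auto simp: subspD)

lemma linear_extend_add: "linear_extend (\<lambda>a. f a + g a) x = linear_extend f x + linear_extend g x"
  by (simp add: linear_extend_def scale_add sum.distrib)

lemma linear_extend_scale: "linear_extend (\<lambda>a. scale c (f a)) x = scale c (linear_extend f x)"
  by (simp add: linear_extend_def scale_sum mult.commute)

lemma subsp_vimage: "linmap f \<Longrightarrow> subsp W \<Longrightarrow> subsp {x. f x \<in> W}"
  by (auto simp: subsp_def linmap_simps)

text \<open>Nested like the product of \<open>CP_plus\<close>, so that the two coincide by
  unfolding.\<close>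

definition bilin :: "('a \<Rightarrow> 'b \<Rightarrow> 'c \<Rightarrow>\<^sub>0 'k::field_char_0) \<Rightarrow> ('a \<Rightarrow>\<^sub>0 'k) \<Rightarrow> ('b \<Rightarrow>\<^sub>0 'k) \<Rightarrow> 'c \<Rightarrow>\<^sub>0 'k" where
  "bilin f x y = linear_extend (\<lambda>a. linear_extend (f a) y) x"

lemma bilin_basis [simp]: "bilin f (basis a) y = linear_extend (f a) y"
  by (simp add: bilin_def)

lemma linmap_bilin_left [simp]: "linmap (\<lambda>x. bilin f x y)"
  unfolding bilin_def by (rule linmap_linear_extend)

lemma linmap_bilin_right [simp]: "linmap (bilin f x)"
  unfolding linmap_def bilin_def by (auto simp: linear_extend_simps linear_extend_add linear_extend_scale)

lemma linmap_bilin_comp: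
  "linmap h \<Longrightarrow> linmap (\<lambda>x. bilin f (h x) y)" "linmap g \<Longrightarrow> linmap (\<lambda>x. bilin f x' (g x))"
  by (auto simp: linmap_def linmap_simps[OF linmap_bilin_left] linmap_simps[OF linmap_bilin_right])

lemma bilin_eqI:
  assumes "\<And>y. linmap (\<lambda>x. f x y)" "\<And>x. linmap (f x)" "\<And>y. linmap (\<lambda>x. g x y)" "\<And>x. linmap (g x)"
    and "\<And>a b. a \<in> Poly_Mapping.keys x \<Longrightarrow> b \<in> Poly_Mapping.keys y \<Longrightarrow>
      f (basis a) (basis b) = g (basis a) (basis b)"
  shows "f x y = g x y"
  by (rule linmap_eqI[OF assms(1,3)], rule linmap_eqI[OF assms(2,4)], rule assms(5))

lemma bilin_mem:
  assumes "subsp W" "\<And>a b. a \<in> Poly_Mapping.keys x \<Longrightarrow> b \<in> Poly_Mapping.keys y \<Longrightarrow> f a b \<in> W"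
  shows "bilin f x y \<in> W"
  unfolding bilin_def using assms by (intro linear_extend_mem)

abbreviation tensor :: "('a \<Rightarrow>\<^sub>0 'k::field_char_0) \<Rightarrow> ('b \<Rightarrow>\<^sub>0 'k) \<Rightarrow> 'a \<times> 'b \<Rightarrow>\<^sub>0 'k" where
  "tensor \<equiv> bilin (\<lambda>a b. basis (a, b))"

text \<open>Contraction of the right tensor factor with the coordinate functional at
  \<open>t\<close>; applied to \<delta> x it is the operator \<open>d\<^sub>t\<close>.\<close>

definition slice :: "'b \<Rightarrow> ('a \<times> 'b \<Rightarrow>\<^sub>0 'k::field_char_0) \<Rightarrow> 'a \<Rightarrow>\<^sub>0 'k" where
  "slice t = linear_extend (\<lambda>(s, u). if u = t then basis s else 0)"

lemma linmap_slice [simp]: "linmap (slice t)"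
  by (simp add: slice_def)

lemma linmap_slice_comp: "linmap h \<Longrightarrow> linmap (\<lambda>x. slice t (h x))"
  unfolding slice_def by (rule linmap_intros(6))

lemma slice_basis: "slice t (basis (s, u)) = (if u = t then basis s else 0)"
  by (simp add: slice_def)

lemma slice_tensor:
  fixes x :: "'b \<Rightarrow>\<^sub>0 'k::field_char_0" and y :: "'c \<Rightarrow>\<^sub>0 'k"
  shows "slice t (tensor x y) = scale (Poly_Mapping.lookup y t) x"
proof (rule bilin_eqI[of "\<lambda>x y. slice t (tensor x y)" "\<lambda>x y. scale (Poly_Mapping.lookup y t) x"])
  show "linmap (\<lambda>y. scale (Poly_Mapping.lookup y t) x)" for x :: "'b \<Rightarrow>\<^sub>0 'k"
    by (simp add: linmap_def lookup_add scale_add)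
  show "linmap (\<lambda>x. slice t (tensor x y))" for y :: "'c \<Rightarrow>\<^sub>0 'k"
    by (intro linmap_slice_comp linmap_bilin_left)
  show "linmap (\<lambda>y. slice t (tensor x y))" for x :: "'b \<Rightarrow>\<^sub>0 'k"
    by (intro linmap_slice_comp linmap_bilin_right)
qed (auto simp: linmap_intros slice_basis lookup_basis)

lemma tensor_slices:
  fixes z :: "'a \<times> 'b \<Rightarrow>\<^sub>0 'k::field_char_0"
  assumes "finite S" "snd ` Poly_Mapping.keys z \<subseteq> S"
  shows "z = (\<Sum>t\<in>S. tensor (slice t z) (basis t))"
proof -
  have "linmap (\<lambda>z. \<Sum>t\<in>S. tensor (slice t z) (basis t))"
    by (auto simp: linmap_def linmap_simps[OF linmap_slice] linmap_simps[OF linmap_bilin_left]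
        sum.distrib scale_sum)
  then show ?thesis
  proof (rule linmap_eqI[OF linmap_intros(1)])
    fix a assume a: "a \<in> Poly_Mapping.keys z"
    have "tensor (slice t (basis a)) (basis t) = (if t = snd a then basis a else 0 :: 'a \<times> 'b \<Rightarrow>\<^sub>0 'k)" for t
      by (cases a) (auto simp: slice_basis linmap_simps(1)[OF linmap_bilin_left])
    then have "(\<Sum>t\<in>S. tensor (slice t (basis a)) (basis t))
        = (\<Sum>t\<in>S. if t = snd a then basis a else 0 :: 'a \<times> 'b \<Rightarrow>\<^sub>0 'k)"
      by (intro sum.cong HOL.refl)
    also have "\<dots> = basis a" using a assms by (simp add: sum.delta image_subset_iff)
    finally show "basis a = (\<Sum>t\<in>S. tensor (slice t (basis a)) (basis t) :: 'a \<times> 'b \<Rightarrow>\<^sub>0 'k)" by simp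
  qed
qed

text \<open>An element of the tensor square is the finite sum of its slices, each tensored with a
  basis vector. Linear maps can thus be examined on elements x \<otimes> t whose left factor is a
  whole slice, which keeps information on its order.\<close>

lemma slices_mem:
  assumes "subsp W" "\<And>t. t \<in> snd ` Poly_Mapping.keys z \<Longrightarrow> tensor (slice t z) (basis t) \<in> W"
  shows "z \<in> W"
proof -
  have "(\<Sum>t\<in>snd ` Poly_Mapping.keys z. tensor (slice t z) (basis t)) \<in> W"
    using assms by (rule subsp_sum)
  also have "(\<Sum>t\<in>snd ` Poly_Mapping.keys z. tensor (slice t z) (basis t)) = z"
    by (rule tensor_slices[symmetric]) simp_all
  finally show ?thesis .
qed

lemma slices_eq_0:
  assumes "\<And>t. slice t z = 0"
  shows "z = 0"
proof -
  have "z \<in> {0}"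
    by (rule slices_mem) (simp_all add: assms subsp_def linmap_simps(1)[OF linmap_bilin_left])
  then show ?thesis by simp
qed

section \<open>PreLie algebras with a compatible coproduct\<close>

text \<open>The part of the argument that does not see trees. Slicing both sides of
  \<open>cop_comm\<close> at a further t yields the commutation of \<open>d\<^sub>s\<close> and
  \<open>d\<^sub>t\<close>; leaving the right factor open allows \<mu> to be applied to both
  sides.\<close>

locale prelie_coalgebra =
  fixes B :: "'b set" and deg :: "'b \<Rightarrow> nat"
    and prd :: "'b \<Rightarrow> 'b \<Rightarrow> 'b \<Rightarrow>\<^sub>0 'k::field_char_0"
    and cop :: "'b \<Rightarrow> 'b \<times> 'b \<Rightarrow>\<^sub>0 'k"
  assumes deg_pos: "b \<in> B \<Longrightarrow> 0 < deg b"
    and keys_prd: "a \<in> B \<Longrightarrow> b \<in> B \<Longrightarrow> Poly_Mapping.keys (prd a b) \<subseteq> {c \<in> B. deg c = deg a + deg b}"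
    and keys_cop: "a \<in> B \<Longrightarrow>
      Poly_Mapping.keys (cop a) \<subseteq> {(s, t). s \<in> B \<and> t \<in> B \<and> deg s + deg t = deg a}"
    and prelie_basis: "a \<in> B \<Longrightarrow> b \<in> B \<Longrightarrow> c \<in> B \<Longrightarrow>
      bilin prd (prd a b) (basis c) - bilin prd (basis a) (prd b c)
        = bilin prd (prd a c) (basis b) - bilin prd (basis a) (prd c b)"
    and cop_prd: "a \<in> B \<Longrightarrow> b \<in> B \<Longrightarrow>
      linear_extend cop (prd a b) = basis (a, b)
        + linear_extend (\<lambda>(p, q). tensor (prd p b) (basis q)) (cop a)
        + linear_extend (\<lambda>(p, q). tensor (basis p) (prd q b)) (cop a)"
    and cop_comm: "a \<in> B \<Longrightarrow>
      linear_extend (\<lambda>(p, q). tensor (slice s (cop p)) (basis q)) (cop a)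
        = linear_extend cop (slice s (cop a))"
begin

abbreviation \<mu> :: "('b \<times> 'b \<Rightarrow>\<^sub>0 'k) \<Rightarrow> 'b \<Rightarrow>\<^sub>0 'k" where
  "\<mu> \<equiv> linear_extend (\<lambda>(a, b). prd a b)"

abbreviation \<delta> :: "('b \<Rightarrow>\<^sub>0 'k) \<Rightarrow> 'b \<times> 'b \<Rightarrow>\<^sub>0 'k" where
  "\<delta> \<equiv> linear_extend cop"

text \<open>A filtration in place of a grading, so that elements of \<open>prim\<close> never have
  to be split into homogeneous parts.\<close>

definition filt :: "nat \<Rightarrow> ('b \<Rightarrow>\<^sub>0 'k) set" where
  "filt n = {x. Poly_Mapping.keys x \<subseteq> {b \<in> B. deg b \<le> n}}"

definition filt2 :: "nat \<Rightarrow> ('b \<times> 'b \<Rightarrow>\<^sub>0 'k) set" where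
  "filt2 n = {z. Poly_Mapping.keys z \<subseteq> {(s, t). s \<in> B \<and> t \<in> B \<and> deg s + deg t \<le> n}}"

definition prim :: "('b \<Rightarrow>\<^sub>0 'k) set" where
  "prim = {x. Poly_Mapping.keys x \<subseteq> B \<and> \<delta> x = 0}"

text \<open>
  The elements killed by any \<open>k\<close> of the operators \<open>\<lambda>x. slice t (\<delta> x)\<close>. On the \<open>k + 1\<close>-st of
  these spaces modulo the \<open>k\<close>-th, the Euler operator \<open>\<mu> \<circ> \<delta>\<close> is multiplication by \<open>k\<close>.
\<close>

primrec ord_le :: "nat \<Rightarrow> ('b \<Rightarrow>\<^sub>0 'k) set" where
  "ord_le 0 = {0}"
| "ord_le (Suc k) = {x. \<forall>t. slice t (\<delta> x) \<in> ord_le k}"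

text \<open>Order is measured in the left factor, with the right one as a spectator. With this
  convention \<delta> lowers the order bound by exactly one, as \<open>ord_le_Suc_iff\<close>
  records.\<close>

definition ord2_le :: "nat \<Rightarrow> ('b \<times> 'b \<Rightarrow>\<^sub>0 'k) set" where
  "ord2_le k = {z. \<forall>t. slice t z \<in> ord_le k}"

lemma subsp_filt: "subsp (filt n)" and subsp_filt2: "subsp (filt2 n)"
  unfolding filt_def filt2_def by (rule subsp_keys)+

lemma subsp_ord_le: "subsp (ord_le k)"
  by (induction k) (auto simp: subsp_def linear_extend_simps linmap_simps[OF linmap_slice])

lemma subsp_ord2_le: "subsp (ord2_le k)"
  using subsp_ord_le[of k] by (auto simp: ord2_le_def subsp_def linmap_simps[OF linmap_slice])

lemma ord_le_Suc_iff: "x \<in> ord_le (Suc k) \<longleftrightarrow> \<delta> x \<in> ord2_le k"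
  by (simp add: ord2_le_def)

lemma basis_filt: "b \<in> B \<Longrightarrow> deg b \<le> n \<Longrightarrow> basis b \<in> filt n"
  by (simp add: filt_def)

lemma filt_mono: "m \<le> n \<Longrightarrow> filt m \<subseteq> filt n"
  by (auto simp: filt_def)

lemma filt_0: "x \<in> filt 0 \<Longrightarrow> x = 0"
  using deg_pos by (fastforce simp: filt_def simp flip: keys_eq_empty)

lemma tensor_filt2: "x \<in> filt m \<Longrightarrow> y \<in> filt n \<Longrightarrow> m + n \<le> l \<Longrightarrow> tensor x y \<in> filt2 l"
  by (rule bilin_mem[OF subsp_filt2]) (force simp: filt_def filt2_def)

lemma prd_filt: "a \<in> B \<Longrightarrow> b \<in> B \<Longrightarrow> deg a + deg b \<le> n \<Longrightarrow> prd a b \<in> filt n"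
  using keys_prd[of a b] by (auto simp: filt_def)

lemma cop_filt2: "a \<in> B \<Longrightarrow> deg a \<le> n \<Longrightarrow> cop a \<in> filt2 n"
  using keys_cop[of a] by (auto simp: filt2_def)

lemma \<mu>_filt: "z \<in> filt2 n \<Longrightarrow> \<mu> z \<in> filt n"
  by (rule linear_extend_mem[OF subsp_filt]) (auto simp: filt2_def intro!: prd_filt)

lemma \<delta>_filt2: "x \<in> filt n \<Longrightarrow> \<delta> x \<in> filt2 n"
  by (rule linear_extend_mem[OF subsp_filt2]) (auto simp: filt_def intro!: cop_filt2)

text \<open>The right factor that is removed has positive degree, so at least one degree is lost on
  the left.\<close>

lemma slice_filt:
  assumes "z \<in> filt2 n" shows "slice t z \<in> filt (n - 1)"
  unfolding slice_def
proof (rule linear_extend_mem[OF subsp_filt])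
  fix a assume "a \<in> Poly_Mapping.keys z"
  then have "fst a \<in> B" "snd a \<in> B" "deg (fst a) + deg (snd a) \<le> n"
    using assms by (auto simp: filt2_def)
  moreover from this have "0 < deg (snd a)" by (intro deg_pos)
  ultimately show "(case a of (s, u) \<Rightarrow> if u = t then basis s else 0) \<in> filt (n - 1)"
    using subspD(1)[OF subsp_filt] by (auto split: prod.split intro!: basis_filt)
qed

text \<open>Each \<open>d\<^sub>t\<close> costs at least one degree, so the degree bounds the order.
  This is the entry point of the inductions on the order.\<close>

lemma filt_ord_le: "x \<in> filt n \<Longrightarrow> x \<in> ord_le n"
proof (induction n arbitrary: x)
  case 0
  then show ?case using filt_0 by simp
next
  case (Suc n)
  then show ?case using slice_filt[OF \<delta>_filt2, of x "Suc n"] by simp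
qed

lemma tensor_ord2_le: "x \<in> ord_le k \<Longrightarrow> tensor x y \<in> ord2_le k"
  by (auto simp: ord2_le_def slice_tensor intro: subspD[OF subsp_ord_le])

lemma filt_prim: "x \<in> filt n \<Longrightarrow> x \<in> ord_le 1 \<Longrightarrow> x \<in> prim"
  using slices_eq_0[of "\<delta> x"] by (auto simp: filt_def prim_def)

section \<open>The Euler operator on the algebra and on its tensor square\<close>

text \<open>A common shape for two remainders: \<open>f t q\<close> is q \<bullet> t in the
  coproduct of a product, and t \<bullet> q after the exchange by the preLie identity. The left
  factor is cut once and the piece q is merged into the right factor.\<close>

definition twist :: "('b \<Rightarrow> 'b \<Rightarrow> 'b \<Rightarrow>\<^sub>0 'k) \<Rightarrow> ('b \<times> 'b \<Rightarrow>\<^sub>0 'k) \<Rightarrow> 'b \<times> 'b \<Rightarrow>\<^sub>0 'k" where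
  "twist f = linear_extend (\<lambda>(a, t). linear_extend (\<lambda>(p, q). tensor (basis p) (f t q)) (cop a))"

text \<open>On x \<otimes> t the left factors that occur come from slices of \<delta> x, whose order
  is one less than that of x. The order ignores what \<open>f\<close> does on the right.\<close>

lemma twist_ord2_le:
  assumes "z \<in> ord2_le (Suc k)"
  shows "twist f z \<in> ord2_le k"
proof -
  define M :: "'b \<Rightarrow> ('b \<times> 'b \<Rightarrow>\<^sub>0 'k) \<Rightarrow> 'b \<times> 'b \<Rightarrow>\<^sub>0 'k"
    where "M t = linear_extend (\<lambda>(p, q). tensor (basis p) (f t q))" for t
  have M: "M t (tensor x (basis q)) = tensor x (f t q)" for t x q
    by (rule linmap_eqI[of "\<lambda>x. M t (tensor x (basis q))" "\<lambda>x. tensor x (f t q)"])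
      (simp_all add: M_def linmap_intros)
  have M_ord: "M t y \<in> ord2_le k" if "y \<in> ord2_le k" for t y
  proof -
    have "y \<in> {y. M t y \<in> ord2_le k}"
    proof (rule slices_mem)
      show "subsp {y. M t y \<in> ord2_le k}"
        unfolding M_def by (rule subsp_vimage[OF linmap_linear_extend subsp_ord2_le])
    qed (use that in \<open>auto simp: M intro!: tensor_ord2_le, simp add: ord2_le_def\<close>)
    then show ?thesis by simp
  qed
  have tw: "twist f (tensor x (basis t)) = M t (\<delta> x)" for x t
  proof (rule linmap_eqI[of "\<lambda>x. twist f (tensor x (basis t))" "\<lambda>x. M t (\<delta> x)"])
    show "linmap (\<lambda>x. twist f (tensor x (basis t)))"
      unfolding twist_def by (intro linmap_intros linmap_bilin_left)
    show "linmap (\<lambda>x. M t (\<delta> x))"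
      unfolding M_def by (intro linmap_intros)
  qed (simp add: twist_def M_def)
  have "z \<in> {z. twist f z \<in> ord2_le k}"
  proof (rule slices_mem)
    show "subsp {z. twist f z \<in> ord2_le k}"
      unfolding twist_def by (rule subsp_vimage[OF linmap_linear_extend subsp_ord2_le])
    fix t
    have "slice t z \<in> ord_le (Suc k)" using assms by (simp add: ord2_le_def)
    then have "\<delta> (slice t z) \<in> ord2_le k" by (simp only: ord_le_Suc_iff)
    then show "tensor (slice t z) (basis t) \<in> {z. twist f z \<in> ord2_le k}"
      by (simp add: tw M_ord)
  qed
  then show ?thesis by simp
qed

lemma twist_filt2:
  assumes f: "\<And>t q. t \<in> B \<Longrightarrow> q \<in> B \<Longrightarrow> f t q \<in> filt (deg t + deg q)" and z: "z \<in> filt2 n"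
  shows "twist f z \<in> filt2 n"
  unfolding twist_def
proof (rule linear_extend_mem[OF subsp_filt2])
  fix w assume "w \<in> Poly_Mapping.keys z"
  then obtain a t where w: "w = (a, t)" "a \<in> B" "t \<in> B" "deg a + deg t \<le> n"
    using z by (auto simp: filt2_def)
  have "linear_extend (\<lambda>(p, q). tensor (basis p) (f t q)) (cop a) \<in> filt2 n"
  proof (rule linear_extend_mem[OF subsp_filt2])
    fix pq assume "pq \<in> Poly_Mapping.keys (cop a)"
    then obtain p q where pq: "pq = (p, q)" "p \<in> B" "q \<in> B" "deg p + deg q = deg a"
      using keys_cop[OF w(2)] by auto
    have "tensor (basis p) (f t q) \<in> filt2 n"
      by (rule tensor_filt2[OF basis_filt[OF pq(2) order_refl] f[OF w(3) pq(3)]]) (use pq w in simp)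
    then show "(case pq of (p, q) \<Rightarrow> tensor (basis p) (f t q)) \<in> filt2 n" by (simp add: pq)
  qed
  then show "(case w of (a, t) \<Rightarrow> linear_extend (\<lambda>(p, q). tensor (basis p) (f t q)) (cop a)) \<in> filt2 n"
    by (simp add: w)
qed

text \<open>The part of \<delta> (a \<bullet> t) in which t multiplies the left factor of \<delta>
  a. Unlike \<open>twist\<close>, it need not lower the order.\<close>

definition left_act :: "('b \<times> 'b \<Rightarrow>\<^sub>0 'k) \<Rightarrow> 'b \<times> 'b \<Rightarrow>\<^sub>0 'k" where
  "left_act = linear_extend (\<lambda>(a, t). linear_extend (\<lambda>(p, q). tensor (prd p t) (basis q)) (cop a))"

lemma \<delta>_\<mu>:
  assumes "z \<in> filt2 n"
  shows "\<delta> (\<mu> z) = z + left_act z + twist (\<lambda>t q. prd q t) z"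
proof (rule linmap_eqI[of "\<lambda>z. \<delta> (\<mu> z)" "\<lambda>z. z + left_act z + twist (\<lambda>t q. prd q t) z"])
  show "linmap (\<lambda>z. \<delta> (\<mu> z))" by (intro linmap_intros)
  show "linmap (\<lambda>z. z + left_act z + twist (\<lambda>t q. prd q t) z)"
    unfolding left_act_def twist_def by (intro linmap_intros)
  fix w assume "w \<in> Poly_Mapping.keys z"
  then show "\<delta> (\<mu> (basis w)) = basis w + left_act (basis w) + twist (\<lambda>t q. prd q t) (basis w)"
    using assms by (auto simp: filt2_def left_act_def twist_def cop_prd)
qed

text \<open>Slicing reads the right factor while t acts on the left one, so the slice may be taken
  before the multiplication. The right-hand side is arranged so that \<open>cop_comm\<close> applies
  once z is itself of the form \<delta> x.\<close>

lemma slice_left_act: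
  "slice s (left_act z) = \<mu> (linear_extend (\<lambda>(p, q). tensor (slice s (cop p)) (basis q)) z)"
proof (rule linmap_eqI[of "\<lambda>z. slice s (left_act z)"
      "\<lambda>z. \<mu> (linear_extend (\<lambda>(p, q). tensor (slice s (cop p)) (basis q)) z)"])
  show "linmap (\<lambda>z. slice s (left_act z))"
    unfolding left_act_def by (intro linmap_intros linmap_slice_comp)
  show "linmap (\<lambda>z. \<mu> (linear_extend (\<lambda>(p, q). tensor (slice s (cop p)) (basis q)) z))"
    by (intro linmap_intros)
  fix w :: "'b \<times> 'b"
  obtain a t where w: "w = (a, t)" by force
  have "slice s (linear_extend (\<lambda>(p, q). tensor (prd p t) (basis q)) y)
      = \<mu> (tensor (slice s y) (basis t))" for y
  proof (rule linmap_eqI[of "\<lambda>y. slice s (linear_extend (\<lambda>(p, q). tensor (prd p t) (basis q)) y)"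
        "\<lambda>y. \<mu> (tensor (slice s y) (basis t))"])
    show "linmap (\<lambda>y. slice s (linear_extend (\<lambda>(p, q). tensor (prd p t) (basis q)) y))"
      by (intro linmap_intros linmap_slice_comp)
    show "linmap (\<lambda>y. \<mu> (tensor (slice s y) (basis t)))"
      by (intro linmap_intros linmap_bilin_comp linmap_slice_comp)
  qed (auto simp: slice_tensor slice_basis lookup_basis linmap_simps(1)[OF linmap_bilin_left] linear_extend_simps)
  then show "slice s (left_act (basis w))
      = \<mu> (linear_extend (\<lambda>(p, q). tensor (slice s (cop p)) (basis q)) (basis w))"
    by (simp add: left_act_def w)
qed

lemma cop_comm_\<delta>:
  assumes "x \<in> filt n"
  shows "linear_extend (\<lambda>(p, q). tensor (slice s (cop p)) (basis q)) (\<delta> x) = \<delta> (slice s (\<delta> x))"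
  by (rule linmap_eqI[of "\<lambda>x. linear_extend (\<lambda>(p, q). tensor (slice s (cop p)) (basis q)) (\<delta> x)"
        "\<lambda>x. \<delta> (slice s (\<delta> x))"])
    (use assms in \<open>auto simp: filt_def cop_comm intro!: linmap_intros linmap_slice_comp\<close>)

text \<open>With E = \<mu> \<circ> \<delta>, slicing \<open>\<delta>_\<mu>\<close> at \<delta> x and
  commuting the slices gives \<open>d\<^sub>s\<close> (E x) = \<open>d\<^sub>s\<close> x + E
  (\<open>d\<^sub>s\<close> x) + remainder. The induction hypothesis for \<open>d\<^sub>s\<close> x
  supplies the factor k, the extra summand \<open>d\<^sub>s\<close> x raises it to k + 1, and the
  remainder is a slice of \<open>twist\<close>, hence of lower order. Order 1 is the kernel of
  \<delta>, where E vanishes.\<close>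

lemma euler_ord_le:
  assumes "x \<in> ord_le (Suc k)" "x \<in> filt n"
  shows "\<mu> (\<delta> x) - scale (of_nat k) x \<in> ord_le k"
  using assms
proof (induction k arbitrary: x n)
  case 0
  then have "\<delta> x = 0" using filt_prim[of x n] by (simp add: prim_def)
  then show ?case by (simp add: linear_extend_simps)
next
  case (Suc k)
  have "slice s (\<delta> (\<mu> (\<delta> x) - scale (of_nat (Suc k)) x)) \<in> ord_le k" for s
  proof -
    let ?y = "slice s (\<delta> x)" and ?r = "slice s (twist (\<lambda>t q. prd q t) (\<delta> x))"
    have y: "?y \<in> ord_le (Suc k)" "?y \<in> filt (n - 1)"
      using Suc.prems slice_filt[OF \<delta>_filt2] by auto
    have "\<delta> x \<in> ord2_le (Suc k)" using Suc.prems(1) by (simp only: ord_le_Suc_iff)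
    then have r: "?r \<in> ord_le k" using twist_ord2_le by (simp add: ord2_le_def)
    have "slice s (\<delta> (\<mu> (\<delta> x))) = ?y + \<mu> (\<delta> ?y) + ?r"
      using \<delta>_\<mu>[OF \<delta>_filt2[OF Suc.prems(2)]]
      by (simp add: linmap_simps[OF linmap_slice] slice_left_act cop_comm_\<delta>[OF Suc.prems(2)])
    then have "slice s (\<delta> (\<mu> (\<delta> x) - scale (of_nat (Suc k)) x))
        = (\<mu> (\<delta> ?y) - scale (of_nat k) ?y) + ?r"
      by (simp add: linear_extend_simps linmap_simps[OF linmap_slice] scale_add)
    then show ?thesis using subspD(2)[OF subsp_ord_le Suc.IH[OF y] r] by simp
  qed
  then show ?case by simp
qed

text \<open>The operator K of the overview: \<delta> \<circ> \<mu> rewritten by the preLie identity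
  of the free algebra. On \<open>filt2 n\<close>, the map \<open>\<Theta>\<close> cannot tell the
  two apart (\<open>\<Theta>_\<delta>_\<mu>\<close>).\<close>

definition euler2 :: "('b \<times> 'b \<Rightarrow>\<^sub>0 'k) \<Rightarrow> 'b \<times> 'b \<Rightarrow>\<^sub>0 'k" where
  "euler2 z = z + linear_extend (\<lambda>(a, t). tensor (\<mu> (cop a)) (basis t)) z + twist prd z"

lemma euler2_filt2:
  assumes "z \<in> filt2 n"
  shows "euler2 z \<in> filt2 n"
proof -
  have "linear_extend (\<lambda>(a, t). tensor (\<mu> (cop a)) (basis t)) z \<in> filt2 n"
  proof (rule linear_extend_mem[OF subsp_filt2])
    fix w assume "w \<in> Poly_Mapping.keys z"
    then obtain a t where w: "w = (a, t)" "a \<in> B" "t \<in> B" "deg a + deg t \<le> n"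
      using assms by (auto simp: filt2_def)
    have "tensor (\<mu> (cop a)) (basis t) \<in> filt2 n"
      by (rule tensor_filt2[OF \<mu>_filt[OF cop_filt2[OF w(2) order_refl]] basis_filt[OF w(3) order_refl] w(4)])
    then show "(case w of (a, t) \<Rightarrow> tensor (\<mu> (cop a)) (basis t)) \<in> filt2 n" by (simp add: w)
  qed
  moreover have "twist prd z \<in> filt2 n"
    by (rule twist_filt2[OF _ assms]) (simp add: prd_filt)
  ultimately show ?thesis using assms subspD(2)[OF subsp_filt2] by (simp add: euler2_def)
qed

text \<open>Slice by slice, the middle summand of \<open>euler2\<close> is \<mu> \<circ> \<delta> on
  \<open>slice t z\<close> and gives the factor k by \<open>euler_ord_le\<close>; the summand z adds
  one, and \<open>twist\<close> contributes lower order only.\<close>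

lemma euler2_ord2_le:
  assumes "z \<in> ord2_le (Suc k)" "z \<in> filt2 n"
  shows "euler2 z - scale (of_nat (Suc k)) z \<in> ord2_le k"
  unfolding ord2_le_def mem_Collect_eq
proof
  fix t
  let ?y = "slice t z" and ?r = "slice t (twist prd z)"
  have "slice t (linear_extend (\<lambda>(a, t). tensor (\<mu> (cop a)) (basis t)) z) = \<mu> (\<delta> ?y)"
  proof (rule linmap_eqI[of "\<lambda>z. slice t (linear_extend (\<lambda>(a, t). tensor (\<mu> (cop a)) (basis t)) z)"
        "\<lambda>z. \<mu> (\<delta> (slice t z))"])
    show "linmap (\<lambda>z. slice t (linear_extend (\<lambda>(a, t). tensor (\<mu> (cop a)) (basis t)) z))"
      "linmap (\<lambda>z. \<mu> (\<delta> (slice t z)))"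
      by (intro linmap_intros linmap_slice_comp)+
  qed (auto simp: slice_tensor slice_basis lookup_basis linear_extend_simps)
  then have "slice t (euler2 z - scale (of_nat (Suc k)) z) = (\<mu> (\<delta> ?y) - scale (of_nat k) ?y) + ?r"
    by (simp add: euler2_def linmap_simps[OF linmap_slice] scale_add)
  moreover have "\<mu> (\<delta> ?y) - scale (of_nat k) ?y \<in> ord_le k"
    by (rule euler_ord_le[OF _ slice_filt[OF assms(2)]]) (use assms in \<open>auto simp: ord2_le_def\<close>)
  moreover have "?r \<in> ord_le k"
    using twist_ord2_le[OF assms(1)] by (simp add: ord2_le_def)
  ultimately show "slice t (euler2 z - scale (of_nat (Suc k)) z) \<in> ord_le k"
    by (simp add: subspD(2)[OF subsp_ord_le])
qed

lemma ord2_le_ex: "z \<in> filt2 n \<Longrightarrow> z \<in> ord2_le n"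
  using slice_filt[of z n] filt_mono[of "n - 1" n] filt_ord_le by (auto simp: ord2_le_def)

end

section \<open>Linear maps from a space with a basis to a module\<close>

text \<open>Coordinates in the form of a \<open>module\<close> record, because the free preLie
  algebra is one; linear maps between the two are then elements of
  \<open>linear_hom\<close>.\<close>

definition free_mod :: "'a set \<Rightarrow> ('k::field_char_0, 'a \<Rightarrow>\<^sub>0 'k) module" where
  "free_mod S = \<lparr>carrier = {x. Poly_Mapping.keys x \<subseteq> S}, monoid.mult = undefined, one = undefined,
     zero = 0, add = (+), module.smult = scale\<rparr>"

lemma linear_homI:
  "(\<And>x. x \<in> carrier A \<Longrightarrow> f x \<in> carrier B) \<Longrightarrow>
   (\<And>x y. x \<in> carrier A \<Longrightarrow> y \<in> carrier A \<Longrightarrow> f (x \<oplus>\<^bsub>A\<^esub> y) = f x \<oplus>\<^bsub>B\<^esub> f y) \<Longrightarrow>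
   (\<And>c x. x \<in> carrier A \<Longrightarrow> f (c \<odot>\<^bsub>A\<^esub> x) = c \<odot>\<^bsub>B\<^esub> f x) \<Longrightarrow> f \<in> linear_hom A B"
  by (simp add: linear_hom_def)

lemma linear_homD:
  assumes "f \<in> linear_hom A B"
  shows "x \<in> carrier A \<Longrightarrow> f x \<in> carrier B"
    "x \<in> carrier A \<Longrightarrow> y \<in> carrier A \<Longrightarrow> f (x \<oplus>\<^bsub>A\<^esub> y) = f x \<oplus>\<^bsub>B\<^esub> f y"
    "x \<in> carrier A \<Longrightarrow> f (c \<odot>\<^bsub>A\<^esub> x) = c \<odot>\<^bsub>B\<^esub> f x"
  using assms by (auto simp: linear_hom_def)

lemma free_mod_linear_homD:
  assumes "f \<in> linear_hom (free_mod S) M"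
  shows "Poly_Mapping.keys x \<subseteq> S \<Longrightarrow> f x \<in> carrier M"
    "Poly_Mapping.keys x \<subseteq> S \<Longrightarrow> Poly_Mapping.keys y \<subseteq> S \<Longrightarrow> f (x + y) = f x \<oplus>\<^bsub>M\<^esub> f y"
    "Poly_Mapping.keys x \<subseteq> S \<Longrightarrow> f (scale c x) = c \<odot>\<^bsub>M\<^esub> f x"
  using linear_homD[OF assms] by (auto simp: free_mod_def)

lemma span_induct [consumes 1, case_names zero add]:
  assumes x: "Poly_Mapping.keys x \<subseteq> S" and 0: "P 0"
    and add: "\<And>c a y. a \<in> S \<Longrightarrow> Poly_Mapping.keys y \<subseteq> S \<Longrightarrow> P y \<Longrightarrow> P (scale c (basis a) + y)"
  shows "P x"
proof -
  let ?s = "\<lambda>T. \<Sum>a\<in>T. scale (Poly_Mapping.lookup x a) (basis a)"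
  have "P (?s T)" if "T \<subseteq> Poly_Mapping.keys x" for T
    using finite_subset[OF that finite_keys] that
  proof (induction T rule: finite_induct)
    case (insert a T)
    have "Poly_Mapping.keys (?s T) \<subseteq> S"
      using insert.prems x keys_scale_subset
      by (intro subsp_sum[OF subsp_keys[of S], simplified] order_trans[OF keys_scale_subset]) auto
    then show ?case using insert x by (auto intro!: add)
  qed (simp add: 0)
  from this[of "Poly_Mapping.keys x"] show ?thesis
    using linear_extend_basis_id[of x] by (simp add: linear_extend_def)
qed

lemma free_mod_linear_hom_eqI:
  fixes M :: "('k::field_char_0, 'b) module"
  assumes f: "f \<in> linear_hom (free_mod S) M" and g: "g \<in> linear_hom (free_mod S) M"
    and M: "module base_field M"
    and x: "Poly_Mapping.keys x \<subseteq> S" and eq: "\<And>a. a \<in> S \<Longrightarrow> f (basis a) = g (basis a)"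
  shows "f x = g x"
  using x
proof (induction x rule: span_induct)
  case zero
  have "h 0 = \<zero>\<^bsub>M\<^esub>" if "h \<in> linear_hom (free_mod S) M" for h
    using free_mod_linear_homD(1)[OF that, of 0] free_mod_linear_homD(3)[OF that, of 0 0] module.smult_l_null[OF M] by simp
  from this[OF f] this[OF g] show ?case by simp
next
  case (add c a y)
  have "Poly_Mapping.keys (scale c (basis a)) \<subseteq> S"
    using add keys_scale_subset[of c "basis a"] by auto
  then show ?case
    using add free_mod_linear_homD(2)[OF f, of "scale c (basis a)" y]
      free_mod_linear_homD(2)[OF g, of "scale c (basis a)" y]
      free_mod_linear_homD(3)[OF f, of "basis a" c] free_mod_linear_homD(3)[OF g, of "basis a" c]
    by (simp add: eq)
qed

lemma free_mod_linear_hom_ex: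
  fixes M :: "('k::field_char_0, 'b) module" and S :: "'a set"
  assumes M: "module (base_field :: 'k::field_char_0 ring) M" and g: "\<And>a. a \<in> S \<Longrightarrow> g a \<in> carrier M"
  obtains f :: "('a \<Rightarrow>\<^sub>0 'k) \<Rightarrow> 'b" where "f \<in> linear_hom (free_mod S) M" "\<And>a. a \<in> S \<Longrightarrow> f (basis a) = g a"
proof -
  interpret M: module "base_field :: 'k ring" M by (rule M)
  define f where "f x = (\<Oplus>\<^bsub>M\<^esub>a\<in>Poly_Mapping.keys x. Poly_Mapping.lookup x a \<odot>\<^bsub>M\<^esub> g a)" for x :: "'a \<Rightarrow>\<^sub>0 'k"
  have f: "f x = (\<Oplus>\<^bsub>M\<^esub>a\<in>T. Poly_Mapping.lookup x a \<odot>\<^bsub>M\<^esub> g a)"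
    if "finite T" "Poly_Mapping.keys x \<subseteq> T" "T \<subseteq> S" for T and x :: "'a \<Rightarrow>\<^sub>0 'k"
    unfolding f_def
    by (rule M.add.finprod_mono_neutral_cong_left)
      (use that g in \<open>auto simp: in_keys_iff M.smult_l_null[simplified]\<close>)
  show ?thesis
  proof (rule that[of f])
    show "f (basis a) = g a" if "a \<in> S" for a
      using that g by (simp add: f_def lookup_basis M.smult_one[simplified])
    show "f \<in> linear_hom (free_mod S) M"
    proof (rule linear_homI)
      fix x :: "'a \<Rightarrow>\<^sub>0 'k" assume "x \<in> carrier (free_mod S)"
      then have x: "Poly_Mapping.keys x \<subseteq> S" by (simp add: free_mod_def)
      show "f x \<in> carrier M" unfolding f_def using x g by (intro M.finsum_closed) auto
      show "f (c \<odot>\<^bsub>free_mod S\<^esub> x) = c \<odot>\<^bsub>M\<^esub> f x" for c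
      proof -
        have "f (scale c x) = (\<Oplus>\<^bsub>M\<^esub>a\<in>Poly_Mapping.keys x. c \<odot>\<^bsub>M\<^esub> (Poly_Mapping.lookup x a \<odot>\<^bsub>M\<^esub> g a))"
          using x g keys_scale_subset[of c x]
          by (subst f[of "Poly_Mapping.keys x"]) (auto intro!: M.finsum_cong' simp: M.smult_assoc1[simplified])
        also have "\<dots> = c \<odot>\<^bsub>M\<^esub> f x"
          unfolding f_def using x g by (intro M.finsum_smult_ldistr[symmetric]) auto
        finally show ?thesis by (simp add: free_mod_def)
      qed
      fix y :: "'a \<Rightarrow>\<^sub>0 'k" assume "y \<in> carrier (free_mod S)"
      then have y: "Poly_Mapping.keys y \<subseteq> S" by (simp add: free_mod_def)
      let ?T = "Poly_Mapping.keys x \<union> Poly_Mapping.keys y"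
      have "f (x + y) = (\<Oplus>\<^bsub>M\<^esub>a\<in>?T. Poly_Mapping.lookup x a \<odot>\<^bsub>M\<^esub> g a \<oplus>\<^bsub>M\<^esub> Poly_Mapping.lookup y a \<odot>\<^bsub>M\<^esub> g a)"
        using x y g Poly_Mapping.keys_add[of x y]
        by (subst f[of ?T]) (auto intro!: M.finsum_cong' simp: lookup_add M.smult_l_distr[simplified])
      also have "\<dots> = f x \<oplus>\<^bsub>M\<^esub> f y"
        using x y g by (subst M.finsum_addf) (auto simp: f[of ?T])
      finally show "f (x \<oplus>\<^bsub>free_mod S\<^esub> y) = f x \<oplus>\<^bsub>M\<^esub> f y" by (simp add: free_mod_def)
    qed
  qed
qed

section \<open>Freeness\<close>

lemma prelie_algebra_free_prelie: "prelie_algebra (free_prelie V)"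
proof -
  interpret F: module base_field "free_prelie V" by (rule module_free_prelie)
  show ?thesis
  proof (unfold_locales, goal_cases)
    case (6 x y z)
    then show ?case
      by (subst (1 2) F.minus_eq_smult)
        (auto simp: carrier_free_prelie free_prelie_ops intro!: pl_class_eqI intro: pl_cong.prelie
          del: subset_antisym)
  qed (auto simp: carrier_free_prelie free_prelie_ops intro!: pl_class_eqI intro: pl_axioms
      del: subset_antisym)
qed

lemma free_gen_add:
  assumes "v \<in> carrier V" "w \<in> carrier V" "v \<oplus>\<^bsub>V\<^esub> w \<in> carrier V"
  shows "free_gen V (v \<oplus>\<^bsub>V\<^esub> w) = free_gen V v \<oplus>\<^bsub>free_prelie V\<^esub> free_gen V w"
  using assms by (simp add: free_gen_def free_prelie_ops pl_class_eqI[OF pl_cong.gen_add])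

lemma free_gen_scale:
  assumes "v \<in> carrier V" "c \<odot>\<^bsub>V\<^esub> v \<in> carrier V"
  shows "free_gen V (c \<odot>\<^bsub>V\<^esub> v) = c \<odot>\<^bsub>free_prelie V\<^esub> free_gen V v"
  using assms by (simp add: free_gen_def free_prelie_ops(3)[of "Gen v" V "Gen v"] pl_class_eqI[OF pl_cong.gen_scale])

lemma free_gen_closed: "v \<in> carrier V \<Longrightarrow> free_gen V v \<in> carrier (free_prelie V)"
  by (simp add: free_gen_def carrier_free_prelie)

context prelie_coalgebra
begin

section \<open>The preLie algebra spanned by the basis, and its submodule of primitive
  elements\<close>

definition alg :: "('k, 'b \<Rightarrow>\<^sub>0 'k) module" where
  "alg = \<lparr>carrier = {x. Poly_Mapping.keys x \<subseteq> B}, monoid.mult = bilin prd, one = undefined,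
     zero = 0, add = (+), module.smult = scale\<rparr>"

lemma alg_simps [simp]:
  "x \<in> carrier alg \<longleftrightarrow> Poly_Mapping.keys x \<subseteq> B" "x \<otimes>\<^bsub>alg\<^esub> y = bilin prd x y" "\<zero>\<^bsub>alg\<^esub> = 0"
  "x \<oplus>\<^bsub>alg\<^esub> y = x + y" "c \<odot>\<^bsub>alg\<^esub> x = scale c x"
  by (simp_all add: alg_def)

lemma keys_bilin_prd:
  assumes "Poly_Mapping.keys x \<subseteq> B" "Poly_Mapping.keys y \<subseteq> B"
  shows "Poly_Mapping.keys (bilin prd x y) \<subseteq> B"
  using bilin_mem[OF subsp_keys[of B], of x y prd] assms keys_prd by blast

lemma bilin_prd_eq_\<mu>: "bilin prd x y = \<mu> (tensor x y)"
  by (rule bilin_eqI[of "bilin prd" "\<lambda>x y. \<mu> (tensor x y)"])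
    (simp_all add: linmap_intros)

lemma bilin_prd_filt: "x \<in> filt m \<Longrightarrow> y \<in> filt n \<Longrightarrow> m + n \<le> l \<Longrightarrow> bilin prd x y \<in> filt l"
  by (simp add: bilin_prd_eq_\<mu> \<mu>_filt tensor_filt2)

lemma prelie_bilin:
  assumes "Poly_Mapping.keys x \<subseteq> B" "Poly_Mapping.keys y \<subseteq> B" "Poly_Mapping.keys z \<subseteq> B"
  shows "bilin prd (bilin prd x y) z - bilin prd x (bilin prd y z)
    = bilin prd (bilin prd x z) y - bilin prd x (bilin prd z y)"
proof (rule linmap_eqI[of "\<lambda>x. bilin prd (bilin prd x y) z - bilin prd x (bilin prd y z)"
      "\<lambda>x. bilin prd (bilin prd x z) y - bilin prd x (bilin prd z y)"])
  fix a assume a: "a \<in> Poly_Mapping.keys x"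
  let ?a = "basis a"
  show "bilin prd (bilin prd ?a y) z - bilin prd ?a (bilin prd y z)
    = bilin prd (bilin prd ?a z) y - bilin prd ?a (bilin prd z y)"
  proof (rule bilin_eqI[of "\<lambda>y z. bilin prd (bilin prd ?a y) z - bilin prd ?a (bilin prd y z)"
        "\<lambda>y z. bilin prd (bilin prd ?a z) y - bilin prd ?a (bilin prd z y)"])
    fix b c assume "b \<in> Poly_Mapping.keys y" "c \<in> Poly_Mapping.keys z"
    then show "bilin prd (bilin prd ?a (basis b)) (basis c) - bilin prd ?a (bilin prd (basis b) (basis c))
      = bilin prd (bilin prd ?a (basis c)) (basis b) - bilin prd ?a (bilin prd (basis c) (basis b))"
      using prelie_basis[of a b c] a assms by auto
  qed (intro linmap_intros linmap_bilin_comp linmap_bilin_left linmap_bilin_right)+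
qed (intro linmap_intros linmap_bilin_comp)+

lemma module_alg: "module base_field alg"
proof (rule moduleI)
  show "cring (base_field :: 'k::field_char_0 ring)"
    by (rule cring_from_type_algebra)
  note K = subspD[OF subsp_keys[of B], simplified]
  show "abelian_group alg"
  proof (rule abelian_groupI)
    fix x assume "x \<in> carrier alg"
    then show "\<exists>y\<in>carrier alg. y \<oplus>\<^bsub>alg\<^esub> x = \<zero>\<^bsub>alg\<^esub>"
      using K(3)[of x "-1"] by (intro bexI[of _ "scale (-1) x"]) (auto simp: scale_minus)
  qed (auto simp: add_ac K)
  show "a \<odot>\<^bsub>alg\<^esub> x \<in> carrier alg" if "x \<in> carrier alg" for a x
    using that K(3) by simp
qed (auto simp: scale_add)

lemma prelie_algebra_alg: "prelie_algebra alg"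
proof -
  interpret A: module base_field alg by (rule module_alg)
  show ?thesis
  proof (unfold_locales, goal_cases)
    case (6 x y z)
    have m: "u \<ominus>\<^bsub>alg\<^esub> w = u - w" if "Poly_Mapping.keys u \<subseteq> B" "Poly_Mapping.keys w \<subseteq> B" for u w
      using A.minus_eq_smult[of u w] that by (simp add: scale_minus)
    show ?case using prelie_bilin[of x y z] 6 by (simp add: m keys_bilin_prd)
  qed (auto simp: linmap_simps[OF linmap_bilin_left] linmap_simps[OF linmap_bilin_right]
      dest: keys_bilin_prd[THEN subsetD, rotated 2])
qed

abbreviation V :: "('k, 'b \<Rightarrow>\<^sub>0 'k) module" where
  "V \<equiv> alg\<lparr>carrier := prim\<rparr>"

abbreviation F :: "('k, ('b \<Rightarrow>\<^sub>0 'k, 'k) pl_term set) module" where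
  "F \<equiv> free_prelie V"

lemma subsp_prim: "subsp prim"
  using subsp_keys[of B] by (simp add: prim_def subsp_def linear_extend_simps) blast

lemma V_simps [simp]: "carrier V = prim" "x \<oplus>\<^bsub>V\<^esub> y = x + y" "c \<odot>\<^bsub>V\<^esub> x = scale c x"
  by (simp_all add: alg_def)

lemma submodule_prim: "submodule prim base_field alg"
proof -
  interpret A: module base_field alg by (rule module_alg)
  have inv: "\<ominus>\<^bsub>alg\<^esub> x = - x" if "x \<in> carrier alg" for x
  proof (rule A.minus_equality)
    show "- x \<in> carrier alg" using that by simp
  qed (use that in auto)
  show ?thesis
    by (rule module.submoduleI[OF module_alg])
      (use subspD[OF subsp_prim] subspD(3)[OF subsp_prim, of _ "-1"] in
        \<open>auto simp: prim_def inv scale_minus\<close>)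
qed

end

section \<open>The canonical morphism and its surjectivity\<close>

locale prelie_coalgebra_hom = prelie_coalgebra B deg prd cop
  for B :: "'b set" and deg and prd :: "'b \<Rightarrow> 'b \<Rightarrow> 'b \<Rightarrow>\<^sub>0 'k::field_char_0" and cop +
  fixes \<phi>
  assumes \<phi>_hom: "\<phi> \<in> prelie_hom F alg"
    and \<phi>_gen: "v \<in> prim \<Longrightarrow> \<phi> (free_gen V v) = v"
begin

sublocale F: prelie_algebra F
  by (rule prelie_algebra_free_prelie)

lemma \<phi>_simps:
  assumes "u \<in> carrier F"
  shows "Poly_Mapping.keys (\<phi> u) \<subseteq> B" "y \<in> carrier F \<Longrightarrow> \<phi> (u \<oplus>\<^bsub>F\<^esub> y) = \<phi> u + \<phi> y"
    "y \<in> carrier F \<Longrightarrow> \<phi> (u \<otimes>\<^bsub>F\<^esub> y) = bilin prd (\<phi> u) (\<phi> y)" "\<phi> (c \<odot>\<^bsub>F\<^esub> u) = scale c (\<phi> u)"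
  using \<phi>_hom assms by (simp_all add: prelie_hom_def linear_hom_def Pi_def)

lemma \<phi>_zero: "\<phi> \<zero>\<^bsub>F\<^esub> = 0"
  using \<phi>_simps(4)[OF F.zero_closed, of 0] F.smult_l_null[OF F.zero_closed] by simp

text \<open>A generator need not be homogeneous: it counts with its top degree.\<close>

inductive wt :: "nat \<Rightarrow> ('b \<Rightarrow>\<^sub>0 'k, 'k) pl_term set \<Rightarrow> bool" where
  gen: "v \<in> prim \<Longrightarrow> v \<in> filt n \<Longrightarrow> wt n (free_gen V v)"
| zero: "wt n \<zero>\<^bsub>F\<^esub>"
| add: "wt n u \<Longrightarrow> wt n y \<Longrightarrow> wt n (u \<oplus>\<^bsub>F\<^esub> y)"
| scale: "wt n u \<Longrightarrow> wt n (c \<odot>\<^bsub>F\<^esub> u)"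
| mult: "wt a u \<Longrightarrow> wt b y \<Longrightarrow> 0 < a \<Longrightarrow> 0 < b \<Longrightarrow> a + b \<le> n \<Longrightarrow> wt n (u \<otimes>\<^bsub>F\<^esub> y)"
| mono: "wt m u \<Longrightarrow> m \<le> n \<Longrightarrow> wt n u"

lemma wt_closed: "wt n u \<Longrightarrow> u \<in> carrier F"
  by (induction rule: wt.induct) (auto simp del: free_prelie_zero intro!: free_gen_closed)

lemma wt_\<phi>: "wt n u \<Longrightarrow> \<phi> u \<in> filt n"
proof (induction rule: wt.induct)
  case (mult a u b y n)
  then show ?case by (simp add: \<phi>_simps wt_closed bilin_prd_filt)
next
  case (mono m u n)
  then show ?case using filt_mono by blast
qed (use subspD[OF subsp_filt] in
    \<open>auto simp: \<phi>_gen \<phi>_zero \<phi>_simps wt_closed simp del: free_prelie_zero\<close>)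

lemma wt_ex:
  assumes "u \<in> carrier F" shows "\<exists>n>0. wt n u"
proof -
  have filt_ex: "\<exists>n. x \<in> filt n" if "Poly_Mapping.keys x \<subseteq> B" for x
    using that by (intro exI[of _ "Max (insert 0 (deg ` Poly_Mapping.keys x))"]) (auto simp: filt_def)
  have "\<exists>n>0. wt n (pl_class V t)" if "t \<in> pl_terms V" for t
    using that
  proof (induction t)
    case (Gen v)
    then obtain n where "v \<in> filt n" using filt_ex[of v] by (auto simp: prim_def)
    \<comment> \<open>Weight n may be 0 here, but the rule for products requires positive weights of
      both factors.\<close>
    then have "wt (Suc n) (free_gen V v)"
      using Gen filt_mono[of n "Suc n"] by (intro wt.gen) auto
    then show ?case unfolding free_gen_def by blast
  next
    case Zero
    then show ?case using wt.zero[of 1] by auto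
  next
    case (Add s t)
    then obtain m n where mn: "wt m (pl_class V s)" "wt n (pl_class V t)" "0 < m" by auto
    then have "wt (m + n) (pl_class V s \<oplus>\<^bsub>F\<^esub> pl_class V t)"
      by (intro wt.add wt.mono[OF mn(1)] wt.mono[OF mn(2)]) simp_all
    then show ?case using Add.prems mn(3) by (intro exI[of _ "m + n"]) (simp add: free_prelie_ops)
  next
    case (Scale c s)
    then obtain m where mn: "wt m (pl_class V s)" "0 < m" by auto
    then have "wt m (c \<odot>\<^bsub>F\<^esub> pl_class V s)" by (intro wt.scale)
    then show ?case using Scale.prems mn(2) free_prelie_ops(3)[of s V s] by (intro exI[of _ m]) simp
  next
    case (Mul s t)
    then obtain m n where mn: "wt m (pl_class V s)" "wt n (pl_class V t)" "0 < m" "0 < n" by auto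
    then have "wt (m + n) (pl_class V s \<otimes>\<^bsub>F\<^esub> pl_class V t)" by (intro wt.mult[OF mn]) simp
    then show ?case using Mul.prems mn(3) by (intro exI[of _ "m + n"]) (simp add: free_prelie_ops)
  qed
  then show ?thesis using assms by (auto simp: carrier_free_prelie)
qed

text \<open>The images of elements of weight \<open>n\<close> form a subspace, so a preimage can be
  assembled from preimages of the individual terms.\<close>

lemma wt_linear_extend:
  assumes "\<And>a. a \<in> Poly_Mapping.keys x \<Longrightarrow> \<exists>u. wt n u \<and> \<phi> u = f a"
  shows "\<exists>u. wt n u \<and> \<phi> u = linear_extend f x"
proof -
  have "subsp {y. \<exists>u. wt n u \<and> \<phi> u = y}"
    unfolding subsp_def
  proof (intro conjI ballI allI)
    show "0 \<in> {y. \<exists>u. wt n u \<and> \<phi> u = y}" using wt.zero[of n] \<phi>_zero by blast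
  next
    fix x y assume "x \<in> {y. \<exists>u. wt n u \<and> \<phi> u = y}" "y \<in> {y. \<exists>u. wt n u \<and> \<phi> u = y}"
    then obtain u w where "wt n u" "\<phi> u = x" "wt n w" "\<phi> w = y" by blast
    then show "x + y \<in> {y. \<exists>u. wt n u \<and> \<phi> u = y}"
      using wt.add[of n u w] \<phi>_simps(2)[OF wt_closed wt_closed, of n u n w] by blast
  next
    fix c x assume "x \<in> {y. \<exists>u. wt n u \<and> \<phi> u = y}"
    then obtain u where "wt n u" "\<phi> u = x" by blast
    then show "scale c x \<in> {y. \<exists>u. wt n u \<and> \<phi> u = y}"
      using wt.scale[of n u c] \<phi>_simps(4)[OF wt_closed, of n u c] by blast
  qed
  from linear_extend_mem[OF this, of x f] assms show ?thesis by blast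
qed

text \<open>
  On \<open>ord_le (k + 2)\<close> the element \<open>(k + 1) x\<close> differs from \<open>\<mu> (\<delta> x)\<close>, a combination of products of
  elements of smaller degree, by an element of \<open>ord_le (k + 1)\<close>.
\<close>

lemma wt_surj: "x \<in> filt n \<Longrightarrow> \<exists>u. wt n u \<and> \<phi> u = x"
proof (induction n arbitrary: x rule: less_induct)
  case (less n)
  have prod: "\<exists>u. wt n u \<and> \<phi> u = \<mu> z" if z: "z \<in> filt2 n" for z
  proof (rule wt_linear_extend)
    fix w assume "w \<in> Poly_Mapping.keys z"
    then obtain a b where ab: "w = (a, b)" "a \<in> B" "b \<in> B" "deg a + deg b \<le> n"
      using z by (auto simp: filt2_def)
    have "deg a < n" "deg b < n" using ab deg_pos[OF ab(2)] deg_pos[OF ab(3)] by auto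
    then obtain u y where "wt (deg a) u" "\<phi> u = basis a" "wt (deg b) y" "\<phi> y = basis b"
      using less.IH basis_filt ab(2,3) by (meson order_refl)
    then show "\<exists>u. wt n u \<and> \<phi> u = (case w of (a, b) \<Rightarrow> prd a b)"
      using ab deg_pos by (intro exI[of _ "u \<otimes>\<^bsub>F\<^esub> y"]) (auto simp: \<phi>_simps wt_closed intro: wt.mult)
  qed
  have "\<exists>u. wt n u \<and> \<phi> u = x" if "x \<in> ord_le k" "x \<in> filt n" for k x
    using that
  proof (induction k arbitrary: x)
    case 0
    then show ?case using wt.zero[of n] \<phi>_zero by auto
  next
    case (Suc k)
    show ?case
    proof (cases k)
      case 0
      then have "x \<in> prim" using Suc.prems filt_prim by simp
      then show ?thesis using Suc.prems wt.gen \<phi>_gen by blast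
    next
      case (Suc j)
      have E: "\<mu> (\<delta> x) \<in> filt n" using Suc.prems by (intro \<mu>_filt \<delta>_filt2)
      obtain u where u: "wt n u" "\<phi> u = \<mu> (\<delta> x)" using prod[OF \<delta>_filt2] Suc.prems by blast
      let ?r = "\<mu> (\<delta> x) - scale (of_nat k) x"
      have "?r \<in> filt n"
        using E Suc.prems subspD(3)[OF subsp_filt] by (intro subsp_minus[OF subsp_filt])
      then obtain y where y: "wt n y" "\<phi> y = ?r"
        using Suc.IH euler_ord_le[OF Suc.prems] by blast
      \<comment> \<open>Solves ?r = \<mu> (\<delta> x) - k x for x. The factor k is nonzero because
        the case k = 0, where x is a generator, has been separated.\<close>
      let ?u = "inverse (of_nat k) \<odot>\<^bsub>F\<^esub> (u \<oplus>\<^bsub>F\<^esub> (-1) \<odot>\<^bsub>F\<^esub> y)"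
      have "wt n ?u" using u y by (intro wt.scale wt.add)
      moreover have "\<phi> ?u = x"
      proof -
        have "\<phi> ?u = scale (inverse (of_nat k)) (\<phi> u - \<phi> y)"
          using wt_closed[OF u(1)] wt_closed[OF y(1)] by (simp add: \<phi>_simps scale_minus)
        moreover have "of_nat k \<noteq> (0 :: 'k)" using Suc by (simp del: of_nat_Suc)
        ultimately show ?thesis by (simp add: u y)
      qed
      ultimately show ?thesis by blast
    qed
  qed
  then show ?case using less.prems filt_ord_le by blast
qed

text \<open>\<open>wt_surj\<close> provides preimages without any linearity. Choosing them for basis
  elements only leaves room for linear extension.\<close>

definition lift :: "'b \<Rightarrow> ('b \<Rightarrow>\<^sub>0 'k, 'k) pl_term set" where
  "lift a = (SOME u. wt (deg a) u \<and> \<phi> u = basis a)"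

lemma lift:
  assumes "a \<in> B" shows "wt (deg a) (lift a)" "\<phi> (lift a) = basis a"
  using someI_ex[OF wt_surj[OF basis_filt[OF assms order_refl]]] by (simp_all add: lift_def)

lemma lift_closed: "a \<in> B \<Longrightarrow> lift a \<in> carrier F"
  using lift(1) wt_closed by blast

lemma linear_hom_\<phi>_comp:
  assumes f: "f \<in> linear_hom (free_mod S) F" and x: "Poly_Mapping.keys x \<subseteq> S"
  shows "\<phi> (f x) = linear_extend (\<lambda>a. \<phi> (f (basis a))) x"
  using x
proof (induction x rule: span_induct)
  case zero
  have "f 0 = \<zero>\<^bsub>F\<^esub>"
    using free_mod_linear_homD(1)[OF f, of 0] free_mod_linear_homD(3)[OF f, of 0 0]
      F.smult_l_null[of "f 0"] by simp
  then show ?case by (simp add: \<phi>_zero linear_extend_simps del: free_prelie_zero)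
next
  case (add c a y)
  have "Poly_Mapping.keys (scale c (basis a)) \<subseteq> S"
    using add keys_scale_subset[of c "basis a"] by auto
  then show ?case
    using add free_mod_linear_homD(1)[OF f]
    by (simp add: free_mod_linear_homD(2,3)[OF f] \<phi>_simps linear_extend_simps)
qed

lemma linear_hom_wt:
  assumes f: "f \<in> linear_hom (free_mod S) F"
    and x: "Poly_Mapping.keys x \<subseteq> T" "T \<subseteq> S" and T: "\<And>a. a \<in> T \<Longrightarrow> wt n (f (basis a))"
  shows "wt n (f x)"
  using x(1)
proof (induction x rule: span_induct)
  case zero
  have "f 0 = \<zero>\<^bsub>F\<^esub>"
    using free_mod_linear_homD(1)[OF f, of 0] free_mod_linear_homD(3)[OF f, of 0 0]
      F.smult_l_null[of "f 0"] by simp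
  then show ?case using wt.zero by (simp del: free_prelie_zero)
next
  case (add c a y)
  have "Poly_Mapping.keys (scale c (basis a)) \<subseteq> S"
    using add x keys_scale_subset[of c "basis a"] by auto
  then have "f (scale c (basis a) + y) = c \<odot>\<^bsub>F\<^esub> f (basis a) \<oplus>\<^bsub>F\<^esub> f y"
    using add x by (subst free_mod_linear_homD(2)[OF f]) (auto simp: free_mod_linear_homD(3)[OF f])
  then show ?case using add T by (simp add: wt.add wt.scale)
qed

end

section \<open>Injectivity of the canonical morphism\<close>

context prelie_coalgebra_hom
begin

lemma free_gen_zero: "free_gen V 0 = \<zero>\<^bsub>F\<^esub>"
  using free_gen_scale[of 0 V 0] subspD(1)[OF subsp_prim]
    F.smult_l_null[OF free_gen_closed[of 0 V]] by (simp del: free_prelie_zero)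

definition faithful :: "nat \<Rightarrow> bool" where
  "faithful n \<longleftrightarrow> (\<forall>u. wt n u \<longrightarrow> \<phi> u = 0 \<longrightarrow> u = \<zero>\<^bsub>F\<^esub>)"

lemma faithfulD:
  assumes "faithful n" "wt n u" "wt n y" "\<phi> u = \<phi> y"
  shows "u = y"
proof -
  have cl: "u \<in> carrier F" "y \<in> carrier F" using assms wt_closed by auto
  have "wt n (u \<oplus>\<^bsub>F\<^esub> (-1) \<odot>\<^bsub>F\<^esub> y)" using assms by (intro wt.add wt.scale)
  moreover have "\<phi> (u \<oplus>\<^bsub>F\<^esub> (-1) \<odot>\<^bsub>F\<^esub> y) = 0"
    using cl assms(4) by (simp add: \<phi>_simps scale_minus)
  ultimately have "u \<ominus>\<^bsub>F\<^esub> y = \<zero>\<^bsub>F\<^esub>"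
    using assms(1) cl F.minus_eq_smult[of u y] unfolding faithful_def by simp
  then show ?thesis using cl F.M.minus_equality[of u "\<ominus>\<^bsub>F\<^esub> y"]
    unfolding a_minus_def by (metis F.M.a_inv_closed F.M.minus_minus)
qed

text \<open>One step of the induction on the weight n. Both maps extend choices on basis elements
  linearly; multiplicativity of \<open>\<tau>\<close> has to be earned from
  \<open>IH\<close>.\<close>

context
  fixes \<tau> :: "('b \<Rightarrow>\<^sub>0 'k) \<Rightarrow> ('b \<Rightarrow>\<^sub>0 'k, 'k) pl_term set"
    and \<Theta> :: "('b \<times> 'b \<Rightarrow>\<^sub>0 'k) \<Rightarrow> ('b \<Rightarrow>\<^sub>0 'k, 'k) pl_term set"
    and n :: nat
  assumes \<tau>: "\<tau> \<in> linear_hom (free_mod B) F" "\<And>a. a \<in> B \<Longrightarrow> \<tau> (basis a) = lift a"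
    and \<Theta>: "\<Theta> \<in> linear_hom (free_mod (B \<times> B)) F"
      "\<And>w. w \<in> B \<times> B \<Longrightarrow> \<Theta> (basis w) = lift (fst w) \<otimes>\<^bsub>F\<^esub> lift (snd w)"
    and IH: "\<And>m. m < n \<Longrightarrow> faithful m"
begin

lemma \<tau>_closed: "Poly_Mapping.keys x \<subseteq> B \<Longrightarrow> \<tau> x \<in> carrier F"
  using free_mod_linear_homD(1)[OF \<tau>(1)] .

lemma \<phi>_\<tau>:
  assumes "Poly_Mapping.keys x \<subseteq> B" shows "\<phi> (\<tau> x) = x"
proof -
  have "\<phi> (\<tau> x) = linear_extend (\<lambda>a. \<phi> (\<tau> (basis a))) x"
    by (rule linear_hom_\<phi>_comp[OF \<tau>(1) assms])
  also have "\<dots> = linear_extend basis x"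
    by (rule linear_extend_cong) (use assms in \<open>auto simp: \<tau>(2) lift(2)\<close>)
  finally show ?thesis by simp
qed

lemma wt_\<tau>: "x \<in> filt m \<Longrightarrow> wt m (\<tau> x)"
  by (rule linear_hom_wt[OF \<tau>(1), of x "{b \<in> B. deg b \<le> m}"])
    (auto simp: filt_def \<tau>(2) intro: wt.mono[OF lift(1)])

lemma \<phi>_\<Theta>:
  assumes "z \<in> filt2 m" shows "\<phi> (\<Theta> z) = \<mu> z"
proof -
  have z: "Poly_Mapping.keys z \<subseteq> B \<times> B" using assms by (auto simp: filt2_def)
  have "\<phi> (\<Theta> z) = linear_extend (\<lambda>a. \<phi> (\<Theta> (basis a))) z"
    by (rule linear_hom_\<phi>_comp[OF \<Theta>(1) z])
  also have "\<dots> = \<mu> z"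
  proof (rule linear_extend_cong)
    fix w assume "w \<in> Poly_Mapping.keys z"
    then obtain a b where "w = (a, b)" "a \<in> B" "b \<in> B" using z by auto
    then show "\<phi> (\<Theta> (basis w)) = (case w of (a, b) \<Rightarrow> prd a b)"
      by (simp add: \<Theta>(2) \<phi>_simps lift_closed lift(2))
  qed
  finally show ?thesis .
qed

lemma \<Theta>_tensor:
  assumes "Poly_Mapping.keys x \<subseteq> B" "Poly_Mapping.keys y \<subseteq> B"
  shows "\<Theta> (tensor x y) = \<tau> x \<otimes>\<^bsub>F\<^esub> \<tau> y"
proof -
  have K: "Poly_Mapping.keys (tensor x y :: _ \<Rightarrow>\<^sub>0 'k) \<subseteq> B \<times> B"
    if "Poly_Mapping.keys x \<subseteq> B" "Poly_Mapping.keys y \<subseteq> B" for x y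
    using bilin_mem[OF subsp_keys[of "B \<times> B"], of x y "\<lambda>a b. basis (a, b)"] that by auto
  have sum: "Poly_Mapping.keys (x + y) \<subseteq> B"
    if "Poly_Mapping.keys x \<subseteq> B" "Poly_Mapping.keys y \<subseteq> B" for x y :: "'b \<Rightarrow>\<^sub>0 'k"
    using that subspD(2)[OF subsp_keys[of B], of x y] by simp
  note bl = linmap_simps[OF linmap_bilin_left] and br = linmap_simps[OF linmap_bilin_right]
  have "(\<lambda>x. \<Theta> (tensor x y)) x = (\<lambda>x. \<tau> x \<otimes>\<^bsub>F\<^esub> \<tau> y) x"
  proof (rule free_mod_linear_hom_eqI[OF _ _ F.module_axioms assms(1),
        of "\<lambda>x. \<Theta> (tensor x y)" "\<lambda>x. \<tau> x \<otimes>\<^bsub>F\<^esub> \<tau> y"])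
    show "(\<lambda>x. \<Theta> (tensor x y)) \<in> linear_hom (free_mod B) F"
      by (rule linear_homI) (use assms in
        \<open>simp_all add: free_mod_def bl free_mod_linear_homD[OF \<Theta>(1)] K\<close>)
    show "(\<lambda>x. \<tau> x \<otimes>\<^bsub>F\<^esub> \<tau> y) \<in> linear_hom (free_mod B) F"
      by (rule linear_homI) (use assms in
        \<open>simp_all add: free_mod_def free_mod_linear_homD[OF \<tau>(1)] F.prod_l_distr F.prod_smult_l\<close>)
    fix a assume a: "a \<in> B"
    show "\<Theta> (tensor (basis a) y) = \<tau> (basis a) \<otimes>\<^bsub>F\<^esub> \<tau> y"
    proof (rule free_mod_linear_hom_eqI[OF _ _ F.module_axioms assms(2),
          of "\<lambda>y. \<Theta> (tensor (basis a) y)" "\<lambda>y. \<tau> (basis a) \<otimes>\<^bsub>F\<^esub> \<tau> y"])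
      show "(\<lambda>y. \<Theta> (tensor (basis a) y)) \<in> linear_hom (free_mod B) F"
        by (rule linear_homI) (use a in
          \<open>simp_all add: free_mod_def br free_mod_linear_homD[OF \<Theta>(1)] K del: bilin_basis\<close>)
      show "(\<lambda>y. \<tau> (basis a) \<otimes>\<^bsub>F\<^esub> \<tau> y) \<in> linear_hom (free_mod B) F"
        by (rule linear_homI) (use a in
          \<open>simp_all add: free_mod_def free_mod_linear_homD[OF \<tau>(1)] F.prod_r_distr F.prod_smult_r\<close>)
      show "\<Theta> (tensor (basis a) (basis b)) = \<tau> (basis a) \<otimes>\<^bsub>F\<^esub> \<tau> (basis b)" if "b \<in> B" for b
        using a that by (simp add: \<Theta>(2) \<tau>(2))
    qed
  qed
  then show ?thesis by simp
qed

text \<open>Both sides have weight a + b and the same image under \<open>\<phi>\<close>, so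
  faithfulness below n identifies them. At weight n itself this is not yet available, which is why
  products are recorded there by \<open>\<Theta>\<close>.\<close>

lemma \<tau>_mult:
  assumes "x \<in> filt a" "y \<in> filt b" "0 < a" "0 < b" "a + b < n"
  shows "\<tau> (bilin prd x y) = \<tau> x \<otimes>\<^bsub>F\<^esub> \<tau> y"
proof (rule faithfulD[OF IH[OF assms(5)]])
  show "wt (a + b) (\<tau> (bilin prd x y))"
    using assms by (intro wt_\<tau> bilin_prd_filt) auto
  show "wt (a + b) (\<tau> x \<otimes>\<^bsub>F\<^esub> \<tau> y)"
    by (rule wt.mult[OF wt_\<tau>[OF assms(1)] wt_\<tau>[OF assms(2)] assms(3,4) order_refl])
  show "\<phi> (\<tau> (bilin prd x y)) = \<phi> (\<tau> x \<otimes>\<^bsub>F\<^esub> \<tau> y)"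
  proof -
    have "Poly_Mapping.keys x \<subseteq> B" "Poly_Mapping.keys y \<subseteq> B"
      using assms by (auto simp: filt_def)
    then show ?thesis by (simp add: \<phi>_simps \<phi>_\<tau> \<tau>_closed keys_bilin_prd)
  qed
qed

text \<open>
  For a term \<open>p \<otimes> q\<close> of \<open>\<delta> a\<close>, the preLie identity in the free algebra exchanges \<open>q\<close> and \<open>t\<close> in
  \<open>(p \<bullet> t) \<bullet> q + p \<bullet> (q \<bullet> t)\<close>.
\<close>

lemma \<Theta>_exchange:
  assumes pq: "p \<in> B" "q \<in> B" "t \<in> B" "deg p + deg q + deg t \<le> n"
  shows "\<Theta> (tensor (prd p t) (basis q)) \<oplus>\<^bsub>F\<^esub> \<Theta> (tensor (basis p) (prd q t))
    = \<Theta> (tensor (prd p q) (basis t)) \<oplus>\<^bsub>F\<^esub> \<Theta> (tensor (basis p) (prd t q))"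
proof -
  have K: "Poly_Mapping.keys (prd a b) \<subseteq> B" if "a \<in> B" "b \<in> B" for a b
    using keys_prd[OF that] by auto
  \<comment> \<open>\<open>\<tau>_mult\<close> works strictly below n. It covers each inner product
    of two of the three elements, since the third has positive degree; the outer product may reach
    degree n and is handled by \<open>\<Theta>_tensor\<close>.\<close>
  have mult: "\<tau> (prd a b) = lift a \<otimes>\<^bsub>F\<^esub> lift b" if "a \<in> B" "b \<in> B" "deg a + deg b < n" for a b
    using \<tau>_mult[OF basis_filt[OF that(1) order_refl] basis_filt[OF that(2) order_refl]] deg_pos that
    by (simp add: \<tau>(2))
  have deg: "0 < deg p" "0 < deg q" "0 < deg t" using deg_pos pq by auto
  let ?p = "lift p" and ?q = "lift q" and ?t = "lift t"
  have cl: "?p \<in> carrier F" "?q \<in> carrier F" "?t \<in> carrier F" using pq lift_closed by auto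
  have pl: "(?p \<otimes>\<^bsub>F\<^esub> ?t \<otimes>\<^bsub>F\<^esub> ?q) \<ominus>\<^bsub>F\<^esub> ?p \<otimes>\<^bsub>F\<^esub> (?t \<otimes>\<^bsub>F\<^esub> ?q)
      = (?p \<otimes>\<^bsub>F\<^esub> ?q \<otimes>\<^bsub>F\<^esub> ?t) \<ominus>\<^bsub>F\<^esub> ?p \<otimes>\<^bsub>F\<^esub> (?q \<otimes>\<^bsub>F\<^esub> ?t)"
    using cl by (intro F.prelie)
  have swap: "a \<oplus>\<^bsub>F\<^esub> d = c \<oplus>\<^bsub>F\<^esub> b"
    if "a \<ominus>\<^bsub>F\<^esub> b = c \<ominus>\<^bsub>F\<^esub> d" "a \<in> carrier F" "b \<in> carrier F" "c \<in> carrier F" "d \<in> carrier F" for a b c d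
  proof -
    have "a \<oplus>\<^bsub>F\<^esub> d = (a \<ominus>\<^bsub>F\<^esub> b) \<oplus>\<^bsub>F\<^esub> (b \<oplus>\<^bsub>F\<^esub> d)"
      using that(2-) by (simp add: a_minus_def F.a_assoc F.r_neg2 F.r_neg1)
    also have "\<dots> = (c \<ominus>\<^bsub>F\<^esub> d) \<oplus>\<^bsub>F\<^esub> (d \<oplus>\<^bsub>F\<^esub> b)"
      using that by (simp add: F.a_comm)
    also have "\<dots> = c \<oplus>\<^bsub>F\<^esub> b"
      using that(2-) by (simp add: a_minus_def F.a_assoc F.r_neg2 F.r_neg1)
    finally show ?thesis .
  qed
  have "(?p \<otimes>\<^bsub>F\<^esub> ?t \<otimes>\<^bsub>F\<^esub> ?q) \<oplus>\<^bsub>F\<^esub> ?p \<otimes>\<^bsub>F\<^esub> (?q \<otimes>\<^bsub>F\<^esub> ?t)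
      = (?p \<otimes>\<^bsub>F\<^esub> ?q \<otimes>\<^bsub>F\<^esub> ?t) \<oplus>\<^bsub>F\<^esub> ?p \<otimes>\<^bsub>F\<^esub> (?t \<otimes>\<^bsub>F\<^esub> ?q)"
    by (rule swap[OF pl]) (use cl in auto)
  then show ?thesis
    using pq deg by (simp add: \<Theta>_tensor K \<tau>(2) mult del: bilin_basis)
qed

text \<open>On a \<otimes> t the coproduct rule gives a \<otimes> t plus the sum of (p \<bullet> t)
  \<otimes> q + p \<otimes> (q \<bullet> t) over \<delta> a. By \<open>\<Theta>_exchange\<close>
  this sum has the same \<open>\<Theta>\<close> as that of (p \<bullet> q) \<otimes> t + p \<otimes>
  (t \<bullet> q), and these are the last two summands of \<open>euler2\<close>. \<open>L\<close>
  and \<open>R\<close> denote the two sums.\<close>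

lemma \<Theta>_\<delta>_\<mu>:
  assumes "z \<in> filt2 n"
  shows "\<Theta> (\<delta> (\<mu> z)) = \<Theta> (euler2 z)"
proof -
  define S where "S = {(s, t). s \<in> B \<and> t \<in> B \<and> deg s + deg t \<le> n}"
  have hom: "(\<lambda>z. \<Theta> (f z)) \<in> linear_hom (free_mod T) F"
    if f: "linmap f" and K: "\<And>z. Poly_Mapping.keys z \<subseteq> T \<Longrightarrow> Poly_Mapping.keys (f z) \<subseteq> B \<times> B"
    for f :: "('b \<times> 'b \<Rightarrow>\<^sub>0 'k) \<Rightarrow> 'b \<times> 'b \<Rightarrow>\<^sub>0 'k" and T
    by (rule linear_homI)
      (simp_all add: free_mod_def linmap_simps[OF f] free_mod_linear_homD[OF \<Theta>(1)] K)
  have filt2_keys: "Poly_Mapping.keys z \<subseteq> B \<times> B" if "z \<in> filt2 m" for z m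
    using that by (auto simp: filt2_def)
  show ?thesis
  proof (rule free_mod_linear_hom_eqI[of "\<lambda>z. \<Theta> (\<delta> (\<mu> z))" S F "\<lambda>z. \<Theta> (euler2 z)"])
    show "module base_field F" by (rule F.module_axioms)
    show "Poly_Mapping.keys z \<subseteq> S" using assms by (simp add: filt2_def S_def)
    show "(\<lambda>z. \<Theta> (\<delta> (\<mu> z))) \<in> linear_hom (free_mod S) F"
    proof (rule hom)
      show "linmap (\<lambda>z. \<delta> (\<mu> z))" by (intro linmap_intros)
    qed (rule filt2_keys[OF \<delta>_filt2[OF \<mu>_filt]], simp add: filt2_def S_def)
    show "(\<lambda>z. \<Theta> (euler2 z)) \<in> linear_hom (free_mod S) F"
    proof (rule hom)
      show "linmap euler2" unfolding euler2_def twist_def by (intro linmap_intros)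
    qed (rule filt2_keys[OF euler2_filt2], simp add: filt2_def S_def)
    fix w assume "w \<in> S"
    then obtain a t where w: "w = (a, t)" and at: "a \<in> B" "t \<in> B" "deg a + deg t \<le> n"
      by (auto simp: S_def)
    define L where "L y = linear_extend (\<lambda>(p, q). tensor (prd p t) (basis q) + tensor (basis p) (prd q t)) y" for y
    define R where "R y = linear_extend (\<lambda>(p, q). tensor (prd p q) (basis t) + tensor (basis p) (prd t q)) y" for y
    \<comment> \<open>Contains the support of \<open>cop a\<close>; for its pairs the total degree
      together with t is at most n, as \<open>\<Theta>_exchange\<close> demands.\<close>
    define U where "U = {(p, q). p \<in> B \<and> q \<in> B \<and> deg p + deg q = deg a}"
    have tk: "Poly_Mapping.keys (tensor x y) \<subseteq> B \<times> B"
      if "Poly_Mapping.keys x \<subseteq> B" "Poly_Mapping.keys y \<subseteq> B" for x y :: "'b \<Rightarrow>\<^sub>0 'k"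
      using bilin_mem[OF subsp_keys[of "B \<times> B"], of x y "\<lambda>a b. basis (a, b)"] that by auto
    have pk: "Poly_Mapping.keys (prd a b) \<subseteq> B" if "a \<in> B" "b \<in> B" for a b
      using keys_prd[OF that] by auto
    have sk: "Poly_Mapping.keys (x + y) \<subseteq> B \<times> B"
      if "Poly_Mapping.keys x \<subseteq> B \<times> B" "Poly_Mapping.keys y \<subseteq> B \<times> B" for x y :: "'b \<times> 'b \<Rightarrow>\<^sub>0 'k"
      using subspD(2)[OF subsp_keys[of "B \<times> B"], of x y] that by simp
    have LK: "Poly_Mapping.keys (L y) \<subseteq> B \<times> B" and RK: "Poly_Mapping.keys (R y) \<subseteq> B \<times> B"
      if "Poly_Mapping.keys y \<subseteq> U" for y
    proof -
      have pq: "p \<in> B \<and> q \<in> B" if "(p, q) \<in> Poly_Mapping.keys y" for p q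
        using that \<open>Poly_Mapping.keys y \<subseteq> U\<close> by (auto simp: U_def)
      have "linear_extend (\<lambda>(p, q). f p q) y \<in> {x. Poly_Mapping.keys x \<subseteq> B \<times> B}"
        if "\<And>p q. p \<in> B \<Longrightarrow> q \<in> B \<Longrightarrow> Poly_Mapping.keys (f p q) \<subseteq> B \<times> B"
        for f :: "'b \<Rightarrow> 'b \<Rightarrow> 'b \<times> 'b \<Rightarrow>\<^sub>0 'k"
      proof (rule linear_extend_mem[OF subsp_keys])
        fix v assume "v \<in> Poly_Mapping.keys y"
        then obtain p q where "v = (p, q)" "p \<in> B" "q \<in> B" using pq by (cases v) auto
        then show "(case v of (p, q) \<Rightarrow> f p q) \<in> {x. Poly_Mapping.keys x \<subseteq> B \<times> B}"
          using that by simp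
      qed
      then show "Poly_Mapping.keys (L y) \<subseteq> B \<times> B" "Poly_Mapping.keys (R y) \<subseteq> B \<times> B"
        unfolding L_def R_def using at by (simp_all add: sk tk pk del: bilin_basis)
    qed
    have ca: "Poly_Mapping.keys (cop a) \<subseteq> U" using keys_cop[OF at(1)] by (simp add: U_def)
    have LR: "\<Theta> (L (cop a)) = \<Theta> (R (cop a))"
    proof (rule free_mod_linear_hom_eqI[of "\<lambda>y. \<Theta> (L y)" U F "\<lambda>y. \<Theta> (R y)"])
      show "module base_field F" by (rule F.module_axioms)
      show "(\<lambda>y. \<Theta> (L y)) \<in> linear_hom (free_mod U) F"
        by (rule hom) (simp_all add: LK, simp add: L_def)
      show "(\<lambda>y. \<Theta> (R y)) \<in> linear_hom (free_mod U) F"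
        by (rule hom) (simp_all add: RK, simp add: R_def)
      fix v assume "v \<in> U"
      then obtain p q where v: "v = (p, q)" "p \<in> B" "q \<in> B" "deg p + deg q = deg a" by (auto simp: U_def)
      then show "\<Theta> (L (basis v)) = \<Theta> (R (basis v))"
        using \<Theta>_exchange[of p q t] at
        by (simp add: L_def R_def free_mod_linear_homD(2)[OF \<Theta>(1)] tk pk del: bilin_basis)
    qed (rule ca)
    have R: "R (cop a) = tensor (\<mu> (cop a)) (basis t) + twist prd (basis w)"
    proof -
      have "linear_extend (\<lambda>(p, q). tensor (prd p q) (basis t)) y = tensor (\<mu> y) (basis t)" for y
        by (rule linmap_eqI[of "linear_extend (\<lambda>(p, q). tensor (prd p q) (basis t))"
              "\<lambda>y. tensor (\<mu> y) (basis t)"]) (auto intro!: linmap_bilin_comp)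
      then show ?thesis
        by (simp add: R_def twist_def w linear_extend_add case_prod_unfold)
    qed
    have "\<delta> (\<mu> (basis w)) = basis w + L (cop a)"
      using at by (simp add: w cop_prd L_def linear_extend_add case_prod_unfold add.assoc)
    moreover have "euler2 (basis w) = basis w + R (cop a)"
      by (simp add: euler2_def R) (simp add: w)
    ultimately show "\<Theta> (\<delta> (\<mu> (basis w))) = \<Theta> (euler2 (basis w))"
      using LR LK[OF ca] RK[OF ca] at by (simp add: free_mod_linear_homD(2)[OF \<Theta>(1)] w)
  qed
qed

text \<open>Descent on the order: from \<delta> v = 0 follows \<delta> (\<mu> z) = 0, hence
  \<open>\<Theta> (euler2 z)\<close> vanishes and z may be corrected by any multiple of
  \<open>euler2 z\<close>. At order 0 all slices vanish, so z = 0 and then v = 0.\<close>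

lemma gen_\<Theta>_eq_zero:
  assumes "z \<in> ord2_le k" "z \<in> filt2 n" "v \<in> prim" "v + \<mu> z = 0"
  shows "free_gen V v \<oplus>\<^bsub>F\<^esub> \<Theta> z = \<zero>\<^bsub>F\<^esub>"
  using assms
proof (induction k arbitrary: z)
  case 0
  have "z = 0" by (rule slices_eq_0) (use 0 in \<open>simp add: ord2_le_def\<close>)
  then have "v = 0" using 0 by (simp add: linear_extend_simps)
  have "\<Theta> 0 = \<zero>\<^bsub>F\<^esub>"
    using free_mod_linear_homD(1)[OF \<Theta>(1), of 0] free_mod_linear_homD(3)[OF \<Theta>(1), of 0 0]
      F.smult_l_null[of "\<Theta> 0"] by simp
  then show ?case using \<open>z = 0\<close> \<open>v = 0\<close> by (simp add: free_gen_zero del: free_prelie_zero)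
next
  case (Suc k)
  let ?c = "of_nat (Suc k) :: 'k"
  have c: "?c \<noteq> 0" by (simp del: of_nat_Suc)
  \<comment> \<open>This is z - \<open>euler2 z\<close> / (k + 1), written so that
    \<open>euler2_ord2_le\<close> bounds the order of the bracket.\<close>
  define e where "e = scale (- inverse ?c) (euler2 z - scale ?c z)"
  have K: "Poly_Mapping.keys y \<subseteq> B \<times> B" if "y \<in> filt2 n" for y
    using that by (auto simp: filt2_def)
  have e: "e \<in> ord2_le k" "e \<in> filt2 n"
    unfolding e_def using Suc.prems euler2_ord2_le euler2_filt2
    by (auto intro!: subspD(3)[OF subsp_ord2_le] subspD(3)[OF subsp_filt2] subsp_minus[OF subsp_filt2]
        simp del: of_nat_Suc)
  have "\<delta> v = 0" using Suc.prems by (simp add: prim_def)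
  then have "\<delta> (\<mu> z) = 0"
    using arg_cong[OF Suc.prems(4), of \<delta>] by (simp add: linear_extend_simps)
  then have 0: "\<Theta> (euler2 z) = \<Theta> 0" using \<Theta>_\<delta>_\<mu>[OF Suc.prems(2)] by simp
  have "z = e + scale (inverse ?c) (euler2 z)"
    using c by (simp add: e_def scale_minus)
  then have "\<Theta> z = \<Theta> (e + scale (inverse ?c) (euler2 z))" by simp
  also have "\<dots> = \<Theta> e \<oplus>\<^bsub>F\<^esub> inverse ?c \<odot>\<^bsub>F\<^esub> \<Theta> (euler2 z)"
    using K[OF e(2)] K[OF euler2_filt2[OF Suc.prems(2)]] K[OF subspD(3)[OF subsp_filt2 euler2_filt2[OF Suc.prems(2)]]]
    by (simp add: free_mod_linear_homD[OF \<Theta>(1)] del: of_nat_Suc)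
  also have "\<dots> = \<Theta> e \<oplus>\<^bsub>F\<^esub> \<Theta> (scale (inverse ?c) 0)"
    unfolding 0 by (subst free_mod_linear_homD(3)[OF \<Theta>(1)]) simp_all
  also have "\<dots> = \<Theta> (e + 0)"
    using K[OF e(2)] by (subst free_mod_linear_homD(2)[OF \<Theta>(1)]) simp_all
  finally have \<Theta>z: "\<Theta> z = \<Theta> e" by simp
  \<comment> \<open>Applying \<open>\<phi>\<close> turns the equality of \<open>\<Theta>\<close>
    values into one of \<mu> values, so the relation v + \<mu> z = 0 passes to e.\<close>
  then have "\<mu> z = \<mu> e" using \<phi>_\<Theta>[OF Suc.prems(2)] \<phi>_\<Theta>[OF e(2)] by simp
  then show ?case using Suc.IH[OF e] Suc.prems \<Theta>z by simp
qed

text \<open>Sums and multiples of such expressions have the same form. In a product both factors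
  have weight below n, so by faithfulness each is \<open>\<tau>\<close> of its own image, and
  \<open>\<Theta>_tensor\<close> absorbs the product.\<close>

lemma wt_decomp:
  assumes "wt m u" "m \<le> n"
  shows "\<exists>v\<in>prim. \<exists>z\<in>filt2 n. u = free_gen V v \<oplus>\<^bsub>F\<^esub> \<Theta> z"
  using assms
proof (induction rule: wt.induct)
  have \<Theta>0: "\<Theta> 0 = \<zero>\<^bsub>F\<^esub>"
    using free_mod_linear_homD(1)[OF \<Theta>(1), of 0] free_mod_linear_homD(3)[OF \<Theta>(1), of 0 0]
      F.smult_l_null[of "\<Theta> 0"] by simp
  have K: "Poly_Mapping.keys y \<subseteq> B \<times> B" if "y \<in> filt2 n" for y
    using that by (auto simp: filt2_def)
  note p0 = subspD(1)[OF subsp_prim] and z0 = subspD(1)[OF subsp_filt2]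
  have gc: "free_gen V v \<in> carrier F" if "v \<in> prim" for v using that by (intro free_gen_closed) simp
  have \<Theta>c: "\<Theta> z \<in> carrier F" if "z \<in> filt2 n" for z
    using K[OF that] free_mod_linear_homD(1)[OF \<Theta>(1)] by simp
  {
    case (gen v m)
    then show ?case
      by (intro bexI[of _ v] bexI[of _ 0]) (simp_all add: \<Theta>0 gc z0 del: free_prelie_zero)
  next
    case (zero m)
    show ?case
      by (intro bexI[of _ 0] bexI[of _ 0])
        (simp_all add: \<Theta>0 free_gen_zero p0 z0 del: free_prelie_zero)
  next
    case (add m u y)
    then obtain v z w x where *: "v \<in> prim" "z \<in> filt2 n" "u = free_gen V v \<oplus>\<^bsub>F\<^esub> \<Theta> z"
      "w \<in> prim" "x \<in> filt2 n" "y = free_gen V w \<oplus>\<^bsub>F\<^esub> \<Theta> x" by blast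
    have "v + w \<in> prim" "z + x \<in> filt2 n"
      using * subspD(2)[OF subsp_prim] subspD(2)[OF subsp_filt2] by auto
    moreover have "u \<oplus>\<^bsub>F\<^esub> y = free_gen V (v + w) \<oplus>\<^bsub>F\<^esub> \<Theta> (z + x)"
      using * free_gen_add[of v V w] \<open>v + w \<in> prim\<close> gc \<Theta>c K
      by (simp add: free_mod_linear_homD(2)[OF \<Theta>(1)] F.a_assoc F.a_lcomm)
    ultimately show ?case by blast
  next
    case (scale m u c)
    then obtain v z where *: "v \<in> prim" "z \<in> filt2 n" "u = free_gen V v \<oplus>\<^bsub>F\<^esub> \<Theta> z" by blast
    have "scale c v \<in> prim" "scale c z \<in> filt2 n"
      using * subspD(3)[OF subsp_prim] subspD(3)[OF subsp_filt2] by auto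
    moreover have "c \<odot>\<^bsub>F\<^esub> u = free_gen V (scale c v) \<oplus>\<^bsub>F\<^esub> \<Theta> (scale c z)"
      using * free_gen_scale[of v V c] \<open>scale c v \<in> prim\<close> gc \<Theta>c K
      by (simp add: free_mod_linear_homD(3)[OF \<Theta>(1)] F.smult_r_distr)
    ultimately show ?case by blast
  next
    case (mult a u b y m)
    \<comment> \<open>The two weights are positive and add up to at most n.\<close>
    have lt: "a < n" "b < n" using mult by auto
    have u: "u = \<tau> (\<phi> u)" "y = \<tau> (\<phi> y)"
      using faithfulD[OF IH[OF lt(1)] mult(1) wt_\<tau>[OF wt_\<phi>[OF mult(1)]]]
        faithfulD[OF IH[OF lt(2)] mult(2) wt_\<tau>[OF wt_\<phi>[OF mult(2)]]]
        wt_closed[OF mult(1)] wt_closed[OF mult(2)] by (simp_all add: \<phi>_\<tau> \<phi>_simps)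
    have "tensor (\<phi> u) (\<phi> y) \<in> filt2 n"
      using mult wt_\<phi> by (intro tensor_filt2) auto
    moreover have "u \<otimes>\<^bsub>F\<^esub> y = free_gen V 0 \<oplus>\<^bsub>F\<^esub> \<Theta> (tensor (\<phi> u) (\<phi> y))"
      using u wt_closed[OF mult(1)] wt_closed[OF mult(2)]
      by (simp add: \<Theta>_tensor \<phi>_simps free_gen_zero del: free_prelie_zero)
    ultimately show ?case using p0 by blast
  next
    case (mono m u n')
    then show ?case by auto
  }
qed

lemma faithful_step: "faithful n"
  unfolding faithful_def
proof (intro allI impI)
  fix u assume u: "wt n u" "\<phi> u = 0"
  obtain v z where *: "v \<in> prim" "z \<in> filt2 n" "u = free_gen V v \<oplus>\<^bsub>F\<^esub> \<Theta> z"
    using wt_decomp[OF u(1) order_refl] by blast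
  have "Poly_Mapping.keys z \<subseteq> B \<times> B" using *(2) by (auto simp: filt2_def)
  then have "v + \<mu> z = 0"
    using u * \<phi>_\<Theta>[OF *(2)] free_gen_closed[of v V] free_mod_linear_homD(1)[OF \<Theta>(1)]
    by (simp add: \<phi>_simps \<phi>_gen)
  then show "u = \<zero>\<^bsub>F\<^esub>"
    using gen_\<Theta>_eq_zero[OF ord2_le_ex[OF *(2)] *(2,1)] * by simp
qed

end

lemma faithful: "faithful n"
proof (induction n rule: less_induct)
  case (less n)
  obtain \<tau> where \<tau>: "\<tau> \<in> linear_hom (free_mod B) F" "\<And>a. a \<in> B \<Longrightarrow> \<tau> (basis a) = lift a"
    using free_mod_linear_hom_ex[OF F.module_axioms, of B lift] lift_closed by blast
  have cl: "lift (fst w) \<otimes>\<^bsub>F\<^esub> lift (snd w) \<in> carrier F" if "w \<in> B \<times> B" for w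
    using that by (auto intro!: F.prod_closed lift_closed)
  obtain \<Theta> where \<Theta>: "\<Theta> \<in> linear_hom (free_mod (B \<times> B)) F"
      "\<And>w. w \<in> B \<times> B \<Longrightarrow> \<Theta> (basis w) = lift (fst w) \<otimes>\<^bsub>F\<^esub> lift (snd w)"
    using free_mod_linear_hom_ex[OF F.module_axioms, of "B \<times> B" "\<lambda>w. lift (fst w) \<otimes>\<^bsub>F\<^esub> lift (snd w)", OF cl]
    by blast
  show ?case by (rule faithful_step[OF \<tau> \<Theta> less.IH])
qed

lemma bij_betw_\<phi>: "bij_betw \<phi> (carrier F) (carrier alg)"
proof (rule bij_betw_imageI)
  show "inj_on \<phi> (carrier F)"
  proof (rule inj_onI)
    fix u y assume "u \<in> carrier F" "y \<in> carrier F" "\<phi> u = \<phi> y"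
    moreover from this obtain m n where "wt m u" "wt n y" using wt_ex by blast
    ultimately show "u = y"
      using faithfulD[OF faithful, of "m + n" u y] wt.mono[of m u "m + n"] wt.mono[of n y "m + n"] by simp
  qed
  show "\<phi> ` carrier F = carrier alg"
  proof (intro equalityI subsetI)
    fix x assume "x \<in> carrier alg"
    then have "x \<in> filt (Max (insert 0 (deg ` Poly_Mapping.keys x)))" by (auto simp: filt_def)
    then show "x \<in> \<phi> ` carrier F" using wt_surj wt_closed by blast
  qed (use \<phi>_simps(1) in auto)
qed

end

theorem (in prelie_coalgebra) freely_generated_by_prim: "freely_generated_by alg prim"
proof -
  interpret A: prelie_algebra alg by (rule prelie_algebra_alg)
  have "(\<lambda>v. v) \<in> linear_hom V alg"
    by (rule linear_homI) (auto simp: prim_def)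
  from A.free_prelie_universal[OF this] obtain \<phi> where \<phi>: "\<phi> \<in> prelie_hom F alg"
    "\<forall>v\<in>prim. \<phi> (free_gen V v) = v" by auto
  interpret prelie_coalgebra_hom B deg prd cop \<phi>
    by unfold_locales (use \<phi> in auto)
  show ?thesis unfolding freely_generated_by_def
    using prelie_algebra_alg submodule_prim \<phi> bij_betw_\<phi> by blast
qed

section \<open>Partitioned trees\<close>

text \<open>The number of strict ancestors is such a rank: along an edge it grows because u is an
  ancestor of v but, by acyclicity, not of itself. Ranks can be shifted and transported, which makes
  acyclicity of grafts and of isomorphic copies easy.\<close>

lemma finite_acyclic_rank:
  assumes "finite V" "E \<subseteq> V \<times> V" "acyclic E"
  obtains r :: "'a \<Rightarrow> nat" where "\<And>u v. (u, v) \<in> E \<Longrightarrow> r u < r v"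
proof
  fix u v assume uv: "(u, v) \<in> E"
  have "finite (E\<^sup>+)" using finite_subset[OF assms(2)] assms(1) by simp
  then have fin: "finite {w. (w, v) \<in> E\<^sup>+}"
    by (rule finite_subset[rotated, OF finite_imageI[of _ fst]]) force
  have "{w. (w, u) \<in> E\<^sup>+} \<subset> {w. (w, v) \<in> E\<^sup>+}"
    using uv assms(3) by (auto simp: acyclic_def intro: trancl_into_trancl)
  then show "card {w. (w, u) \<in> E\<^sup>+} < card {w. (w, v) \<in> E\<^sup>+}"
    by (rule psubset_card_mono[OF fin])
qed

lemma acyclic_if_rank:
  fixes r :: "'a \<Rightarrow> nat"
  assumes "\<And>u v. (u, v) \<in> E \<Longrightarrow> r u < r v"
  shows "acyclic E"
proof -
  have "r u < r v" if "(u, v) \<in> E\<^sup>+" for u v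
    using that by (induction rule: trancl_induct) (auto dest: assms)
  then show ?thesis by (auto simp: acyclic_def)
qed

lemma rooted_forest_rank:
  assumes "rooted_forest F"
  obtains r :: "'a \<Rightarrow> nat" where "\<And>u v. (u, v) \<in> edges F \<Longrightarrow> r u < r v"
proof -
  have "finite (verts F)" "edges F \<subseteq> verts F \<times> verts F" "acyclic (edges F)"
    using assms by (auto simp: rooted_forest_def)
  from finite_acyclic_rank[OF this] obtain r :: "'a \<Rightarrow> nat"
    where "\<And>u v. (u, v) \<in> edges F \<Longrightarrow> r u < r v" by blast
  then show ?thesis by (rule that)
qed

lemma rooted_forestD:
  assumes "rooted_forest F"
  shows "finite (verts F)" "(u, v) \<in> edges F \<Longrightarrow> u \<in> verts F \<and> v \<in> verts F" "acyclic (edges F)"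
    "(u, v) \<in> edges F \<Longrightarrow> (u', v) \<in> edges F \<Longrightarrow> u = u'"
  using assms by (auto simp: rooted_forest_def)

lemma partitioned_forestD:
  assumes "partitioned_forest F"
  shows "rooted_forest F" "b \<in> blocks F \<Longrightarrow> b \<subseteq> verts F" "b \<in> blocks F \<Longrightarrow> b \<noteq> {}"
    "b \<in> blocks F \<Longrightarrow> c \<in> blocks F \<Longrightarrow> v \<in> b \<Longrightarrow> v \<in> c \<Longrightarrow> b = c"
    "v \<in> verts F \<Longrightarrow> \<exists>b\<in>blocks F. v \<in> b"
    "b \<in> blocks F \<Longrightarrow> u \<in> b \<Longrightarrow> v \<in> b \<Longrightarrow> (p, u) \<in> edges F \<Longrightarrow> (p, v) \<in> edges F"
proof -
  show "rooted_forest F" "b \<in> blocks F \<Longrightarrow> b \<subseteq> verts F" "b \<in> blocks F \<Longrightarrow> b \<noteq> {}"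
    "v \<in> verts F \<Longrightarrow> \<exists>b\<in>blocks F. v \<in> b"
    using assms by (auto simp: partitioned_forest_def partition_on_def)
  show "b \<in> blocks F \<Longrightarrow> c \<in> blocks F \<Longrightarrow> v \<in> b \<Longrightarrow> v \<in> c \<Longrightarrow> b = c"
    using assms unfolding partitioned_forest_def partition_on_def disjoint_def by blast
  assume *: "b \<in> blocks F" "u \<in> b" "v \<in> b" "(p, u) \<in> edges F"
  then have "u \<notin> roots F" by (auto simp: roots_def)
  with * obtain q where "(q, u) \<in> edges F" "(q, v) \<in> edges F"
    using assms unfolding partitioned_forest_def by blast
  then show "(p, v) \<in> edges F"
    using * rooted_forestD(4)[OF \<open>rooted_forest F\<close>] by blast
qed

text \<open>The last premise replaces the alternative between roots and siblings: a parent of one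
  vertex of a block is a parent of all its vertices, so if one of them has no parent then none
  has.\<close>

lemma partitioned_forestI:
  assumes "rooted_forest F" "\<And>b. b \<in> blocks F \<Longrightarrow> b \<subseteq> verts F" "\<And>b. b \<in> blocks F \<Longrightarrow> b \<noteq> {}"
    "\<And>b c v. b \<in> blocks F \<Longrightarrow> c \<in> blocks F \<Longrightarrow> v \<in> b \<Longrightarrow> v \<in> c \<Longrightarrow> b = c"
    "\<And>v. v \<in> verts F \<Longrightarrow> \<exists>b\<in>blocks F. v \<in> b"
    "\<And>b u v p. b \<in> blocks F \<Longrightarrow> u \<in> b \<Longrightarrow> v \<in> b \<Longrightarrow> (p, u) \<in> edges F \<Longrightarrow> (p, v) \<in> edges F"
  shows "partitioned_forest F"
proof -
  have "partition_on (verts F) (blocks F)"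
  proof (rule partition_onI)
    show "\<Union>(blocks F) = verts F" using assms(2,5) by blast
    show "disjnt b c" if "b \<in> blocks F" "c \<in> blocks F" "b \<noteq> c" for b c
      using that assms(4) unfolding disjnt_def by blast
  qed (use assms(3) in auto)
  moreover have "(u \<in> roots F \<and> v \<in> roots F) \<or> (\<exists>p. (p, u) \<in> edges F \<and> (p, v) \<in> edges F)"
    if "b \<in> blocks F" "u \<in> b" "v \<in> b" for b u v
    using that assms(2,6) unfolding roots_def by blast
  ultimately show ?thesis using assms(1) by (simp add: partitioned_forest_def)
qed

text \<open>Representatives of the basis elements: nonempty, and over any vertex type, so that
  grafts with vertices in a sum type are included.\<close>

definition ptree :: "'d set \<Rightarrow> ('v, 'd) pforest \<Rightarrow> bool" where
  "ptree D F \<longleftrightarrow> partitioned_tree F \<and> verts F \<noteq> {} \<and> deco F ` verts F \<subseteq> D"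

lemma root_reaches:
  assumes "rooted_forest F" "v \<in> verts F"
  shows "\<exists>r\<in>roots F. (r, v) \<in> (edges F)\<^sup>*"
proof -
  obtain r :: "_ \<Rightarrow> nat" where r: "\<And>u v. (u, v) \<in> edges F \<Longrightarrow> r u < r v"
    using rooted_forest_rank[OF assms(1)] by blast
  show ?thesis using assms(2)
  proof (induction v rule: measure_induct_rule[of r])
    case (less v)
    show ?case
    proof (cases "v \<in> roots F")
      case False
      then obtain u where "(u, v) \<in> edges F" using less.prems by (auto simp: roots_def)
      then show ?thesis using less.IH[of u] r rooted_forestD(2)[OF assms(1)]
        by (meson rtrancl_into_rtrancl)
    qed blast
  qed
qed

text \<open>A block containing a root contains only roots, because blocks share parents; being a
  tree puts all roots into that block. The roots therefore form exactly one block.\<close>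

lemma ptree_roots:
  assumes "ptree D F"
  shows "roots F \<in> blocks F" "roots F \<noteq> {}"
proof -
  have F: "partitioned_forest F" and V: "verts F \<noteq> {}"
    and one: "\<And>u v. u \<in> roots F \<Longrightarrow> v \<in> roots F \<Longrightarrow> \<exists>b\<in>blocks F. u \<in> b \<and> v \<in> b"
    using assms by (auto simp: ptree_def partitioned_tree_def)
  show "roots F \<noteq> {}" using root_reaches[OF partitioned_forestD(1)[OF F]] V by blast
  then obtain u where u: "u \<in> roots F" by blast
  then obtain b where b: "b \<in> blocks F" "u \<in> b" using one by blast
  have "v \<in> b" if "v \<in> roots F" for v
    using one[OF u that] b partitioned_forestD(4)[OF F] by blast
  moreover have "v \<in> roots F" if "v \<in> b" for v
    using partitioned_forestD(6)[OF F b(1) that b(2)] partitioned_forestD(2)[OF F b(1)] u that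
    unfolding roots_def by blast
  ultimately have "b = roots F" by blast
  then show "roots F \<in> blocks F" using b by simp
qed

lemma ptreeI:
  "partitioned_forest F \<Longrightarrow> roots F \<in> blocks F \<Longrightarrow> verts F \<noteq> {} \<Longrightarrow> deco F ` verts F \<subseteq> D \<Longrightarrow> ptree D F"
  unfolding ptree_def partitioned_tree_def by blast

lemma ptreeD:
  assumes "ptree D F"
  shows "partitioned_forest F" "rooted_forest F" "finite (verts F)" "verts F \<noteq> {}" "deco F ` verts F \<subseteq> D"
  using assms partitioned_forestD(1) rooted_forestD(1) by (auto simp: ptree_def partitioned_tree_def)

subsection \<open>Isomorphism classes\<close>

lemma ptree_iso:
  assumes F: "ptree D F" and iso: "F \<cong>\<^sub>p G"
  shows "ptree D G" "card (verts G) = card (verts F)" "card (roots G) = card (roots F)"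
proof -
  obtain f where f: "bij_betw f (verts F) (verts G)" "edges G = map_prod f f ` edges F"
    "blocks G = (`) f ` blocks F" "\<forall>v\<in>verts F. deco G (f v) = deco F v"
    using iso by (rule pforest_isoE)
  have inj: "inj_on f (verts F)" and im: "verts G = f ` verts F"
    using f(1) by (auto simp: bij_betw_def)
  note pf = ptreeD(1)[OF F] and rf = ptreeD(2)[OF F]
  have E: "edges F \<subseteq> verts F \<times> verts F" using rf by (simp add: rooted_forest_def)
  have roots: "roots G = f ` roots F" by (rule roots_image[OF inj im f(2) E])
  have injD: "f u = f v \<Longrightarrow> u \<in> verts F \<Longrightarrow> v \<in> verts F \<Longrightarrow> u = v" for u v
    using inj by (auto dest: inj_onD)
  show "card (verts G) = card (verts F)" by (simp add: im card_image[OF inj])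
  show "card (roots G) = card (roots F)"
    unfolding roots by (rule card_image[OF inj_on_subset[OF inj]]) (auto simp: roots_def)
  obtain r :: "_ \<Rightarrow> nat" where r: "\<And>u v. (u, v) \<in> edges F \<Longrightarrow> r u < r v"
    using rooted_forest_rank[OF rf] by blast
  have EG: "\<exists>x y. (x, y) \<in> edges F \<and> p = f x \<and> q = f y" if "(p, q) \<in> edges G" for p q
    using that unfolding f(2) by (auto simp: map_prod_def)
  have EV: "x \<in> verts F" "y \<in> verts F" if "(x, y) \<in> edges F" for x y
    using rooted_forestD(2)[OF rf that] by auto
  have BV: "x \<in> verts F" if "x \<in> b" "b \<in> blocks F" for x b
    using partitioned_forestD(2)[OF pf that(2)] that(1) by (rule subsetD)
  have acyc: "acyclic (edges G)"
  proof (rule acyclic_if_rank[of _ "r \<circ> inv_into (verts F) f"])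
    fix p q assume "(p, q) \<in> edges G"
    from EG[OF this] obtain x y where "(x, y) \<in> edges F" "p = f x" "q = f y" by blast
    then show "(r \<circ> inv_into (verts F) f) p < (r \<circ> inv_into (verts F) f) q"
      using r EV inv_into_f_f[OF inj] by simp
  qed
  have uniq: "u = u'" if uv: "(u, v) \<in> edges G" "(u', v) \<in> edges G" for u u' v
  proof -
    obtain x y x' y' where *: "(x, y) \<in> edges F" "u = f x" "v = f y" "(x', y') \<in> edges F" "u' = f x'" "v = f y'"
      using EG[OF uv(1)] EG[OF uv(2)] by blast
    then have "y' = y" by (intro injD EV) auto
    then show ?thesis using * rooted_forestD(4)[OF rf] by blast
  qed
  have "edges G \<subseteq> verts G \<times> verts G"
  proof
    fix e assume "e \<in> edges G"
    moreover obtain p q where e: "e = (p, q)" by (cases e)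
    ultimately obtain x y where "(x, y) \<in> edges F" "p = f x" "q = f y" using EG by blast
    then show "e \<in> verts G \<times> verts G" using EV by (simp add: e im)
  qed
  then have rfG: "rooted_forest G"
    using acyc uniq rooted_forestD(1)[OF rf] unfolding rooted_forest_def by (auto simp: im)
  have "partitioned_forest G"
  proof (rule partitioned_forestI[OF rfG])
    fix b assume "b \<in> blocks G"
    then obtain b' where "b' \<in> blocks F" "b = f ` b'" unfolding f(3) by (rule imageE)
    then show "b \<subseteq> verts G" "b \<noteq> {}"
      using partitioned_forestD(2,3)[OF pf, of b'] by (simp_all add: im image_mono)
  next
    fix b c v assume bc: "b \<in> blocks G" "c \<in> blocks G" "v \<in> b" "v \<in> c"
    obtain b' where b': "b' \<in> blocks F" "b = f ` b'" using bc(1) unfolding f(3) by (rule imageE)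
    obtain c' where c': "c' \<in> blocks F" "c = f ` c'" using bc(2) unfolding f(3) by (rule imageE)
    obtain x where x: "v = f x" "x \<in> b'" using bc(3) unfolding b'(2) by (rule imageE)
    obtain y where y: "v = f y" "y \<in> c'" using bc(4) unfolding c'(2) by (rule imageE)
    have "x = y" using x y by (intro injD BV[OF x(2) b'(1)] BV[OF y(2) c'(1)]) simp
    then have "b' = c'" using partitioned_forestD(4)[OF pf b'(1) c'(1)] x y by blast
    then show "b = c" using b' c' by simp
  next
    fix v assume "v \<in> verts G"
    then obtain x where x: "v = f x" "x \<in> verts F" unfolding im by (rule imageE)
    then obtain b where "b \<in> blocks F" "x \<in> b" using partitioned_forestD(5)[OF pf] by blast
    then show "\<exists>b\<in>blocks G. v \<in> b" using x unfolding f(3) by blast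
  next
    fix b u v p assume bc: "b \<in> blocks G" "u \<in> b" "v \<in> b" "(p, u) \<in> edges G"
    obtain b' where b': "b' \<in> blocks F" "b = f ` b'" using bc(1) unfolding f(3) by (rule imageE)
    obtain x where x: "u = f x" "x \<in> b'" using bc(2) unfolding b'(2) by (rule imageE)
    obtain y where y: "v = f y" "y \<in> b'" using bc(3) unfolding b'(2) by (rule imageE)
    obtain p' x' where px: "(p', x') \<in> edges F" "p = f p'" "u = f x'" using EG[OF bc(4)] by blast
    have "x' = x" using px(3) x(1) by (intro injD EV(2)[OF px(1)] BV[OF x(2) b'(1)]) simp
    then have "(p', y) \<in> edges F" using px partitioned_forestD(6)[OF pf b'(1) x(2) y(2)] by blast
    then show "(p, v) \<in> edges G" using px y unfolding f(2) by force
  qed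
  moreover have "roots G \<in> blocks G" using ptree_roots(1)[OF F] by (simp add: roots f(3))
  moreover have "verts G \<noteq> {}" using ptreeD(4)[OF F] by (simp add: im)
  moreover have "deco G ` verts G \<subseteq> D"
    using ptreeD(5)[OF F] f(4) by (auto simp: im)
  ultimately show "ptree D G" by (rule ptreeI)
qed

lemma ptree_iso_class_eqI: "ptree D F \<Longrightarrow> F \<cong>\<^sub>p G \<Longrightarrow> iso_class F = iso_class G"
  by (erule iso_class_eqI[OF _ partitioned_forest_subsets(2,3)[OF ptreeD(1)]])

lemma ptree_rep:
  assumes "ptree D F"
  shows "ptree D (rep (iso_class F))" "card (verts (rep (iso_class F))) = card (verts F)"
    "card (roots (rep (iso_class F))) = card (roots F)" "iso_class (rep (iso_class F)) = iso_class F"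
  using ptree_iso[OF assms rep_iso[OF ptreeD(3)[OF assms]]]
    ptree_iso_class_eqI[OF assms rep_iso[OF ptreeD(3)[OF assms]]] by simp_all

lemma iso_class_eq_empty_iff:
  assumes "partitioned_tree F"
  shows "iso_class F = empty_class \<longleftrightarrow> verts F = {}"
proof
  let ?E = "\<lparr>verts = {} :: nat set, edges = {}, blocks = {}, deco = undefined\<rparr>"
  have pf: "partitioned_forest F" using assms by (simp add: partitioned_tree_def)
  {
    assume "iso_class F = empty_class"
    then have "F \<cong>\<^sub>p rep empty_class" "?E \<cong>\<^sub>p rep empty_class"
      using rep_iso[of F] rep_iso[of ?E] partitioned_forest_subsets(1)[OF pf] by (auto simp: empty_class_def)
    then show "verts F = {}" by (auto simp: pforest_iso_def bij_betw_def)
  next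
    assume "verts F = {}"
    then have "F \<cong>\<^sub>p ?E"
      using partitioned_forest_subsets[OF pf] partitioned_forestD(2,3)[OF pf]
      by (auto simp: pforest_iso_def bij_betw_def)
    then show "iso_class F = empty_class"
      unfolding empty_class_def by (rule iso_class_eqI[OF _ partitioned_forest_subsets(2,3)[OF pf]])
  }
qed

lemma iso_class_mem: "ptree D F \<Longrightarrow> iso_class F \<in> PT D - {empty_class}"
proof -
  assume F: "ptree D F"
  let ?G = "rep (iso_class F)"
  have G: "ptree D ?G" "iso_class ?G = iso_class F" using ptree_rep[OF F] by auto
  then have "iso_class ?G \<in> PT D" unfolding PT_def ptree_def by blast
  moreover have "iso_class ?G \<noteq> empty_class"
    using G(1) iso_class_eq_empty_iff[of ?G] by (auto simp: ptree_def)
  ultimately show ?thesis using G(2) by simp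
qed

lemma PT_nonempty_cases:
  assumes "C \<in> PT D - {empty_class}"
  obtains F :: "(nat, 'd) pforest" where "ptree D F" "C = iso_class F"
proof -
  obtain F :: "(nat, 'd) pforest" where F: "partitioned_tree F" "deco F ` verts F \<subseteq> D" "C = iso_class F"
    using assms unfolding PT_def by blast
  then have "ptree D F" using assms iso_class_eq_empty_iff[OF F(1)] by (simp add: ptree_def)
  then show ?thesis using F(3) by (rule that)
qed

subsection \<open>Grafting\<close>

lemma graft_simps [simp]:
  "Inl u \<in> verts (graft F s G) \<longleftrightarrow> u \<in> verts F" "Inr w \<in> verts (graft F s G) \<longleftrightarrow> w \<in> verts G"
  "(Inl u, Inl v) \<in> edges (graft F s G) \<longleftrightarrow> (u, v) \<in> edges F"
  "(Inr w, Inr x) \<in> edges (graft F s G) \<longleftrightarrow> (w, x) \<in> edges G"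
  "(Inl u, Inr w) \<in> edges (graft F s G) \<longleftrightarrow> u = s \<and> w \<in> roots G"
  "(Inr w, Inl u) \<notin> edges (graft F s G)"
  by (auto simp: graft_def)

text \<open>Every root of G acquires the parent s. The number of roots is thus unaffected by
  grafting, so the same normalising constant serves for F and for all its grafts.\<close>

lemma roots_graft:
  fixes F :: "('a, 'd) pforest" and G :: "('b, 'd) pforest"
  assumes "s \<in> verts F"
  shows "roots (graft F s G) = Inl ` roots F"
proof (intro equalityI subsetI)
  fix x assume x: "x \<in> roots (graft F s G)"
  show "x \<in> Inl ` roots F"
  proof (cases x)
    case (Inl u)
    then have "u \<in> verts F" "\<nexists>v. (v, u) \<in> edges F"
      using x graft_simps(3)[of _ u F s G] unfolding roots_def by auto
    then show ?thesis using Inl by (simp add: roots_def)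
  next
    case (Inr w)
    then have w: "w \<in> verts G" "\<nexists>v. (v, Inr w) \<in> edges (graft F s G)" using x by (auto simp: roots_def)
    then have "w \<in> roots G" using graft_simps(4)[of _ w F s G] unfolding roots_def by blast
    then show ?thesis using w graft_simps(5)[of s w F s G] by blast
  qed
next
  fix x :: "'a + 'b" assume "x \<in> Inl ` roots F"
  then obtain u where u: "x = Inl u" "u \<in> roots F" by blast
  have "(y, Inl u) \<notin> edges (graft F s G)" for y
    using u(2) by (cases y) (auto simp: roots_def)
  then show "x \<in> roots (graft F s G)" using u by (simp add: roots_def)
qed

lemma ptree_graft:
  assumes F: "ptree W F" and G: "ptree W G" and s: "s \<in> verts F"
  shows "ptree W (graft F s G)"
proof -
  let ?H = "graft F s G"
  note rF = ptreeD(2)[OF F] and rG = ptreeD(2)[OF G] and pF = ptreeD(1)[OF F] and pG = ptreeD(1)[OF G]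
  obtain f :: "_ \<Rightarrow> nat" where f: "\<And>u v. (u, v) \<in> edges F \<Longrightarrow> f u < f v"
    using rooted_forest_rank[OF rF] by blast
  obtain g :: "_ \<Rightarrow> nat" where g: "\<And>u v. (u, v) \<in> edges G \<Longrightarrow> g u < g v"
    using rooted_forest_rank[OF rG] by blast
  have acyc: "acyclic (edges ?H)"
  \<comment> \<open>The rank on G is shifted above that of s, so that it also increases along the
    new edges.\<close>
  proof (rule acyclic_if_rank[of _ "case_sum f (\<lambda>w. f s + 1 + g w)"])
    fix x y assume "(x, y) \<in> edges ?H"
    then show "case_sum f (\<lambda>w. f s + 1 + g w) x < case_sum f (\<lambda>w. f s + 1 + g w) y"
      by (cases x; cases y) (auto dest: f g)
  qed
  have V: "verts ?H = Inl ` verts F \<union> Inr ` verts G" by (simp add: graft_def)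
  have Vs: "edges ?H \<subseteq> verts ?H \<times> verts ?H"
  proof
    fix e assume "e \<in> edges ?H"
    moreover obtain x y where "e = (x, y)" by (cases e)
    ultimately show "e \<in> verts ?H \<times> verts ?H"
      using rooted_forestD(2)[OF rF] rooted_forestD(2)[OF rG] s
      by (cases x; cases y) (auto simp: roots_def)
  qed
  have uniq: "x = y" if "(x, z) \<in> edges ?H" "(y, z) \<in> edges ?H" for x y z
    using that rooted_forestD(4)[OF rF] rooted_forestD(4)[OF rG]
    by (cases x; cases y; cases z) (auto simp: roots_def)
  have rH: "rooted_forest ?H"
    using acyc Vs uniq ptreeD(3)[OF F] ptreeD(3)[OF G] unfolding rooted_forest_def V by blast
  have Bl: "b \<in> blocks ?H \<longleftrightarrow> (\<exists>c\<in>blocks F. b = Inl ` c) \<or> (\<exists>c\<in>blocks G. b = Inr ` c)" for b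
    by (auto simp: graft_def)
  have "partitioned_forest ?H"
  proof (rule partitioned_forestI[OF rH])
    fix b assume "b \<in> blocks ?H"
    then show "b \<subseteq> verts ?H" "b \<noteq> {}"
      using partitioned_forestD(2,3)[OF pF] partitioned_forestD(2,3)[OF pG] unfolding Bl V
      by (fast, fast)
  next
    fix b c v assume bc: "b \<in> blocks ?H" "c \<in> blocks ?H" "v \<in> b" "v \<in> c"
    show "b = c"
      using bc(1)[unfolded Bl] bc(2)[unfolded Bl]
    proof (elim disjE bexE)
      fix b' c' assume "b' \<in> blocks F" "b = Inl ` b'" "c' \<in> blocks F" "c = Inl ` c'"
      then show "b = c" using bc(3,4) partitioned_forestD(4)[OF pF, of b' c'] by auto
    next
      fix b' c' assume "b' \<in> blocks G" "b = Inr ` b'" "c' \<in> blocks G" "c = Inr ` c'"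
      then show "b = c" using bc(3,4) partitioned_forestD(4)[OF pG, of b' c'] by auto
    qed (use bc in auto)
  next
    fix v assume v: "v \<in> verts ?H"
    show "\<exists>b\<in>blocks ?H. v \<in> b"
    proof (cases v)
      case (Inl u)
      then obtain b where "b \<in> blocks F" "u \<in> b" using v partitioned_forestD(5)[OF pF, of u] by auto
      then show ?thesis using Inl by (intro bexI[of _ "Inl ` b"]) (auto simp: Bl)
    next
      case (Inr u)
      then obtain b where "b \<in> blocks G" "u \<in> b" using v partitioned_forestD(5)[OF pG, of u] by auto
      then show ?thesis using Inr by (intro bexI[of _ "Inr ` b"]) (auto simp: Bl)
    qed
  next
    fix b u v p assume b: "b \<in> blocks ?H" "u \<in> b" "v \<in> b" "(p, u) \<in> edges ?H"
    show "(p, v) \<in> edges ?H"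
      using b(1)[unfolded Bl]
    proof (elim disjE bexE)
      fix c assume c: "c \<in> blocks F" "b = Inl ` c"
      then obtain u' v' where uv: "u = Inl u'" "v = Inl v'" "u' \<in> c" "v' \<in> c" using b by blast
      then obtain p' where "p = Inl p'" using b(4) by (cases p) auto
      then show ?thesis using b(4) partitioned_forestD(6)[OF pF c(1) uv(3,4)] uv by simp
    next
      fix c assume c: "c \<in> blocks G" "b = Inr ` c"
      then obtain u' v' where uv: "u = Inr u'" "v = Inr v'" "u' \<in> c" "v' \<in> c" using b by blast
      show ?thesis
      proof (cases p)
        case (Inr p')
        then show ?thesis using b(4) partitioned_forestD(6)[OF pG c(1) uv(3,4)] uv by simp
      next
        case (Inl p')
        then have "p' = s" "u' \<in> roots G" using b(4) uv by auto
        \<comment> \<open>A block of G with one root in it is the whole root block, and all of that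
          block has been attached to s.\<close>
        moreover have "c = roots G"
          by (rule partitioned_forestD(4)[OF pG c(1) ptree_roots(1)[OF G] uv(3) \<open>u' \<in> roots G\<close>])
        ultimately show ?thesis using Inl uv by simp
      qed
    qed
  qed
  moreover have "roots ?H \<in> blocks ?H"
    using ptree_roots(1)[OF F] by (auto simp: roots_graft[OF s] Bl)
  moreover have "verts ?H \<noteq> {}" using s by (auto simp: V)
  moreover have "deco ?H ` verts ?H \<subseteq> W"
    using ptreeD(5)[OF F] ptreeD(5)[OF G] by (auto simp: graft_def)
  ultimately show ?thesis by (rule ptreeI)
qed

lemma card_verts_graft:
  assumes "finite (verts F)" "finite (verts G)"
  shows "card (verts (graft F s G)) = card (verts F) + card (verts G)"
  using card_Plus[OF assms] by (simp add: graft_def Plus_def)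

text \<open>Uses a bijection between the vertex types themselves. This suits repeated grafts, where
  the isomorphism just rearranges a nested sum type.\<close>

lemma pforest_iso_bijI:
  assumes f: "inj f" "surj f" and V: "\<And>x. f x \<in> verts G \<longleftrightarrow> x \<in> verts F"
    and E: "\<And>x y. (f x, f y) \<in> edges G \<longleftrightarrow> (x, y) \<in> edges F"
    and B: "blocks G = (`) f ` blocks F" and d: "\<And>v. deco G (f v) = deco F v"
  shows "F \<cong>\<^sub>p G"
  unfolding pforest_iso_def
proof (intro exI[of _ f] conjI)
  have "verts G = f ` verts F"
  proof (intro equalityI subsetI)
    fix x assume "x \<in> verts G"
    moreover obtain y where "x = f y" using surjD[OF f(2)] by blast
    ultimately show "x \<in> f ` verts F" using V by simp
  qed (use V in auto)
  then show "bij_betw f (verts F) (verts G)"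
    using inj_on_subset[OF f(1)] by (simp add: bij_betw_def)
  show "edges G = map_prod f f ` edges F"
  proof (intro equalityI subrelI)
    fix u v assume uv: "(u, v) \<in> edges G"
    obtain x y where xy: "u = f x" "v = f y" using surjD[OF f(2), of u] surjD[OF f(2), of v] by blast
    then have "(x, y) \<in> edges F" using uv E by simp
    then show "(u, v) \<in> map_prod f f ` edges F" unfolding xy by (rule map_prod_imageI)
  next
    fix u v assume "(u, v) \<in> map_prod f f ` edges F"
    then show "(u, v) \<in> edges G" using E by auto
  qed
qed (simp_all add: B d)

text \<open>Two graftings at vertices of F do not interfere. This is the symmetry behind the preLie
  identity.\<close>

lemma graft_graft_swap:
  fixes F :: "('a, 'd) pforest" and G :: "('b, 'd) pforest" and H :: "('c, 'd) pforest"
  assumes "s \<in> verts F" "s' \<in> verts F"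
  shows "graft (graft F s G) (Inl s') H \<cong>\<^sub>p graft (graft F s' H) (Inl s) G"
proof -
  define f :: "('a + 'b) + 'c \<Rightarrow> ('a + 'c) + 'b"
    where "f = case_sum (case_sum (\<lambda>x. Inl (Inl x)) Inr) (\<lambda>z. Inl (Inr z))"
  define g :: "('a + 'c) + 'b \<Rightarrow> ('a + 'b) + 'c"
    where "g = case_sum (case_sum (\<lambda>x. Inl (Inl x)) Inr) (\<lambda>z. Inl (Inr z))"
  have f: "f (Inl (Inl x)) = Inl (Inl x)" "f (Inl (Inr y)) = Inr y" "f (Inr z) = Inl (Inr z)" for x y z
    by (auto simp: f_def)
  have gf: "g (f x) = x" for x by (auto simp: f_def g_def split: sum.split)
  have fg: "f (g x) = x" for x by (auto simp: f_def g_def split: sum.split)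
  show ?thesis
  proof (rule pforest_iso_bijI[of f])
    show "inj f" using gf by (metis injI)
    show "surj f" using fg by (metis surjI)
    show "f x \<in> verts (graft (graft F s' H) (Inl s) G) \<longleftrightarrow> x \<in> verts (graft (graft F s G) (Inl s') H)" for x
      by (auto simp: f_def split: sum.split)
    show "(f x, f y) \<in> edges (graft (graft F s' H) (Inl s) G)
      \<longleftrightarrow> (x, y) \<in> edges (graft (graft F s G) (Inl s') H)" for x y
      by (auto simp: f_def split: sum.split)
    show "blocks (graft (graft F s' H) (Inl s) G) = (`) f ` blocks (graft (graft F s G) (Inl s') H)"
      by (simp add: graft_def image_Un image_image f Un_ac)
    show "deco (graft (graft F s' H) (Inl s) G) (f v) = deco (graft (graft F s G) (Inl s') H) v" for v
      by (auto simp: graft_def f_def split: sum.split)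
  qed
qed

text \<open>The roots of \<open>graft G t H\<close> are those of G, so s receives the same new
  children on both sides.\<close>

lemma graft_assoc:
  fixes F :: "('a, 'd) pforest" and G :: "('b, 'd) pforest" and H :: "('c, 'd) pforest"
  assumes "t \<in> verts G"
  shows "graft (graft F s G) (Inr t) H \<cong>\<^sub>p graft F s (graft G t H)"
proof -
  define f :: "('a + 'b) + 'c \<Rightarrow> 'a + ('b + 'c)"
    where "f = case_sum (case_sum Inl (\<lambda>x. Inr (Inl x))) (\<lambda>z. Inr (Inr z))"
  define g :: "'a + ('b + 'c) \<Rightarrow> ('a + 'b) + 'c"
    where "g = case_sum (\<lambda>x. Inl (Inl x)) (case_sum (\<lambda>x. Inl (Inr x)) Inr)"
  have f: "f (Inl (Inl x)) = Inl x" "f (Inl (Inr y)) = Inr (Inl y)" "f (Inr z) = Inr (Inr z)" for x y z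
    by (auto simp: f_def)
  have gf: "g (f x) = x" for x by (auto simp: f_def g_def split: sum.split)
  have fg: "f (g x) = x" for x by (auto simp: f_def g_def split: sum.split)
  show ?thesis
  proof (rule pforest_iso_bijI[of f])
    show "inj f" using gf by (metis injI)
    show "surj f" using fg by (metis surjI)
    show "f x \<in> verts (graft F s (graft G t H)) \<longleftrightarrow> x \<in> verts (graft (graft F s G) (Inr t) H)" for x
      by (auto simp: f_def split: sum.split)
    show "(f x, f y) \<in> edges (graft F s (graft G t H))
      \<longleftrightarrow> (x, y) \<in> edges (graft (graft F s G) (Inr t) H)" for x y
      by (auto simp: f_def roots_graft[OF assms] split: sum.split)
    show "blocks (graft F s (graft G t H)) = (`) f ` blocks (graft (graft F s G) (Inr t) H)"
      by (simp add: graft_def image_Un image_image f Un_ac)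
    show "deco (graft F s (graft G t H)) (f v) = deco (graft (graft F s G) (Inr t) H) v" for v
      by (auto simp: graft_def f_def split: sum.split)
  qed
qed

subsection \<open>Cutting\<close>

definition desc :: "('v, 'd) pforest \<Rightarrow> 'v set \<Rightarrow> 'v set" where
  "desc F b = (edges F)\<^sup>* `` b"

text \<open>Restriction to such a set cuts through no block, so that blocks survive whole or
  disappear.\<close>

definition saturated :: "('v, 'd) pforest \<Rightarrow> 'v set \<Rightarrow> bool" where
  "saturated F S \<longleftrightarrow> (\<forall>b\<in>blocks F. b \<subseteq> S \<or> b \<inter> S = {})"

lemma St_rest_eq: "St_rest F b = restrict_to F (verts F - desc F b)"
  and St_sub_eq: "St_sub F b = restrict_to F (desc F b)"
  by (simp_all add: St_rest_def St_sub_def desc_def)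

lemma restrict_to_simps [simp]:
  "verts (restrict_to F S) = verts F \<inter> S" "edges (restrict_to F S) = edges F \<inter> S \<times> S"
  "deco (restrict_to F S) = deco F"
  by (simp_all add: restrict_to_def)

lemma blocks_restrict_to:
  assumes "partitioned_forest F" "saturated F S"
  shows "blocks (restrict_to F S) = {b \<in> blocks F. b \<subseteq> S}"
proof -
  have "(\<lambda>b. b \<inter> S) ` blocks F - {{}} = {b \<in> blocks F. b \<subseteq> S}"
  proof (intro equalityI subsetI)
    fix c assume "c \<in> (\<lambda>b. b \<inter> S) ` blocks F - {{}}"
    then obtain b where b: "c = b \<inter> S" "b \<in> blocks F" "c \<noteq> {}" by blast
    then have "b \<subseteq> S" using assms(2) unfolding saturated_def by blast
    then show "c \<in> {b \<in> blocks F. b \<subseteq> S}" using b by (simp add: Int_absorb2)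
  next
    fix b assume "b \<in> {b \<in> blocks F. b \<subseteq> S}"
    then have "b \<in> blocks F" "b = b \<inter> S" by auto
    then show "b \<in> (\<lambda>b. b \<inter> S) ` blocks F - {{}}"
      using partitioned_forestD(3)[OF assms(1)] by auto
  qed
  then show ?thesis by (simp add: restrict_to_def)
qed

lemma restrict_to_restrict_to: "restrict_to (restrict_to F S) T = restrict_to F (S \<inter> T)"
proof -
  have "(\<lambda>b. b \<inter> T) ` ((\<lambda>b. b \<inter> S) ` P - {{}}) - {{}} = (\<lambda>b. b \<inter> (S \<inter> T)) ` P - {{}}" for P :: "'a set set"
  proof (intro equalityI subsetI)
    fix c assume "c \<in> (\<lambda>b. b \<inter> T) ` ((\<lambda>b. b \<inter> S) ` P - {{}}) - {{}}"
    then obtain b where "b \<in> P" "c = b \<inter> S \<inter> T" "c \<noteq> {}" by blast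
    then show "c \<in> (\<lambda>b. b \<inter> (S \<inter> T)) ` P - {{}}" by (simp add: Int_assoc)
  next
    fix c assume "c \<in> (\<lambda>b. b \<inter> (S \<inter> T)) ` P - {{}}"
    then obtain b where b: "b \<in> P" "c = b \<inter> S \<inter> T" "c \<noteq> {}" by blast
    then have "b \<inter> S \<in> (\<lambda>b. b \<inter> S) ` P - {{}}" by simp blast
    then show "c \<in> (\<lambda>b. b \<inter> T) ` ((\<lambda>b. b \<inter> S) ` P - {{}}) - {{}}" using b by simp
  qed
  moreover have "edges F \<inter> S \<times> S \<inter> T \<times> T = edges F \<inter> (S \<inter> T) \<times> (S \<inter> T)" by blast
  ultimately show ?thesis by (simp add: restrict_to_def Int_assoc)
qed

lemma restrict_to_verts:
  assumes "partitioned_forest F"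
  shows "restrict_to F (verts F) = F"
proof -
  have "blocks (restrict_to F (verts F)) = blocks F"
    using blocks_restrict_to[OF assms, of "verts F"] partitioned_forestD(2)[OF assms]
    unfolding saturated_def by blast
  moreover have "edges F \<inter> verts F \<times> verts F = edges F"
    using partitioned_forest_subsets(2)[OF assms] by blast
  ultimately show ?thesis by (intro pforest.equality) simp_all
qed

lemma partitioned_forest_restrict_to:
  assumes F: "partitioned_forest F" and S: "saturated F S"
  shows "partitioned_forest (restrict_to F S)"
proof (rule partitioned_forestI)
  note rF = partitioned_forestD(1)[OF F]
  show "rooted_forest (restrict_to F S)"
    unfolding rooted_forest_def restrict_to_simps
  proof (intro conjI allI impI)
    show "finite (verts F \<inter> S)" using rooted_forestD(1)[OF rF] by simp
    show "edges F \<inter> S \<times> S \<subseteq> (verts F \<inter> S) \<times> (verts F \<inter> S)"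
      using partitioned_forest_subsets(2)[OF F] by blast
    show "acyclic (edges F \<inter> S \<times> S)"
      by (rule acyclic_subset[OF rooted_forestD(3)[OF rF]]) simp
    show "u = u'" if "(u, v) \<in> edges F \<inter> S \<times> S" "(u', v) \<in> edges F \<inter> S \<times> S" for u u' v
      by (rule rooted_forestD(4)[OF rF IntD1[OF that(1)] IntD1[OF that(2)]])
  qed
  have B: "b \<in> blocks F" "b \<subseteq> S" if "b \<in> blocks (restrict_to F S)" for b
    using that blocks_restrict_to[OF F S] by simp_all
  show "b \<subseteq> verts (restrict_to F S)" "b \<noteq> {}" if "b \<in> blocks (restrict_to F S)" for b
    using partitioned_forestD(2,3)[OF F B(1)[OF that]] B(2)[OF that] by simp_all
  show "b = c" if "b \<in> blocks (restrict_to F S)" "c \<in> blocks (restrict_to F S)" "v \<in> b" "v \<in> c" for b c v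
    by (rule partitioned_forestD(4)[OF F B(1)[OF that(1)] B(1)[OF that(2)] that(3,4)])
  show "\<exists>b\<in>blocks (restrict_to F S). v \<in> b" if "v \<in> verts (restrict_to F S)" for v
  proof -
    have v: "v \<in> verts F" "v \<in> S" using that by simp_all
    obtain b where b: "b \<in> blocks F" "v \<in> b" using partitioned_forestD(5)[OF F v(1)] by blast
    then have "b \<subseteq> S" using S v(2) unfolding saturated_def by blast
    then show ?thesis using b blocks_restrict_to[OF F S] by simp blast
  qed
  show "(p, v) \<in> edges (restrict_to F S)"
    if "b \<in> blocks (restrict_to F S)" "u \<in> b" "v \<in> b" "(p, u) \<in> edges (restrict_to F S)" for b u v p
  proof -
    have "(p, v) \<in> edges F"
      using that(4) by (intro partitioned_forestD(6)[OF F B(1)[OF that(1)] that(2,3)]) simp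
    then show ?thesis using that(4) subsetD[OF B(2)[OF that(1)] that(3)] by simp
  qed
qed

lemma desc_closed: "u \<in> desc F b \<Longrightarrow> (u, v) \<in> edges F \<Longrightarrow> v \<in> desc F b"
  unfolding desc_def by (blast intro: rtrancl_into_rtrancl)

lemma desc_base: "b \<subseteq> desc F b"
  unfolding desc_def by blast

lemma desc_parent:
  assumes "v \<in> desc F b" "v \<notin> b"
  shows "\<exists>u\<in>desc F b. (u, v) \<in> edges F"
proof -
  obtain x where "x \<in> b" "(x, v) \<in> (edges F)\<^sup>*" using assms by (auto simp: desc_def)
  from this(2) show ?thesis
  proof (cases rule: rtranclE)
    case base
    then show ?thesis using assms(2) \<open>x \<in> b\<close> by simp
  next
    case (step y)
    then show ?thesis using \<open>x \<in> b\<close> unfolding desc_def by blast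
  qed
qed

lemma desc_induct [consumes 1, case_names base step]:
  assumes "v \<in> desc F b" "\<And>v. v \<in> b \<Longrightarrow> P v"
    "\<And>u v. u \<in> desc F b \<Longrightarrow> P u \<Longrightarrow> (u, v) \<in> edges F \<Longrightarrow> P v"
  shows "P v"
proof -
  obtain x where "x \<in> b" "(x, v) \<in> (edges F)\<^sup>*" using assms(1) by (auto simp: desc_def)
  from this(2) show ?thesis
  proof (induction rule: rtrancl_induct)
    case base
    show ?case by (rule assms(2)[OF \<open>x \<in> b\<close>])
  next
    case (step y z)
    have "y \<in> desc F b" using step(1) \<open>x \<in> b\<close> unfolding desc_def by blast
    then show ?case using step.IH step(2) by (rule assms(3))
  qed
qed

lemma desc_least:
  assumes "b \<subseteq> S" "\<And>u v. u \<in> S \<Longrightarrow> (u, v) \<in> edges F \<Longrightarrow> v \<in> S"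
  shows "desc F b \<subseteq> S"
proof
  fix v assume "v \<in> desc F b"
  then show "v \<in> S"
  proof (induction rule: desc_induct)
    case (base v)
    then show ?case using assms(1) by blast
  next
    case (step u v)
    show ?case using step.IH step.hyps(2) by (rule assms(2))
  qed
qed

locale cut =
  fixes W :: "'d set" and F :: "('v, 'd) pforest" and r b
  assumes F: "ptree W F" and rb: "(r, b) \<in> St_index F"
begin

lemma St_indexD: "r \<in> roots F" "b \<in> blocks F" "v \<in> b \<Longrightarrow> (r, v) \<in> edges F"
  using rb by (auto simp: St_index_def)

lemmas pF = ptreeD(1)[OF F] and rF = ptreeD(2)[OF F]

lemma desc_verts: "desc F b \<subseteq> verts F"
  using partitioned_forestD(2)[OF pF St_indexD(2)] rooted_forestD(2)[OF rF] by (intro desc_least) auto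

lemma parent_desc: "v \<in> desc F b \<Longrightarrow> \<exists>u. (u, v) \<in> edges F"
  using desc_parent St_indexD(3) by metis

lemma roots_desc: "roots F \<inter> desc F b = {}"
  using parent_desc unfolding roots_def by blast

lemma desc_parent_closed: "v \<in> desc F b \<Longrightarrow> v \<notin> b \<Longrightarrow> (u, v) \<in> edges F \<Longrightarrow> u \<in> desc F b"
  using desc_parent[of v F b] rooted_forestD(4)[OF rF] by metis

lemma saturated_desc: "saturated F (desc F b)"
  unfolding saturated_def
proof
  fix c assume c: "c \<in> blocks F"
  show "c \<subseteq> desc F b \<or> c \<inter> desc F b = {}"
  proof (cases "c = b")
    case True
    then show ?thesis using desc_base[of b F] by simp
  next
    case False
    have "w \<in> desc F b" if v: "v \<in> c" "v \<in> desc F b" and w: "w \<in> c" for v w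
    proof -
      have "v \<notin> b" using False partitioned_forestD(4)[OF pF c St_indexD(2) v(1)] by (rule contrapos_nn)
      from desc_parent[OF v(2) this] obtain u where u: "u \<in> desc F b" "(u, v) \<in> edges F" by blast
      show ?thesis by (rule desc_closed[OF u(1) partitioned_forestD(6)[OF pF c v(1) w u(2)]])
    qed
    then show ?thesis by blast
  qed
qed

lemma saturated_rest: "saturated F (verts F - desc F b)"
  unfolding saturated_def
proof
  fix c assume c: "c \<in> blocks F"
  then have "c \<subseteq> desc F b \<or> c \<inter> desc F b = {}"
    using saturated_desc unfolding saturated_def by (rule bspec[rotated])
  then show "c \<subseteq> verts F - desc F b \<or> c \<inter> (verts F - desc F b) = {}"
    using partitioned_forestD(2)[OF pF c] by blast
qed

text \<open>No root lies below b, and a surviving vertex keeps its parent since the removed set is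
  closed under children. The constant number of roots makes the normalisation compatible with
  repeated cuts.\<close>

lemma roots_St_rest: "roots (St_rest F b) = roots F"
proof -
  have *: "u \<in> verts F - desc F b" if "(u, v) \<in> edges F" "v \<notin> desc F b" for u v
    using that desc_closed[of u F b v] rooted_forestD(2)[OF rF that(1)] by blast
  show ?thesis
  proof (intro equalityI subsetI)
    fix v assume "v \<in> roots (St_rest F b)"
    then show "v \<in> roots F"
      using * unfolding roots_def St_rest_eq restrict_to_simps by blast
  next
    fix v assume "v \<in> roots F"
    moreover from this have "v \<notin> desc F b" using roots_desc by blast
    ultimately show "v \<in> roots (St_rest F b)"
      unfolding roots_def St_rest_eq restrict_to_simps by blast
  qed
qed

lemma roots_St_sub: "roots (St_sub F b) = b"
proof -
  have r: "r \<notin> desc F b" using roots_desc St_indexD(1) by blast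
  show ?thesis
  proof (intro equalityI subsetI)
    fix v assume "v \<in> roots (St_sub F b)"
    then have v: "v \<in> desc F b" "\<And>u. u \<in> desc F b \<Longrightarrow> (u, v) \<notin> edges F"
      unfolding roots_def St_sub_eq restrict_to_simps by blast+
    then show "v \<in> b" using desc_parent[of v F b] by blast
  next
    fix v assume v: "v \<in> b"
    have "u = r" if "(u, v) \<in> edges F" for u
      by (rule rooted_forestD(4)[OF rF that St_indexD(3)[OF v]])
    then have "(u, v) \<notin> edges F" if "u \<in> desc F b" for u using r that by blast
    moreover have "v \<in> desc F b" using desc_base[of b F] v by (rule subsetD)
    ultimately show "v \<in> roots (St_sub F b)"
      using desc_verts unfolding roots_def St_sub_eq restrict_to_simps by blast
  qed
qed

lemma verts_St: "verts (St_rest F b) = verts F - desc F b" "verts (St_sub F b) = desc F b"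
  unfolding St_rest_eq St_sub_eq restrict_to_simps using desc_verts by blast+

lemma ptree_St_rest: "ptree W (St_rest F b)"
proof (rule ptreeI)
  show "partitioned_forest (St_rest F b)"
    unfolding St_rest_eq by (rule partitioned_forest_restrict_to[OF pF saturated_rest])
  have roots: "roots F \<subseteq> verts F - desc F b"
  proof
    fix v assume "v \<in> roots F"
    then have "v \<in> verts F" "v \<notin> desc F b" using roots_desc by (simp add: roots_def, blast)
    then show "v \<in> verts F - desc F b" by simp
  qed
  then show "roots (St_rest F b) \<in> blocks (St_rest F b)"
    unfolding roots_St_rest unfolding St_rest_eq blocks_restrict_to[OF pF saturated_rest]
    using ptree_roots(1)[OF F] by simp
  show "verts (St_rest F b) \<noteq> {}"
    using roots ptree_roots(2)[OF F] unfolding verts_St by blast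
  have "deco F ` (verts F - desc F b) \<subseteq> deco F ` verts F" by (rule image_mono) blast
  then show "deco (St_rest F b) ` verts (St_rest F b) \<subseteq> W"
    unfolding verts_St unfolding St_rest_eq restrict_to_simps using ptreeD(5)[OF F] by (rule order_trans)
qed

lemma ptree_St_sub: "ptree W (St_sub F b)"
proof (rule ptreeI)
  show "partitioned_forest (St_sub F b)"
    unfolding St_sub_eq by (rule partitioned_forest_restrict_to[OF pF saturated_desc])
  show "roots (St_sub F b) \<in> blocks (St_sub F b)"
    unfolding roots_St_sub unfolding St_sub_eq blocks_restrict_to[OF pF saturated_desc]
    using St_indexD(2) desc_base[of b F] by simp
  show "verts (St_sub F b) \<noteq> {}"
    using desc_base[of b F] partitioned_forestD(3)[OF pF St_indexD(2)] unfolding verts_St by blast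
  have "deco F ` desc F b \<subseteq> deco F ` verts F" by (rule image_mono[OF desc_verts])
  then show "deco (St_sub F b) ` verts (St_sub F b) \<subseteq> W"
    unfolding verts_St unfolding St_sub_eq restrict_to_simps using ptreeD(5)[OF F] by (rule order_trans)
qed

lemma card_verts_St: "card (verts (St_rest F b)) + card (verts (St_sub F b)) = card (verts F)"
  unfolding verts_St using desc_verts ptreeD(3)[OF F]
  by (simp add: card_Diff_subset finite_subset card_mono)

end

lemma finite_St_index:
  assumes F: "ptree W F"
  shows "finite (St_index F)"
proof (rule finite_subset)
  show "St_index F \<subseteq> verts F \<times> Pow (verts F)"
    using partitioned_forestD(2)[OF ptreeD(1)[OF F]] unfolding St_index_def roots_def by blast
qed (use ptreeD(3)[OF F] in simp)

text \<open>The root is the common parent of the nonempty block. An index is therefore determined by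
  its block.\<close>

lemma St_index_root_unique:
  assumes F: "ptree W F" and rb: "(r, b) \<in> St_index F" and r'b: "(r', b) \<in> St_index F"
  shows "r = r'"
proof -
  interpret c: cut W F r b by (rule cut.intro[OF F rb])
  interpret c': cut W F r' b by (rule cut.intro[OF F r'b])
  obtain v where v: "v \<in> b" using partitioned_forestD(3)[OF c.pF c.St_indexD(2)] by blast
  show ?thesis by (rule rooted_forestD(4)[OF c.rF c.St_indexD(3)[OF v] c'.St_indexD(3)[OF v]])
qed

locale two_cuts = cut W F r b + c': cut W F r' b' for W F r b r' b' +
  assumes neq: "b \<noteq> b'"
begin

text \<open>Going upwards from a common descendant stays below both blocks until one of them is
  reached. The next parent is then a root, yet it would still lie below the other block.\<close>

lemma desc_disjoint: "desc F b \<inter> desc F b' = {}"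
proof -
  have "v \<notin> desc F b'" if "v \<in> desc F b" for v
    using that
  proof (induction rule: desc_induct)
    case (base v)
    show ?case
    proof
      assume v: "v \<in> desc F b'"
      have "v \<notin> b'" using base neq partitioned_forestD(4)[OF pF St_indexD(2) c'.St_indexD(2)] by blast
      then have "r \<in> desc F b'" using v c'.desc_parent_closed St_indexD(3)[OF base] by blast
      then show False using St_indexD(1) c'.roots_desc by blast
    qed
  next
    case (step u v)
    show ?case
    proof
      assume v: "v \<in> desc F b'"
      have "v \<notin> b'"
      proof
        assume "v \<in> b'"
        then have "u = r'" using step.hyps(2) c'.St_indexD(3) rooted_forestD(4)[OF rF] by blast
        then show False using step.hyps(1) c'.St_indexD(1) roots_desc by blast
      qed
      then show False using v c'.desc_parent_closed step.hyps(2) step.IH by blast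
    qed
  qed
  then show ?thesis by blast
qed

lemma desc_St_rest: "desc (St_rest F b) b' = desc F b'"
proof
  show "desc (St_rest F b) b' \<subseteq> desc F b'"
  proof (rule desc_least[OF desc_base])
    fix u v assume u: "u \<in> desc F b'" and "(u, v) \<in> edges (St_rest F b)"
    then have "(u, v) \<in> edges F" by (simp add: St_rest_eq)
    with u show "v \<in> desc F b'" by (rule desc_closed)
  qed
  show "desc F b' \<subseteq> desc (St_rest F b) b'"
  proof
    fix v assume "v \<in> desc F b'"
    then show "v \<in> desc (St_rest F b) b'"
    proof (induction rule: desc_induct)
      case (base v)
      then show ?case using desc_base[of b' "St_rest F b"] by blast
    next
      case (step u v)
      have "v \<in> desc F b'" using step.hyps by (rule desc_closed)
      then have "(u, v) \<in> edges (St_rest F b)"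
        using step.hyps desc_disjoint c'.desc_verts unfolding St_rest_eq restrict_to_simps by blast
      with step.IH show ?case by (rule desc_closed)
    qed
  qed
qed

lemma St_sub_St_rest: "St_sub (St_rest F b) b' = St_sub F b'"
proof -
  have "(verts F - desc F b) \<inter> desc F b' = desc F b'" using desc_disjoint c'.desc_verts by blast
  then show ?thesis unfolding St_sub_eq[of "St_rest F b"] desc_St_rest
    by (simp add: St_rest_eq restrict_to_restrict_to St_sub_eq)
qed

text \<open>The right-hand side removes two sets whose order is irrelevant; this is the geometric
  content of the commutation of slices.\<close>

lemma St_rest_St_rest: "St_rest (St_rest F b) b' = restrict_to F (verts F - desc F b - desc F b')"
proof -
  have "(verts F - desc F b) \<inter> (verts (St_rest F b) - desc F b') = verts F - desc F b - desc F b'"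
    unfolding verts_St by blast
  then show ?thesis unfolding St_rest_eq[of "St_rest F b"] desc_St_rest
    by (simp add: St_rest_eq[of F] restrict_to_restrict_to)
qed

end

lemma (in cut) blocks_St_rest: "c \<in> blocks (St_rest F b) \<longleftrightarrow> c \<in> blocks F \<and> c \<subseteq> verts F - desc F b"
  unfolding St_rest_eq blocks_restrict_to[OF pF saturated_rest] by simp

lemma (in cut) edges_St_rest:
  "e \<in> edges (St_rest F b) \<longleftrightarrow> e \<in> edges F \<and> e \<in> (verts F - desc F b) \<times> (verts F - desc F b)"
  by (simp add: St_rest_eq)

text \<open>The roots survive and the other cut blocks lie outside the removed set by
  \<open>desc_disjoint\<close>; restriction adds no blocks or edges, so no new index
  appears.\<close>

lemma (in cut) St_index_St_rest: "St_index (St_rest F b) = St_index F - {(r, b)}"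
proof (intro equalityI subsetI)
  fix x assume x: "x \<in> St_index (St_rest F b)"
  obtain r' b' where x': "x = (r', b')" by (cases x)
  have b': "r' \<in> roots F" "b' \<in> blocks F" "b' \<subseteq> verts F - desc F b" "\<And>v. v \<in> b' \<Longrightarrow> (r', v) \<in> edges F"
    using x unfolding x' St_index_def roots_St_rest by (auto simp: blocks_St_rest edges_St_rest)
  have "b' \<noteq> b" using b'(3) desc_base[of b F] partitioned_forestD(3)[OF pF b'(2)] by blast
  then show "x \<in> St_index F - {(r, b)}" using b' by (simp add: x' St_index_def)
next
  fix x assume x: "x \<in> St_index F - {(r, b)}"
  obtain r' b' where x': "x = (r', b')" by (cases x)
  have r'b': "(r', b') \<in> St_index F" using x x' by simp
  interpret c': cut W F r' b' by (rule cut.intro[OF F r'b'])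
  have "b \<noteq> b'" using x x' rb St_index_root_unique[OF F _ r'b', of r] by blast
  then interpret two_cuts W F r b r' b'
    by (intro two_cuts.intro two_cuts_axioms.intro cut_axioms c'.cut_axioms)
  have sub: "b' \<subseteq> verts F - desc F b"
    using desc_disjoint desc_base[of b' F] c'.desc_verts by blast
  have r': "r' \<in> verts F" "r' \<notin> desc F b" using c'.St_indexD(1) roots_desc by (simp add: roots_def, blast)
  have "(r', v) \<in> edges (St_rest F b)" if "v \<in> b'" for v
    using subsetD[OF sub that] r' c'.St_indexD(3)[OF that] by (simp add: edges_St_rest)
  moreover have "b' \<in> blocks (St_rest F b)"
    using sub c'.St_indexD(2) by (simp add: blocks_St_rest)
  ultimately show "x \<in> St_index (St_rest F b)"
    using c'.St_indexD(1) by (simp add: x' St_index_def roots_St_rest)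
qed

subsection \<open>Cutting a grafted tree\<close>

lemma blocks_graft: "blocks (graft F s G) = (`) Inl ` blocks F \<union> (`) Inr ` blocks G"
  by (simp add: graft_def)

text \<open>Keeping s preserves the edges to the copy of G. Both sides have vertices in the same sum
  type, so an equality holds and not only an isomorphism.\<close>

lemma restrict_graft_both:
  assumes G: "partitioned_forest G" and s: "s \<in> S"
  shows "restrict_to (graft F s G) (Inl ` S \<union> Inr ` verts G) = graft (restrict_to F S) s G"
    (is "?L = ?R")
proof (rule pforest.equality)
  let ?S = "Inl ` S \<union> Inr ` verts G"
  have E: "edges G \<subseteq> verts G \<times> verts G" by (rule partitioned_forest_subsets(2)[OF G])
  show "verts ?L = verts ?R" by (auto simp: graft_def)
  show "edges ?L = edges ?R"
  proof (intro equalityI subrelI)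
    fix x y assume "(x, y) \<in> edges ?L"
    then show "(x, y) \<in> edges ?R" by (cases x; cases y) auto
  next
    fix x y assume "(x, y) \<in> edges ?R"
    then show "(x, y) \<in> edges ?L" using E s by (cases x; cases y) (auto simp: roots_def)
  qed
  have l: "Inl ` c \<inter> ?S = Inl ` (c \<inter> S)" for c by auto
  have r: "Inr ` c \<inter> ?S = Inr ` c" if "c \<in> blocks G" for c
    using partitioned_forestD(2)[OF G that] by auto
  have "(\<lambda>c. c \<inter> ?S) ` (`) Inl ` blocks F - {{}} = (`) Inl ` ((\<lambda>c. c \<inter> S) ` blocks F - {{}})"
    unfolding image_image l by blast
  moreover have "(\<lambda>c. c \<inter> ?S) ` (`) Inr ` blocks G - {{}} = (`) Inr ` blocks G"
    using r partitioned_forestD(3)[OF G] unfolding image_image by force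
  ultimately show "blocks ?L = blocks ?R"
    by (simp add: restrict_to_def graft_def image_Un Un_Diff)
qed (simp_all add: graft_def)

lemma pforest_isoI:
  assumes "inj_on f (verts F)" "verts G = f ` verts F" "edges G = map_prod f f ` edges F"
    "blocks G = (`) f ` blocks F" "\<And>v. v \<in> verts F \<Longrightarrow> deco G (f v) = deco F v"
  shows "F \<cong>\<^sub>p G"
  unfolding pforest_iso_def using assms by (intro exI[of _ f]) (simp add: bij_betw_def)

lemma restrict_graft_left:
  fixes F :: "('a, 'd) pforest" and G :: "('b, 'd) pforest"
  assumes "S \<subseteq> verts F"
  shows "restrict_to F S \<cong>\<^sub>p restrict_to (graft F s G) (Inl ` S)"
proof (rule pforest_isoI[of Inl])
  show "verts (restrict_to (graft F s G) (Inl ` S)) = Inl ` verts (restrict_to F S)"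
    by (auto simp: graft_def)
  show "edges (restrict_to (graft F s G) (Inl ` S)) = map_prod Inl Inl ` edges (restrict_to F S)"
  proof (intro equalityI subrelI)
    fix x y :: "'a + 'b" assume xy: "(x, y) \<in> edges (restrict_to (graft F s G) (Inl ` S))"
    then have "x \<in> Inl ` S" "y \<in> Inl ` S" by simp_all
    then obtain u v where uv: "x = Inl u" "u \<in> S" "y = Inl v" "v \<in> S" by blast
    then have "(u, v) \<in> edges (restrict_to F S)" using xy by simp
    then show "(x, y) \<in> map_prod Inl Inl ` edges (restrict_to F S)"
      unfolding uv(1,3) by (rule map_prod_imageI)
  next
    fix x y :: "'a + 'b" assume "(x, y) \<in> map_prod Inl Inl ` edges (restrict_to F S)"
    then obtain u v where "x = Inl u" "y = Inl v" "(u, v) \<in> edges (restrict_to F S)"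
      by (rule prod_fun_imageE) auto
    then show "(x, y) \<in> edges (restrict_to (graft F s G) (Inl ` S))" by simp
  qed
  have "(\<lambda>c. c \<inter> Inl ` S) ` (`) Inl ` blocks F - {{}} = (`) Inl ` ((\<lambda>c. c \<inter> S) ` blocks F - {{}})"
  proof -
    have l: "Inl ` c \<inter> Inl ` S = Inl ` (c \<inter> S)" for c by auto
    show ?thesis unfolding image_image l by blast
  qed
  moreover have "(\<lambda>c. c \<inter> Inl ` S) ` (`) Inr ` blocks G \<subseteq> {{}}" by blast
  then have "(\<lambda>c. c \<inter> Inl ` S) ` (`) Inr ` blocks G - {{}} = {}" by (simp only: Diff_eq_empty_iff)
  ultimately show "blocks (restrict_to (graft F s G) (Inl ` S)) = (`) Inl ` blocks (restrict_to F S)"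
    unfolding restrict_to_def graft_def by (simp only: pforest.simps image_Un Un_Diff Un_empty_right)
qed (simp_all add: graft_def)

lemma restrict_graft_right:
  fixes F :: "('a, 'd) pforest" and G :: "('b, 'd) pforest"
  assumes G: "partitioned_forest G"
  shows "G \<cong>\<^sub>p restrict_to (graft F s G) (Inr ` verts G)"
proof (rule pforest_isoI[of Inr])
  show "verts (restrict_to (graft F s G) (Inr ` verts G)) = Inr ` verts G"
    by (auto simp: graft_def)
  show "edges (restrict_to (graft F s G) (Inr ` verts G)) = map_prod Inr Inr ` edges G"
  proof (intro equalityI subrelI)
    fix x y :: "'a + 'b" assume xy: "(x, y) \<in> edges (restrict_to (graft F s G) (Inr ` verts G))"
    then have "x \<in> Inr ` verts G" "y \<in> Inr ` verts G" by simp_all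
    then obtain u v where uv: "x = Inr u" "y = Inr v" by blast
    then have "(u, v) \<in> edges G" using xy by simp
    then show "(x, y) \<in> map_prod Inr Inr ` edges G" unfolding uv by (rule map_prod_imageI)
  next
    fix x y :: "'a + 'b" assume "(x, y) \<in> map_prod Inr Inr ` edges G"
    then obtain u v where uv: "x = Inr u" "y = Inr v" "(u, v) \<in> edges G"
      by (rule prod_fun_imageE) auto
    then show "(x, y) \<in> edges (restrict_to (graft F s G) (Inr ` verts G))"
      using rooted_forestD(2)[OF partitioned_forestD(1)[OF G] uv(3)] by simp
  qed
  let ?r = "Inr :: 'b \<Rightarrow> 'a + 'b"
  have "?r ` c \<inter> ?r ` verts G = ?r ` c" if "c \<in> blocks G" for c
    using partitioned_forestD(2)[OF G that] by auto
  then have "(\<lambda>c. c \<inter> ?r ` verts G) ` (`) ?r ` blocks G = (`) ?r ` blocks G"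
    unfolding image_image by (rule image_cong[OF HOL.refl])
  moreover have "{} \<notin> (`) ?r ` blocks G"
    using partitioned_forestD(3)[OF G] by blast
  ultimately have "(\<lambda>c. c \<inter> ?r ` verts G) ` (`) ?r ` blocks G - {{}} = (`) ?r ` blocks G"
    by simp
  moreover have "(\<lambda>c. c \<inter> ?r ` verts G) ` (`) Inl ` blocks F \<subseteq> {{}}" by blast
  then have "(\<lambda>c. c \<inter> ?r ` verts G) ` (`) Inl ` blocks F - {{}} = {}" by (simp only: Diff_eq_empty_iff)
  ultimately show "blocks (restrict_to (graft F s G) (Inr ` verts G)) = (`) Inr ` blocks G"
    unfolding restrict_to_def graft_def by (simp only: pforest.simps image_Un Un_Diff Un_empty_left)
qed (simp_all add: graft_def)

lemma desc_Inr_roots: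
  fixes F :: "('a, 'd) pforest" and G :: "('b, 'd) pforest"
  assumes G: "partitioned_forest G"
  shows "desc (graft F s G) (Inr ` roots G) = Inr ` verts G"
proof
  show "desc (graft F s G) (Inr ` roots G) \<subseteq> Inr ` verts G"
  proof (rule desc_least)
    fix x y :: "'a + 'b" assume x: "x \<in> Inr ` verts G" and e: "(x, y) \<in> edges (graft F s G)"
    obtain w where w: "x = Inr w" "w \<in> verts G" using x by (rule imageE)
    show "y \<in> Inr ` verts G"
    proof (cases y)
      case (Inr z)
      then have "(w, z) \<in> edges G" using e w by simp
      then show ?thesis using rooted_forestD(2)[OF partitioned_forestD(1)[OF G]] Inr by blast
    qed (use e w in simp)
  next
    show "(Inr :: 'b \<Rightarrow> 'a + 'b) ` roots G \<subseteq> Inr ` verts G"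
      by (rule image_mono) (auto simp: roots_def)
  qed
  show "Inr ` verts G \<subseteq> desc (graft F s G) (Inr ` roots G)"
  proof
    fix x :: "'a + 'b" assume "x \<in> Inr ` verts G"
    then obtain w where w: "x = Inr w" "w \<in> verts G" by (rule imageE)
    obtain t where t: "t \<in> roots G" "(t, w) \<in> (edges G)\<^sup>*"
      using root_reaches[OF partitioned_forestD(1)[OF G] w(2)] by blast
    from t(2) have "Inr w \<in> desc (graft F s G) (Inr ` roots G)"
    proof (induction rule: rtrancl_induct)
      case base
      show ?case using desc_base[of "Inr ` roots G" "graft F s G"] t(1) by blast
    next
      case (step y z)
      show ?case by (rule desc_closed[OF step.IH]) (simp add: step.hyps(2))
    qed
    then show "x \<in> desc (graft F s G) (Inr ` roots G)" using w by simp
  qed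
qed

locale cut_graft = cut W F r b for W :: "'d set" and F :: "('v, 'd) pforest" and r b +
  fixes G :: "('w, 'd) pforest" and s
  assumes G: "ptree W G" and s: "s \<in> verts F"
begin

lemmas pG = ptreeD(1)[OF G]

text \<open>The copy of G hangs entirely below s, so it lies below the cut exactly when s
  does.\<close>

lemma desc_graft:
  "desc (graft F s G) (Inl ` b) = Inl ` desc F b \<union> (if s \<in> desc F b then Inr ` verts G else {})"
  (is "?L = ?R")
proof
  have mem: "Inl u \<in> ?R \<longleftrightarrow> u \<in> desc F b" "Inr w \<in> ?R \<longleftrightarrow> s \<in> desc F b \<and> w \<in> verts G" for u w
    by (auto simp del: graft_simps)
  show "?L \<subseteq> ?R"
  proof (rule desc_least)
    show "Inl ` b \<subseteq> ?R" using desc_base[of b F] by (intro le_supI1 image_mono)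
    fix x y assume x: "x \<in> ?R" and e: "(x, y) \<in> edges (graft F s G)"
    show "y \<in> ?R"
    proof (cases x)
      case (Inl u)
      then have u: "u \<in> desc F b" using x by (simp only: mem)
      show ?thesis
      proof (cases y)
        case y: (Inl v)
        then have "(u, v) \<in> edges F" using e Inl by simp
        then show ?thesis unfolding y mem by (rule desc_closed[OF u])
      next
        case y: (Inr w)
        then have "u = s" "w \<in> verts G" using e Inl by (simp_all add: roots_def)
        then show ?thesis using u unfolding y mem by simp
      qed
    next
      case (Inr v)
      then have v: "s \<in> desc F b" "v \<in> verts G" using x by (simp_all only: mem)
      show ?thesis
      proof (cases y)
        case y: (Inl w)
        then show ?thesis using e Inr by simp
      next
        case y: (Inr w)
        then have "(v, w) \<in> edges G" using e Inr by simp
        then have "w \<in> verts G" using rooted_forestD(2)[OF partitioned_forestD(1)[OF pG]] by blast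
        then show ?thesis using v unfolding y mem by simp
      qed
    qed
  qed
  have l: "Inl v \<in> ?L" if "v \<in> desc F b" for v
    using that
  proof (induction rule: desc_induct)
    case (base v)
    then show ?case using desc_base[of "Inl ` b" "graft F s G"] by blast
  next
    case (step u v)
    show ?case by (rule desc_closed[OF step.IH]) (simp add: step.hyps(2))
  qed
  have r: "Inr ` verts G \<subseteq> ?L" if sd: "s \<in> desc F b"
  proof -
    have "desc (graft F s G) (Inr ` roots G) \<subseteq> ?L"
    proof (rule desc_least)
      show "Inr ` roots G \<subseteq> ?L"
      proof
        fix x :: "'v + 'w" assume "x \<in> Inr ` roots G"
        then obtain w where w: "x = Inr w" "w \<in> roots G" by (rule imageE)
        show "x \<in> ?L" unfolding w(1) by (rule desc_closed[OF l[OF sd]]) (simp add: w(2))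
      qed
    qed (rule desc_closed)
    then show ?thesis by (simp only: desc_Inr_roots[OF pG])
  qed
  show "?R \<subseteq> ?L"
  proof
    fix x assume x: "x \<in> ?R"
    show "x \<in> ?L"
    proof (cases x)
      case (Inl v)
      then show ?thesis using x l by (simp only: mem)
    next
      case (Inr w)
      then show ?thesis using x r by (simp only: mem) blast
    qed
  qed
qed

lemma verts_graft: "verts (graft F s G) = Inl ` verts F \<union> Inr ` verts G"
  by (simp add: graft_def)

text \<open>G is carried off with the piece that contains s; these cuts give the terms F' \<otimes>
  (F'' \<bullet> G).\<close>

lemma cut_below:
  assumes "s \<in> desc F b"
  shows "iso_class (St_rest (graft F s G) (Inl ` b)) = iso_class (St_rest F b)"
    "St_sub (graft F s G) (Inl ` b) = graft (St_sub F b) s G"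
proof -
  have d: "desc (graft F s G) (Inl ` b) = Inl ` desc F b \<union> Inr ` verts G"
    using assms by (simp add: desc_graft)
  then have v: "verts (graft F s G) - desc (graft F s G) (Inl ` b) = Inl ` (verts F - desc F b)"
    unfolding verts_graft by auto
  show "iso_class (St_rest (graft F s G) (Inl ` b)) = iso_class (St_rest F b)"
    unfolding St_rest_eq[of "graft F s G"] v
    by (rule ptree_iso_class_eqI[OF ptree_St_rest, symmetric])
      (unfold St_rest_eq, rule restrict_graft_left, blast)
  show "St_sub (graft F s G) (Inl ` b) = graft (St_sub F b) s G"
    unfolding St_sub_eq d by (rule restrict_graft_both[OF pG assms])
qed

text \<open>G stays with the remainder; these cuts give the terms (F' \<bullet> G) \<otimes>
  F''.\<close>

lemma cut_beside:
  assumes "s \<notin> desc F b"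
  shows "St_rest (graft F s G) (Inl ` b) = graft (St_rest F b) s G"
    "iso_class (St_sub (graft F s G) (Inl ` b)) = iso_class (St_sub F b)"
proof -
  have d: "desc (graft F s G) (Inl ` b) = Inl ` desc F b"
    using assms by (simp add: desc_graft)
  then have v: "verts (graft F s G) - desc (graft F s G) (Inl ` b) = Inl ` (verts F - desc F b) \<union> Inr ` verts G"
    unfolding verts_graft by auto
  show "St_rest (graft F s G) (Inl ` b) = graft (St_rest F b) s G"
    unfolding St_rest_eq v using assms s by (intro restrict_graft_both[OF pG]) simp
  show "iso_class (St_sub (graft F s G) (Inl ` b)) = iso_class (St_sub F b)"
    unfolding St_sub_eq[of "graft F s G"] d
    by (rule ptree_iso_class_eqI[OF ptree_St_sub, symmetric])
      (unfold St_sub_eq, rule restrict_graft_left[OF desc_verts])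
qed

end

text \<open>Cutting at the grafted block undoes the grafting and gives the term F \<otimes>
  G.\<close>

lemma cut_new:
  assumes F: "ptree W F" and G: "ptree W G"
  shows "iso_class (St_sub (graft F s G) (Inr ` roots G)) = iso_class G"
    "iso_class (St_rest (graft F s G) (Inr ` roots G)) = iso_class F"
proof -
  note d = desc_Inr_roots[OF ptreeD(1)[OF G], of F s]
  show "iso_class (St_sub (graft F s G) (Inr ` roots G)) = iso_class G"
    unfolding St_sub_eq d
    by (rule ptree_iso_class_eqI[OF G restrict_graft_right[OF ptreeD(1)[OF G]], symmetric])
  have v: "verts (graft F s G) - Inr ` verts G = Inl ` verts F" by (auto simp: graft_def)
  have "F \<cong>\<^sub>p restrict_to (graft F s G) (Inl ` verts F)"
    using restrict_graft_left[of "verts F" F s G] by (simp add: restrict_to_verts[OF ptreeD(1)[OF F]])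
  from ptree_iso_class_eqI[OF F this]
  show "iso_class (St_rest (graft F s G) (Inr ` roots G)) = iso_class F"
    unfolding St_rest_eq d v by simp
qed

text \<open>The root block of G can be cut only if its new parent s is a root of F. All other blocks
  of G have deeper parents or none in the roots of F.\<close>

lemma St_index_graft:
  fixes F :: "('a, 'd) pforest" and G :: "('b, 'd) pforest"
  assumes F: "ptree W F" and G: "ptree W G" and s: "s \<in> verts F"
  shows "St_index (graft F s G) = map_prod Inl ((`) Inl) ` St_index F
    \<union> (if s \<in> roots F then {(Inl s, Inr ` roots G)} else {})" (is "?L = ?R")
proof (intro equalityI subsetI)
  fix x assume "x \<in> ?L"
  then obtain t c where x: "x = (t, c)" "t \<in> Inl ` roots F" "c \<in> blocks (graft F s G)"
    "\<And>v. v \<in> c \<Longrightarrow> (t, v) \<in> edges (graft F s G)"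
    unfolding St_index_def roots_graft[OF s] by blast
  obtain u where u: "t = Inl u" "u \<in> roots F" using x(2) by (rule imageE)
  consider c' where "c' \<in> blocks F" "c = Inl ` c'" | c' where "c' \<in> blocks G" "c = Inr ` c'"
    using x(3) unfolding blocks_graft by blast
  then show "x \<in> ?R"
  proof cases
    case 1
    have "(u, v) \<in> edges F" if "v \<in> c'" for v
      using x(4)[of "Inl v"] that u 1 by simp
    then have "(u, c') \<in> St_index F" using u 1 by (simp add: St_index_def)
    then have "x \<in> map_prod Inl ((`) Inl) ` St_index F"
      unfolding x(1) u(1) 1(2) by (rule map_prod_imageI)
    then show ?thesis by simp
  next
    case 2
    have *: "u = s \<and> v \<in> roots G" if "v \<in> c'" for v
      using x(4)[of "Inr v"] that u 2 by simp
    moreover obtain v where v: "v \<in> c'" using partitioned_forestD(3)[OF ptreeD(1)[OF G] 2(1)] by blast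
    moreover have "c' = roots G"
      by (rule partitioned_forestD(4)[OF ptreeD(1)[OF G] 2(1) ptree_roots(1)[OF G] v])
        (use *[OF v] in simp)
    ultimately show ?thesis using x(1) u 2 by simp
  qed
next
  fix x assume "x \<in> ?R"
  then consider u c where "(u, c) \<in> St_index F" "x = (Inl u, Inl ` c)"
    | "s \<in> roots F" "x = (Inl s, Inr ` roots G)" by (auto split: if_splits)
  then show "x \<in> ?L"
  proof cases
    case 1
    then show ?thesis by (auto simp: St_index_def roots_graft[OF s] blocks_graft)
  next
    case 2
    then show ?thesis
      using ptree_roots(1)[OF G] by (auto simp: St_index_def roots_graft[OF s] blocks_graft)
  qed
qed

subsection \<open>The normalised coproduct\<close>

definition num_verts :: "'d pt_class \<Rightarrow> nat" where
  "num_verts C = card (verts (rep C))"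

definition num_roots :: "'d pt_class \<Rightarrow> nat" where
  "num_roots C = card (roots (rep C))"

text \<open>
  Grafting at a root creates one new term of the coproduct for each root; the division by the
  number of roots turns their sum into a single term \<open>T \<otimes> T'\<close>.
\<close>

definition norm_coprod :: "'d pt_class \<Rightarrow> 'd pt_class \<times> 'd pt_class \<Rightarrow>\<^sub>0 'k::field_char_0" where
  "norm_coprod C = scale (inverse (of_nat (num_roots C))) (tree_coprod C)"

abbreviation cut_rest :: "('v, 'd) pforest \<Rightarrow> 'v \<times> 'v set \<Rightarrow> 'd pt_class" where
  "cut_rest F x \<equiv> iso_class (St_rest F (snd x))"

abbreviation cut_sub :: "('v, 'd) pforest \<Rightarrow> 'v \<times> 'v set \<Rightarrow> 'd pt_class" where
  "cut_sub F x \<equiv> iso_class (St_sub F (snd x))"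

lemma num_iso_class:
  "ptree W F \<Longrightarrow> num_verts (iso_class F) = card (verts F)"
  "ptree W F \<Longrightarrow> num_roots (iso_class F) = card (roots F)"
  unfolding num_verts_def num_roots_def by (rule ptree_rep(2), assumption) (rule ptree_rep(3), assumption)

lemma card_roots_pos:
  assumes F: "ptree W F" shows "0 < card (roots F)"
proof -
  have "finite (roots F)"
    by (rule finite_subset[OF _ ptreeD(3)[OF F]]) (auto simp: roots_def)
  then show ?thesis using ptree_roots(2)[OF F] by (simp add: card_gt_0_iff)
qed

lemma tree_coprod_ptree:
  assumes F: "ptree W F"
  shows "tree_coprod (iso_class F) = (\<Sum>x\<in>St_index F. basis (cut_rest F x, cut_sub F x))"
  unfolding tree_coprod_iso_class[OF ptreeD(1)[OF F]] by (simp add: case_prod_unfold)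

lemma norm_coprod_ptree:
  assumes F: "ptree W F"
  shows "norm_coprod (iso_class F) =
    scale (inverse (of_nat (card (roots F)))) (\<Sum>x\<in>St_index F. basis (cut_rest F x, cut_sub F x))"
  unfolding norm_coprod_def num_iso_class(2)[OF F] tree_coprod_ptree[OF F] ..

lemma tree_prod_ptree:
  assumes F: "ptree W F" and G: "ptree W G"
  shows "tree_prod (iso_class F) (iso_class G) = (\<Sum>s\<in>verts F. basis (iso_class (graft F s G)))"
  by (rule tree_prod_iso_class[OF ptreeD(1)[OF F] ptreeD(1)[OF G]])

lemma keys_sum_basis:
  assumes "\<And>i. i \<in> I \<Longrightarrow> f i \<in> S"
  shows "Poly_Mapping.keys (\<Sum>i\<in>I. basis (f i) :: 'a \<Rightarrow>\<^sub>0 'k::field_char_0) \<subseteq> S"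
  using subsp_sum[OF subsp_keys[of S], of I "\<lambda>i. basis (f i)"] assms by simp

lemma sum_const_scale: "(\<Sum>i\<in>I. y) = scale (of_nat (card I)) y"
  by (induction I rule: infinite_finite_induct) (simp_all add: scale_add)

lemma sum_verts_graft:
  assumes "finite (verts F)" "finite (verts G)"
  shows "(\<Sum>x\<in>verts (graft F s G). f x) = (\<Sum>u\<in>verts F. f (Inl u)) + (\<Sum>w\<in>verts G. f (Inr w))"
proof -
  have "verts (graft F s G) = verts F <+> verts G" by (simp add: graft_def Plus_def)
  then show ?thesis using sum.Plus[OF assms, of f] by (simp add: comp_def)
qed

text \<open>In (F \<bullet> G) \<bullet> H the tree H is attached at a vertex of F or of G. The
  latter terms make up F \<bullet> (G \<bullet> H) by \<open>graft_assoc\<close> and cancel, leaving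
  G and H both attached to F, a form symmetric in G and H.\<close>

lemma tree_prod_prelie:
  fixes F :: "('a, 'd) pforest" and G :: "('b, 'd) pforest" and H :: "('c, 'd) pforest"
  assumes F: "ptree W F" and G: "ptree W G" and H: "ptree W H"
  shows "bilin tree_prod (tree_prod (iso_class F) (iso_class G)) (basis (iso_class H))
      - bilin tree_prod (basis (iso_class F)) (tree_prod (iso_class G) (iso_class H))
    = (\<Sum>s\<in>verts F. \<Sum>s'\<in>verts F. basis (iso_class (graft (graft F s G) (Inl s') H)) :: _ \<Rightarrow>\<^sub>0 'k::field_char_0)"
proof -
  note fin = ptreeD(3)[OF F] ptreeD(3)[OF G]
  have "bilin tree_prod (tree_prod (iso_class F) (iso_class G)) (basis (iso_class H))
    = (\<Sum>s\<in>verts F. tree_prod (iso_class (graft F s G)) (iso_class H) :: _ \<Rightarrow>\<^sub>0 'k)"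
    by (simp add: tree_prod_ptree[OF F G] linmap_simps[OF linmap_bilin_left])
  also have "\<dots> = (\<Sum>s\<in>verts F. \<Sum>x\<in>verts (graft F s G). basis (iso_class (graft (graft F s G) x H)))"
    by (intro sum.cong HOL.refl tree_prod_ptree[OF ptree_graft[OF F G] H])
  also have "\<dots> = (\<Sum>s\<in>verts F. \<Sum>s'\<in>verts F. basis (iso_class (graft (graft F s G) (Inl s') H)))
      + (\<Sum>s\<in>verts F. \<Sum>t\<in>verts G. basis (iso_class (graft (graft F s G) (Inr t) H)))"
    by (simp only: sum_verts_graft[OF fin] sum.distrib)
  also have "(\<Sum>s\<in>verts F. \<Sum>t\<in>verts G. basis (iso_class (graft (graft F s G) (Inr t) H)))
      = (\<Sum>s\<in>verts F. \<Sum>t\<in>verts G. basis (iso_class (graft F s (graft G t H))) :: _ \<Rightarrow>\<^sub>0 'k)"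
  proof (intro sum.cong HOL.refl arg_cong[of _ _ basis])
    fix s t assume "s \<in> verts F" "t \<in> verts G"
    then show "iso_class (graft (graft F s G) (Inr t) H) = iso_class (graft F s (graft G t H))"
      by (intro ptree_iso_class_eqI[OF ptree_graft[OF ptree_graft[OF F G] H]] graft_assoc) simp_all
  qed
  also have "\<dots> = (\<Sum>t\<in>verts G. tree_prod (iso_class F) (iso_class (graft G t H)))"
    by (subst sum.swap) (intro sum.cong HOL.refl tree_prod_ptree[OF F ptree_graft[OF G H], symmetric])
  also have "\<dots> = bilin tree_prod (basis (iso_class F)) (tree_prod (iso_class G) (iso_class H))"
    by (simp add: tree_prod_ptree[OF G H] linear_extend_simps)
  finally show ?thesis by simp
qed

lemma tree_prod_prelie_swap:
  fixes F :: "('a, 'd) pforest" and G :: "('b, 'd) pforest" and H :: "('c, 'd) pforest"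
  assumes F: "ptree W F" and G: "ptree W G" and H: "ptree W H"
  shows "(\<Sum>s\<in>verts F. \<Sum>s'\<in>verts F. basis (iso_class (graft (graft F s G) (Inl s') H)))
    = (\<Sum>s\<in>verts F. \<Sum>s'\<in>verts F. basis (iso_class (graft (graft F s H) (Inl s') G)) :: _ \<Rightarrow>\<^sub>0 'k::field_char_0)"
  by (subst sum.swap)
    (intro sum.cong HOL.refl arg_cong[of _ _ basis]
      ptree_iso_class_eqI[OF ptree_graft[OF ptree_graft[OF F G] H]] graft_graft_swap; simp)

lemma sum_St_index_graft:
  fixes F :: "('a, 'd) pforest" and G :: "('b, 'd) pforest"
    and f :: "('a + 'b) \<times> ('a + 'b) set \<Rightarrow> 'c::ab_group_add"
  assumes F: "ptree W F" and G: "ptree W G" and s: "s \<in> verts F"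
  shows "(\<Sum>x\<in>St_index (graft F s G). f x) = (\<Sum>x\<in>St_index F. f (Inl (fst x), Inl ` snd x))
    + (if s \<in> roots F then f (Inl s, Inr ` roots G) else 0)"
proof -
  have "inj_on (map_prod Inl ((`) Inl) :: _ \<Rightarrow> ('a + 'b) \<times> ('a + 'b) set) (St_index F)"
    by (intro inj_onI) (auto simp: inj_image_eq_iff)
  then have reindex: "(\<Sum>x\<in>map_prod Inl ((`) Inl) ` St_index F. f x) = (\<Sum>x\<in>St_index F. f (Inl (fst x), Inl ` snd x))"
    by (simp add: sum.reindex case_prod_unfold map_prod_def comp_def)
  have "(Inl s, Inr ` roots G) \<notin> (map_prod Inl ((`) Inl) ` St_index F :: (('a + 'b) \<times> ('a + 'b) set) set)"
    using ptree_roots(2)[OF G] by auto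
  then show ?thesis
    unfolding St_index_graft[OF F G s] using finite_St_index[OF F] by (simp add: reindex[symmetric] add.commute)
qed

lemma St_index_cut: "ptree W F \<Longrightarrow> x \<in> St_index F \<Longrightarrow> cut W F (fst x) (snd x)"
  by (simp add: cut_def)

text \<open>The new cut exists only when s is a root, so it contributes the same term once per root,
  and the normalisation leaves a single F \<otimes> G. An old cut gives one of the two remaining
  sums according to the position of s.\<close>

lemma norm_coprod_tree_prod:
  fixes F :: "('a, 'd) pforest" and G :: "('b, 'd) pforest"
  assumes F: "ptree W F" and G: "ptree W G"
  shows "linear_extend norm_coprod (tree_prod (iso_class F) (iso_class G))
    = basis (iso_class F, iso_class G)
      + linear_extend (\<lambda>(p, q). tensor (tree_prod p (iso_class G)) (basis q)) (norm_coprod (iso_class F))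
      + (linear_extend (\<lambda>(p, q). tensor (basis p) (tree_prod q (iso_class G))) (norm_coprod (iso_class F))
          :: _ \<Rightarrow>\<^sub>0 'k::field_char_0)"
proof -
  let ?c = "inverse (of_nat (card (roots F))) :: 'k" and ?G = "iso_class G"
  have roots: "roots F \<subseteq> verts F" "card (roots F) \<noteq> 0"
    using card_roots_pos[OF F] by (auto simp: roots_def)
  define \<psi> where "\<psi> s x = (basis (cut_rest (graft F s G) (Inl (fst x), Inl ` snd x),
      cut_sub (graft F s G) (Inl (fst x), Inl ` snd x)) :: _ \<Rightarrow>\<^sub>0 'k)" for s x
  have "linear_extend norm_coprod (tree_prod (iso_class F) ?G)
      = (\<Sum>s\<in>verts F. norm_coprod (iso_class (graft F s G)))"
    by (simp add: tree_prod_ptree[OF F G] linear_extend_simps)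
  also have "\<dots> = (\<Sum>s\<in>verts F. scale ?c ((\<Sum>x\<in>St_index F. \<psi> s x)
      + (if s \<in> roots F then basis (iso_class F, ?G) else 0)))"
  proof (rule sum.cong[OF HOL.refl])
    fix s assume s: "s \<in> verts F"
    have "card (roots (graft F s G)) = card (roots F)"
      by (simp add: roots_graft[OF s] card_image)
    then show "norm_coprod (iso_class (graft F s G)) = scale ?c ((\<Sum>x\<in>St_index F. \<psi> s x)
      + (if s \<in> roots F then basis (iso_class F, ?G) else 0))"
      by (simp add: norm_coprod_ptree[OF ptree_graft[OF F G s]] sum_St_index_graft[OF F G s] \<psi>_def
          cut_new[OF F G])
  qed
  also have "\<dots> = scale ?c (\<Sum>s\<in>verts F. \<Sum>x\<in>St_index F. \<psi> s x)
      + scale ?c (\<Sum>s\<in>verts F. if s \<in> roots F then basis (iso_class F, ?G) else 0)"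
    by (simp add: scale_add sum.distrib scale_sum)
  also have "(\<Sum>s\<in>verts F. if s \<in> roots F then basis (iso_class F, ?G) else 0)
      = (scale (of_nat (card (roots F))) (basis (iso_class F, ?G)) :: _ \<Rightarrow>\<^sub>0 'k)"
    using roots(1) ptreeD(3)[OF F]
    by (simp add: sum.If_cases Int_absorb1 sum_const_scale)
  also have "scale ?c (scale (of_nat (card (roots F))) (basis (iso_class F, ?G))) = basis (iso_class F, ?G)"
    using roots(2) by simp
  also have "(\<Sum>s\<in>verts F. \<Sum>x\<in>St_index F. \<psi> s x) = (\<Sum>x\<in>St_index F. \<Sum>s\<in>verts F. \<psi> s x)"
    by (rule sum.swap)
  also have "\<dots> = (\<Sum>x\<in>St_index F. tensor (tree_prod (cut_rest F x) ?G) (basis (cut_sub F x)))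
      + (\<Sum>x\<in>St_index F. tensor (basis (cut_rest F x)) (tree_prod (cut_sub F x) ?G))"
    unfolding sum.distrib[symmetric]
  proof (rule sum.cong[OF HOL.refl])
    fix x assume x: "x \<in> St_index F"
    interpret cut W F "fst x" "snd x" by (rule St_index_cut[OF F x])
    let ?D = "desc F (snd x)"
    have cg: "cut_graft W F (fst x) (snd x) G s" if "s \<in> verts F" for s
      using that G by (intro cut_graft.intro cut_graft_axioms.intro cut_axioms)
    \<comment> \<open>For a fixed cut the vertices s are divided into those that stay
      (\<open>cut_beside\<close>) and those that are carried off (\<open>cut_below\<close>).\<close>
    have "(\<Sum>s\<in>verts F. \<psi> s x) = (\<Sum>s\<in>verts F - ?D. \<psi> s x) + (\<Sum>s\<in>?D. \<psi> s x)"
      by (rule sum.subset_diff[OF desc_verts ptreeD(3)[OF F]])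
    also have "(\<Sum>s\<in>verts F - ?D. \<psi> s x)
        = (\<Sum>s\<in>verts F - ?D. basis (iso_class (graft (St_rest F (snd x)) s G), cut_sub F x))"
    proof (rule sum.cong[OF HOL.refl])
      fix s assume sD: "s \<in> verts F - ?D"
      then interpret cut_graft W F "fst x" "snd x" G s by (intro cg) simp
      show "\<psi> s x = basis (iso_class (graft (St_rest F (snd x)) s G), cut_sub F x)"
      proof -
        have "s \<notin> ?D" using sD by simp
        from cut_beside[OF this] show ?thesis by (simp only: \<psi>_def fst_conv snd_conv)
      qed
    qed
    also have "\<dots> = tensor (tree_prod (cut_rest F x) ?G) (basis (cut_sub F x))"
      by (simp add: tree_prod_ptree[OF ptree_St_rest G] verts_St linmap_simps[OF linmap_bilin_left])
    also have "(\<Sum>s\<in>?D. \<psi> s x) = (\<Sum>s\<in>?D. basis (cut_rest F x, iso_class (graft (St_sub F (snd x)) s G)))"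
    proof (rule sum.cong[OF HOL.refl])
      fix s assume sD: "s \<in> ?D"
      then interpret cut_graft W F "fst x" "snd x" G s using desc_verts by (intro cg) blast
      show "\<psi> s x = basis (cut_rest F x, iso_class (graft (St_sub F (snd x)) s G))"
        by (simp only: \<psi>_def fst_conv snd_conv cut_below[OF sD])
    qed
    also have "\<dots> = tensor (basis (cut_rest F x)) (tree_prod (cut_sub F x) ?G)"
      by (simp add: tree_prod_ptree[OF ptree_St_sub G] verts_St linear_extend_simps)
    finally show "(\<Sum>s\<in>verts F. \<psi> s x) = tensor (tree_prod (cut_rest F x) ?G) (basis (cut_sub F x))
        + tensor (basis (cut_rest F x)) (tree_prod (cut_sub F x) ?G)" .
  qed
  finally show ?thesis
    by (simp add: norm_coprod_ptree[OF F] linear_extend_simps scale_add add_ac del: bilin_basis)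
qed

lemma sum_pairs_swap:
  assumes "finite S"
  shows "(\<Sum>x\<in>S. \<Sum>y\<in>S - {x}. f x y) = (\<Sum>y\<in>S. \<Sum>x\<in>S - {y}. f x y :: 'c::ab_group_add)"
proof -
  have "(\<Sum>x\<in>S. \<Sum>y\<in>S - {x}. f x y) = (\<Sum>x\<in>S. \<Sum>y\<in>S. if x = y then 0 else f x y)"
    using assms by (intro sum.cong HOL.refl sum.mono_neutral_cong_left) auto
  also have "\<dots> = (\<Sum>y\<in>S. \<Sum>x\<in>S. if x = y then 0 else f x y)" by (rule sum.swap)
  also have "\<dots> = (\<Sum>y\<in>S. \<Sum>x\<in>S - {y}. f x y)"
    using assms by (intro sum.cong HOL.refl sum.mono_neutral_cong_right) auto
  finally show ?thesis .
qed

text \<open>Both sides run over ordered pairs of distinct cuts, with the piece of one cut required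
  to be t. What remains after two cuts does not depend on their order, and both are normalised by
  the same number of roots.\<close>

lemma norm_coprod_comm:
  fixes F :: "('a, 'd) pforest"
  assumes F: "ptree W F"
  shows "linear_extend (\<lambda>(p, q). tensor (slice t (norm_coprod p)) (basis q)) (norm_coprod (iso_class F))
    = (linear_extend norm_coprod (slice t (norm_coprod (iso_class F))) :: _ \<Rightarrow>\<^sub>0 'k::field_char_0)"
proof -
  let ?c = "inverse (of_nat (card (roots F))) :: 'k" and ?S = "St_index F"
  define R where "R x y = iso_class (restrict_to F (verts F - desc F (snd x) - desc F (snd y)))"
    for x y :: "'a \<times> 'a set"
  have R_comm: "R x y = R y x" for x y
  proof -
    have "verts F - desc F (snd x) - desc F (snd y) = verts F - desc F (snd y) - desc F (snd x)" by blast
    then show ?thesis by (simp only: R_def)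
  qed
  \<comment> \<open>The constant is again that of F, because the cut leaves the roots
    untouched.\<close>
  have rest: "norm_coprod (cut_rest F x) = scale ?c (\<Sum>y\<in>?S - {x}. basis (R x y, cut_sub F y))"
    if x: "x \<in> ?S" for x
  proof -
    interpret cut W F "fst x" "snd x" by (rule St_index_cut[OF F x])
    have "basis (cut_rest (St_rest F (snd x)) y, cut_sub (St_rest F (snd x)) y) = basis (R x y, cut_sub F y)"
      if y: "y \<in> ?S - {x}" for y
    proof -
      interpret c': cut W F "fst y" "snd y" using y by (intro St_index_cut[OF F]) simp
      have "snd x \<noteq> snd y"
      proof
        assume eq: "snd x = snd y"
        have "(fst x, snd x) \<in> ?S" "(fst y, snd y) \<in> ?S" using x y by simp_all
        then have "fst x = fst y" unfolding eq by (rule St_index_root_unique[OF F])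
        then show False using eq y by (simp add: prod_eq_iff)
      qed
      then interpret two_cuts W F "fst x" "snd x" "fst y" "snd y"
        by (intro two_cuts.intro two_cuts_axioms.intro cut_axioms c'.cut_axioms)
      show ?thesis by (simp only: St_rest_St_rest St_sub_St_rest R_def)
    qed
    then show ?thesis
      unfolding norm_coprod_ptree[OF ptree_St_rest] roots_St_rest St_index_St_rest prod.collapse
      by (intro arg_cong[of _ _ "scale ?c"] sum.cong[OF HOL.refl])
  qed
  have "linear_extend (\<lambda>(p, q). tensor (slice t (norm_coprod p)) (basis q)) (norm_coprod (iso_class F))
    = scale ?c (\<Sum>x\<in>?S. tensor (slice t (norm_coprod (cut_rest F x))) (basis (cut_sub F x)))"
    by (simp add: norm_coprod_ptree[OF F] linear_extend_simps)
  also have "(\<Sum>x\<in>?S. tensor (slice t (norm_coprod (cut_rest F x))) (basis (cut_sub F x)))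
    = (\<Sum>x\<in>?S. \<Sum>y\<in>?S - {x}. if cut_sub F y = t then scale ?c (basis (R x y, cut_sub F x)) else 0)"
  proof (rule sum.cong[OF HOL.refl])
    fix x assume x: "x \<in> ?S"
    have "tensor (slice t (norm_coprod (cut_rest F x))) (basis (cut_sub F x))
      = (\<Sum>y\<in>?S - {x}. scale ?c (tensor (slice t (basis (R x y, cut_sub F y))) (basis (cut_sub F x))))"
      by (simp only: rest[OF x] linmap_simps[OF linmap_slice] linmap_simps[OF linmap_bilin_left] scale_sum)
    also have "\<dots> = (\<Sum>y\<in>?S - {x}. if cut_sub F y = t then scale ?c (basis (R x y, cut_sub F x)) else 0)"
      by (rule sum.cong[OF HOL.refl]) (simp add: slice_basis linmap_simps(1)[OF linmap_bilin_left])
    finally show "tensor (slice t (norm_coprod (cut_rest F x))) (basis (cut_sub F x))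
      = (\<Sum>y\<in>?S - {x}. if cut_sub F y = t then scale ?c (basis (R x y, cut_sub F x)) else 0)" .
  qed
  also have "\<dots> = (\<Sum>y\<in>?S. \<Sum>x\<in>?S - {y}. if cut_sub F y = t then scale ?c (basis (R x y, cut_sub F x)) else 0)"
    by (rule sum_pairs_swap[OF finite_St_index[OF F]])
  also have "\<dots> = (\<Sum>y\<in>?S. if cut_sub F y = t then norm_coprod (cut_rest F y) else 0)"
  proof (rule sum.cong[OF HOL.refl])
    fix y assume y: "y \<in> ?S"
    have "norm_coprod (cut_rest F y) = (\<Sum>x\<in>?S - {y}. scale ?c (basis (R x y, cut_sub F x)))"
      unfolding rest[OF y] scale_sum R_comm[of y] ..
    then show "(\<Sum>x\<in>?S - {y}. if cut_sub F y = t then scale ?c (basis (R x y, cut_sub F x)) else 0)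
      = (if cut_sub F y = t then norm_coprod (cut_rest F y) else 0)" by simp
  qed
  also have "\<dots> = (\<Sum>y\<in>?S. linear_extend norm_coprod (slice t (basis (cut_rest F y, cut_sub F y))))"
    by (rule sum.cong[OF HOL.refl]) (simp add: slice_basis linear_extend_simps)
  also have "scale ?c \<dots> = linear_extend norm_coprod (slice t (norm_coprod (iso_class F)))"
    by (simp only: norm_coprod_ptree[OF F] linear_extend_simps linmap_simps[OF linmap_slice])
  finally show ?thesis .
qed

section \<open>Partitioned trees as an instance of the abstract setting\<close>

interpretation pt: prelie_coalgebra "PT D - {empty_class} :: 'd pt_class set" num_verts tree_prod
    "norm_coprod :: 'd pt_class \<Rightarrow> _ \<Rightarrow>\<^sub>0 'k::field_char_0" for D
proof
  fix A :: "'d pt_class" assume "A \<in> PT D - {empty_class}"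
  then obtain F :: "(nat, 'd) pforest" where F: "ptree D F" "A = iso_class F" by (rule PT_nonempty_cases)
  show "0 < num_verts A"
    using ptreeD(3,4)[OF F(1)] by (simp add: F(2) num_iso_class(1)[OF F(1)] card_gt_0_iff)
  have cutx: "cut_rest F x \<in> PT D - {empty_class} \<and> cut_sub F x \<in> PT D - {empty_class}
      \<and> num_verts (cut_rest F x) + num_verts (cut_sub F x) = card (verts F)" if x: "x \<in> St_index F" for x
  proof -
    interpret cut D F "fst x" "snd x" by (rule St_index_cut[OF F(1) x])
    show ?thesis
      using iso_class_mem[OF ptree_St_rest] iso_class_mem[OF ptree_St_sub] card_verts_St
      by (simp add: num_iso_class(1)[OF ptree_St_rest] num_iso_class(1)[OF ptree_St_sub])
  qed
  have "Poly_Mapping.keys (tree_coprod A :: _ \<Rightarrow>\<^sub>0 'k)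
      \<subseteq> {(s, t). s \<in> PT D - {empty_class} \<and> t \<in> PT D - {empty_class} \<and> num_verts s + num_verts t = num_verts A}"
    unfolding F(2) tree_coprod_ptree[OF F(1)] num_iso_class(1)[OF F(1)]
    by (rule keys_sum_basis) (use cutx in simp)
  then show "Poly_Mapping.keys (norm_coprod A :: _ \<Rightarrow>\<^sub>0 'k)
      \<subseteq> {(s, t). s \<in> PT D - {empty_class} \<and> t \<in> PT D - {empty_class} \<and> num_verts s + num_verts t = num_verts A}"
    unfolding norm_coprod_def by (rule order_trans[OF keys_scale_subset])
  show "linear_extend (\<lambda>(p, q). tensor (slice s (norm_coprod p)) (basis q)) (norm_coprod A)
      = (linear_extend norm_coprod (slice s (norm_coprod A)) :: _ \<Rightarrow>\<^sub>0 'k)" for s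
    unfolding F(2) by (rule norm_coprod_comm[OF F(1)])
  fix B :: "'d pt_class" assume "B \<in> PT D - {empty_class}"
  then obtain G :: "(nat, 'd) pforest" where G: "ptree D G" "B = iso_class G" by (rule PT_nonempty_cases)
  show "Poly_Mapping.keys (tree_prod A B :: _ \<Rightarrow>\<^sub>0 'k)
      \<subseteq> {c \<in> PT D - {empty_class}. num_verts c = num_verts A + num_verts B}"
    unfolding F(2) G(2) tree_prod_ptree[OF F(1) G(1)]
  proof (rule keys_sum_basis)
    fix s assume "s \<in> verts F"
    note H = ptree_graft[OF F(1) G(1) this]
    show "iso_class (graft F s G) \<in> {c \<in> PT D - {empty_class}. num_verts c = num_verts (iso_class F) + num_verts (iso_class G)}"
      using iso_class_mem[OF H]
      by (simp add: num_iso_class(1)[OF H] num_iso_class(1)[OF F(1)] num_iso_class(1)[OF G(1)]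
          card_verts_graft[OF ptreeD(3)[OF F(1)] ptreeD(3)[OF G(1)]])
  qed
  show "linear_extend norm_coprod (tree_prod A B)
    = basis (A, B) + linear_extend (\<lambda>(p, q). tensor (tree_prod p B) (basis q)) (norm_coprod A)
      + (linear_extend (\<lambda>(p, q). tensor (basis p) (tree_prod q B)) (norm_coprod A) :: _ \<Rightarrow>\<^sub>0 'k)"
    unfolding F(2) G(2) by (rule norm_coprod_tree_prod[OF F(1) G(1)])
  fix C :: "'d pt_class" assume "C \<in> PT D - {empty_class}"
  then obtain H :: "(nat, 'd) pforest" where H: "ptree D H" "C = iso_class H" by (rule PT_nonempty_cases)
  show "bilin tree_prod (tree_prod A B) (basis C) - bilin tree_prod (basis A) (tree_prod B C)
    = bilin tree_prod (tree_prod A C) (basis B) - (bilin tree_prod (basis A) (tree_prod C B) :: _ \<Rightarrow>\<^sub>0 'k)"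
    unfolding F(2) G(2) H(2) tree_prod_prelie[OF F(1) G(1) H(1)] tree_prod_prelie[OF F(1) H(1) G(1)]
    by (rule tree_prod_prelie_swap[OF F(1) G(1) H(1)])
qed

lemma CP_plus_eq_alg: "CP_plus D = pt.alg D"
  unfolding CP_plus_def pt.alg_def bilin_def by simp

text \<open>An element may mix trees with different numbers of roots, so the normalising constants
  do not factor out of its coproduct. They can be read off the terms: a cut leaves all roots in the
  left factor, so rescaling each term by the number of roots of its left factor, or by the inverse,
  passes between the two coproducts.\<close>

lemma Ker_coprod_eq_prim: "Ker_coprod D = (pt.prim D :: ('d pt_class \<Rightarrow>\<^sub>0 'k::field_char_0) set)"
proof -
  let ?w = "\<lambda>p. of_nat (num_roots p) :: 'k"
  let ?N = "linear_extend (\<lambda>pq. scale (inverse (?w (fst pq))) (basis pq))"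
    and ?M = "linear_extend (\<lambda>pq. scale (?w (fst pq)) (basis pq))"
  have weight: "num_roots (cut_rest F y) = card (roots F)" if "ptree D F" "y \<in> St_index F" for F :: "(nat, 'd) pforest" and y
  proof -
    interpret cut D F "fst y" "snd y" by (rule St_index_cut[OF that])
    show ?thesis by (simp add: num_iso_class(2)[OF ptree_St_rest] roots_St_rest)
  qed
  have N: "?N (coprod x) = linear_extend norm_coprod x" and M: "?M (linear_extend norm_coprod x) = coprod x"
    if x: "Poly_Mapping.keys x \<subseteq> PT D - {empty_class}" for x :: "'d pt_class \<Rightarrow>\<^sub>0 'k"
  proof -
    have *: "?N (tree_coprod A) = norm_coprod A \<and> ?M (norm_coprod A) = tree_coprod A"
      if A: "A \<in> Poly_Mapping.keys x" for A
    proof -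
      obtain F :: "(nat, 'd) pforest" where F: "ptree D F" "A = iso_class F"
        using PT_nonempty_cases[OF subsetD[OF x A]] by blast
      have nz: "of_nat (card (roots F)) \<noteq> (0 :: 'k)" using card_roots_pos[OF F(1)] by simp
      show ?thesis
        unfolding F(2) norm_coprod_ptree[OF F(1)] tree_coprod_ptree[OF F(1)]
        using nz by (simp add: linear_extend_simps weight[OF F(1)] scale_sum)
    qed
    show "?N (coprod x) = linear_extend norm_coprod x"
      unfolding coprod_def
      by (subst linmap_linear_extend_apply[OF linmap_linear_extend]) (rule linear_extend_cong, use * in blast)
    show "?M (linear_extend norm_coprod x) = coprod x"
      unfolding coprod_def
      by (subst linmap_linear_extend_apply[OF linmap_linear_extend]) (rule linear_extend_cong, use * in blast)
  qed
  have "coprod x = 0 \<longleftrightarrow> linear_extend norm_coprod x = (0 :: _ \<Rightarrow>\<^sub>0 'k)"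
    if "Poly_Mapping.keys x \<subseteq> PT D - {empty_class}" for x :: "'d pt_class \<Rightarrow>\<^sub>0 'k"
  proof
    assume "coprod x = 0"
    then show "linear_extend norm_coprod x = (0 :: _ \<Rightarrow>\<^sub>0 'k)"
      using N[OF that] by (simp add: linear_extend_simps)
  next
    assume "linear_extend norm_coprod x = (0 :: _ \<Rightarrow>\<^sub>0 'k)"
    then show "coprod x = 0" using M[OF that] by (simp add: linear_extend_simps)
  qed
  then show ?thesis unfolding Ker_coprod_def pt.prim_def CP_plus_def by auto
qed

theorem proposition3p7:
  fixes D :: "'d set"
  shows "freely_generated_by
    (CP_plus D :: ('k::field_char_0, 'd pt_class \<Rightarrow>\<^sub>0 'k) module) (Ker_coprod D)"
  unfolding CP_plus_eq_alg Ker_coprod_eq_prim by (rule pt.freely_generated_by_prim)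

end
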